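(* Let the pair of functions $(u(x,t), s(t))$ be a classical solution of Problem $P$ with data $\lambda,\sigma,b,f,\varphi$ (i.e. it satisfies (i), (ii), (iii) of the context). Then the free boundary $x=s(t)$, $t\in(0,\infty)$, is an infinitely differentiable curve, i.e. $s\in C^\infty((0,\infty))$, if and only if $f\in C^\infty((0,\infty))$.
   Context: Problem $P$. Let $\lambda>0$, $\sigma>0$, $b>0$ be constants, and let $f:[0,\infty)\to\mathbb{R}$ and $\varphi:[0,b]\to\mathbb{R}$ be given functions with $\varphi(0)=f(0)$. Find $s(t)>0$ and $u(x,t)$ such that (P1) $u_t = u_{xx}-\lambda u$ for $0<x<s(t)$, $t>0$; (P2) $u(0,t)=f(t)$ for $t\ge 0$; (P3) $u(x,0)=\varphi(x)$ for $x\in[0,b]$, and $s(0)=b$; (P4) $u_x(s(t),t)=0$ for $t>0$; (P5) $s'(t)=\int_0^{s(t)}(u(x,t)-\sigma)\,dx$ for $t>0$. A classical solution of Problem $P$ is a pair $(u,s)$ such that: (i) $u(x,t)$ is defined, continuous and has continuous partial derivatives $u_x,u_t,u_{xx}$ in the domain $\{(x,t): 0\le x\le s(t),\ t\ge 0\}$ (one-sided derivatives at the boundary); (ii) $s\in C^1([0,\infty))$ and $s(t)>0$ for $t\ge 0$; (iii) conditions (P1)–(P5) hold. *)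

theory Defs
  imports "HOL-Analysis.Analysis"
begin

definition fb_domain :: "(real \<Rightarrow> real) \<Rightarrow> (real \<times> real) set" where
  "fb_domain s = {(x, t). 0 \<le> x \<and> x \<le> s t \<and> 0 \<le> t}"

(* All derivatives are taken within the sections of the domain, hence one-sided at its boundary.
   A section in the t-direction may have isolated points (x = s(t) at a strict local maximum of s);
   there the condition on ut is vacuous and ut is only the continuous extension of u_t. *)
definition has_continuous_partials ::
    "(real \<Rightarrow> real) \<Rightarrow> (real \<Rightarrow> real \<Rightarrow> real) \<Rightarrow> (real \<Rightarrow> real \<Rightarrow> real) \<Rightarrow>
     (real \<Rightarrow> real \<Rightarrow> real) \<Rightarrow> (real \<Rightarrow> real \<Rightarrow> real) \<Rightarrow> bool" where
  "has_continuous_partials s u ux ut uxx \<longleftrightarrow>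
     continuous_on (fb_domain s) (\<lambda>(x, t). u x t) \<and>
     continuous_on (fb_domain s) (\<lambda>(x, t). ux x t) \<and>
     continuous_on (fb_domain s) (\<lambda>(x, t). ut x t) \<and>
     continuous_on (fb_domain s) (\<lambda>(x, t). uxx x t) \<and>
     (\<forall>(x, t) \<in> fb_domain s.
        ((\<lambda>y. u y t) has_real_derivative ux x t) (at x within {y. (y, t) \<in> fb_domain s}) \<and>
        ((\<lambda>\<tau>. u x \<tau>) has_real_derivative ut x t) (at t within {\<tau>. (x, \<tau>) \<in> fb_domain s}) \<and>
        ((\<lambda>y. ux y t) has_real_derivative uxx x t) (at x within {y. (y, t) \<in> fb_domain s}))"

(* f, \<phi>, s and u are total functions whose values outside [0,\<infinity>), [0,b], [0,\<infinity>) and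
   fb_domain s, respectively, play no role. *)
definition classical_solution ::
    "real \<Rightarrow> real \<Rightarrow> real \<Rightarrow> (real \<Rightarrow> real) \<Rightarrow> (real \<Rightarrow> real) \<Rightarrow>
     (real \<Rightarrow> real \<Rightarrow> real) \<Rightarrow> (real \<Rightarrow> real) \<Rightarrow> bool" where
  "classical_solution lam \<sigma> b f \<phi> u s \<longleftrightarrow>
     (\<exists>ux ut uxx s'.
        has_continuous_partials s u ux ut uxx \<and>
        (\<forall>t\<ge>0. (s has_real_derivative s' t) (at t within {0..})) \<and>
        continuous_on {0..} s' \<and>
        (\<forall>t\<ge>0. s t > 0) \<and>
        (\<forall>t>0. \<forall>x. 0 < x \<and> x < s t \<longrightarrow> ut x t = uxx x t - lam * u x t) \<and>
        (\<forall>t\<ge>0. u 0 t = f t) \<and>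
        (\<forall>x\<in>{0..b}. u x 0 = \<phi> x) \<and> s 0 = b \<and>
        (\<forall>t>0. ux (s t) t = 0) \<and>
        (\<forall>t>0. s' t = integral {0..s t} (\<lambda>x. u x t - \<sigma>)))"

(* Intended for open S only: deriv is the two-sided derivative. *)
definition C_infinity_on :: "real set \<Rightarrow> (real \<Rightarrow> real) \<Rightarrow> bool" where
  "C_infinity_on S g \<longleftrightarrow> (\<forall>k. \<forall>t\<in>S. ((deriv ^^ k) g) field_differentiable (at t))"

end

theory Submission
  imports Defs "HOL-Probability.Probability" "HOL-Real_Asymp.Real_Asymp"
begin

text \<open>
  Multiplying the solution by \<open>exp (lam * t)\<close> turns the equation into the heat equation for a
  function \<open>w\<close> on \<open>0 < x < s t\<close> with a homogeneous Neumann condition on the free boundary. The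
  boundary of the domain carries three unknown functions of time: the Dirichlet trace \<open>w 0\<close>, which is
  \<open>f\<close> up to the exponential factor, the Neumann trace \<open>wx 0\<close>, and the trace \<open>v t = w (s t) t\<close> on the
  free boundary. Differentiating the integral condition for \<open>s'\<close> and using the heat equation gives
  the ordinary differential equation
  \<open>s'' = exp (- lam * t) * (s' * v - wx 0) - lam * (s' + \<sigma> * s) - \<sigma> * s'\<close>,
  so everything is a question about the regularity of functions of one variable, the traces.

  Green's identity on the moving domain, tested with the heat kernel (\<open>green_identity\<close>,
  \<open>boundary_representation\<close>), produces one integral equation on each boundary component. Let
  \<open>J h t\<close> be the integral of \<open>h \<tau> / sqrt (t - \<tau>)\<close> over \<open>\<tau>\<close> between \<open>c\<close> and \<open>t\<close>, where \<open>c > 0\<close> is an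
  arbitrary starting time; starting at \<open>c\<close> avoids all compatibility questions at the corner
  \<open>t = 0\<close>, because the contribution of the time \<open>c\<close> is smooth for \<open>t > c\<close>.

  \<^item> On \<open>x = 0\<close>: \<open>w 0 = F - const * J (wx 0)\<close> with \<open>F\<close> smooth, because the free boundary stays away
    from \<open>x = 0\<close> and the heat kernel is flat there. Since \<open>J (J h)\<close> is \<open>\<pi>\<close> times the integral of \<open>h\<close>
    (\<open>abel_abel\<close>), the Dirichlet trace is smooth if and only if the Neumann trace is
    (\<open>dirichlet_of_neumann\<close>, \<open>neumann_of_dirichlet\<close>), whatever the regularity of \<open>s\<close>.
  \<^item> On \<open>x = s t\<close>: \<open>v t = F t + J (a t * v) t\<close>, where \<open>F\<close> is as regular as \<open>s\<close> and \<open>a t \<tau>\<close> has one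
    derivative less than \<open>s\<close>. On the diagonal \<open>a\<close> equals \<open>d \<tau> = const * s' \<tau>\<close>, and a kernel that
    vanishes on the diagonal makes \<open>J\<close> gain a full derivative (\<open>abel_gain_Ck\<close>). Hence
    \<open>v = J (d * v) + R\<close> with \<open>R\<close> one derivative better than \<open>v\<close>. Inserting the equation into itself
    produces \<open>J (d * J (d * v))\<close>; commuting \<open>d\<close> with the outer \<open>J\<close> costs only a kernel that vanishes
    on the diagonal, and \<open>J J\<close> is an integration, so \<open>v\<close> gains a derivative: if \<open>s\<close> is of class
    \<open>C^(k+2)\<close> and \<open>v\<close> of class \<open>C^k\<close>, then \<open>v\<close> is of class \<open>C^(k+1)\<close> (\<open>free_trace_gain\<close>).

  If \<open>f\<close> is smooth, so is \<open>wx 0\<close>, and the differential equation for \<open>s\<close> together with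
  \<open>free_trace_gain\<close> raises the regularity of \<open>s\<close> and \<open>v\<close> alternately, starting from \<open>s\<close> of class
  \<open>C^1\<close> and \<open>v\<close> continuous. If \<open>s\<close> is smooth, so is \<open>v\<close> by \<open>free_trace_gain\<close>; the differential equation
  then shows that \<open>wx 0\<close> is smooth, hence also \<open>w 0\<close> and \<open>f\<close>.
\<close>

section \<open>Functions of class C^k depending on a parameter\<close>

text \<open>
  The first variable is time and is the only one in which derivatives are taken; the parameter enters
  only through joint continuity. This is what differentiation under the integral sign needs, and it
  permits densities that are merely continuous in the integration variable.
\<close>

primrec Ck_param :: "nat \<Rightarrow> real set \<Rightarrow> 'p::topological_space set \<Rightarrow> (real \<Rightarrow> 'p \<Rightarrow> real) \<Rightarrow> bool" where
  "Ck_param 0 I P F \<longleftrightarrow> continuous_on (I \<times> P) (\<lambda>(t, p). F t p)"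
| "Ck_param (Suc k) I P F \<longleftrightarrow> continuous_on (I \<times> P) (\<lambda>(t, p). F t p) \<and>
     (\<exists>F'. (\<forall>t\<in>I. \<forall>p\<in>P. ((\<lambda>t. F t p) has_real_derivative F' t p) (at t)) \<and> Ck_param k I P F')"

text \<open>
  A function without parameter is one whose parameter ranges over a single point, so that every rule
  for \<open>Ck_param\<close> also serves \<open>Ck\<close>.
\<close>

definition Ck :: "nat \<Rightarrow> real set \<Rightarrow> (real \<Rightarrow> real) \<Rightarrow> bool" where
  "Ck k I f \<longleftrightarrow> Ck_param k I {0::real} (\<lambda>t _. f t)"

lemma Ck_param_continuous: "Ck_param k I P F \<Longrightarrow> continuous_on (I \<times> P) (\<lambda>(t, p). F t p)"
  by (cases k) auto

lemma Ck_param_SucD: "Ck_param (Suc k) I P F \<Longrightarrow> Ck_param k I P F"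
  by (induction k arbitrary: F) auto

lemma Ck_param_le: assumes "Ck_param n I P F" "m \<le> n" shows "Ck_param m I P F"
  using assms(2,1) by (induction rule: dec_induct) (auto dest: Ck_param_SucD simp del: Ck_param.simps)

lemma Ck_param_SucI:
  assumes "Ck_param k I P F" "Ck_param k I P F'"
    and "\<And>t p. t \<in> I \<Longrightarrow> p \<in> P \<Longrightarrow> ((\<lambda>t. F t p) has_real_derivative F' t p) (at t)"
  shows "Ck_param (Suc k) I P F"
  using assms Ck_param_continuous by auto

lemma Ck_param_subset:
  assumes "Ck_param k I P F" "I' \<subseteq> I" "P' \<subseteq> P" shows "Ck_param k I' P' F"
  using assms(1)
proof (induction k arbitrary: F)
  case 0 then show ?case using assms(2,3) by (auto intro: continuous_on_subset)
next
  case (Suc k)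
  then show ?case using assms(2,3)
    by (auto intro: continuous_on_subset) (metis subsetD)
qed

lemma Ck_param_cong:
  assumes F: "Ck_param k I P F" and I: "open I" and eq: "\<And>t p. t \<in> I \<Longrightarrow> p \<in> P \<Longrightarrow> F t p = G t p"
  shows "Ck_param k I P G"
proof -
  have c: "continuous_on (I \<times> P) (\<lambda>(t, p). G t p)"
    using Ck_param_continuous[OF F] by (rule continuous_on_eq) (use eq in auto)
  show ?thesis
  proof (cases k)
    case (Suc j)
    have d: "((\<lambda>t. G t p) has_real_derivative F' t p) (at t)"
      if "((\<lambda>t. F t p) has_real_derivative F' t p) (at t)" "t \<in> I" "p \<in> P" for F' t p
      by (rule has_field_derivative_transform_within_open[OF that(1) I that(2)]) (use eq that in auto)
    obtain F' where F': "\<forall>t\<in>I. \<forall>p\<in>P. ((\<lambda>t. F t p) has_real_derivative F' t p) (at t)" "Ck_param j I P F'"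
      using F Suc by auto
    have "\<forall>t\<in>I. \<forall>p\<in>P. ((\<lambda>t. G t p) has_real_derivative F' t p) (at t)"
      using F'(1) d by blast
    then show ?thesis using F'(2) c Suc by auto
  qed (use c in auto)
qed

lemma Ck_param_reindex:
  fixes F :: "real \<Rightarrow> 'p::topological_space \<Rightarrow> real" and \<pi> :: "'q::topological_space \<Rightarrow> 'p"
  assumes "Ck_param k I P F" "continuous_on P' \<pi>" "\<And>q. q \<in> P' \<Longrightarrow> \<pi> q \<in> P"
  shows "Ck_param k I P' (\<lambda>t q. F t (\<pi> q))"
proof -
  have *: "continuous_on (I \<times> P') (\<lambda>(t, q). F t (\<pi> q))"
    if "continuous_on (I \<times> P) (\<lambda>(t, p). F t p)" for F :: "real \<Rightarrow> 'p \<Rightarrow> real"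
  proof -
    have "continuous_on (I \<times> P') (\<lambda>z. (fst z, \<pi> (snd z)))"
      by (intro continuous_intros continuous_on_compose2[OF assms(2)]) auto
    then have "continuous_on (I \<times> P') (\<lambda>z. (\<lambda>(t, p). F t p) (fst z, \<pi> (snd z)))"
      by (rule continuous_on_compose2[OF that]) (use assms(3) in auto)
    then show ?thesis by (simp add: split_beta)
  qed
  show ?thesis
    using assms(1)
  proof (induction k arbitrary: F)
    case 0 then show ?case using * by simp
  next
    case (Suc k)
    then obtain F' where F': "\<forall>t\<in>I. \<forall>p\<in>P. ((\<lambda>t. F t p) has_real_derivative F' t p) (at t)" "Ck_param k I P F'"
      by auto
    show ?case
      by (rule Ck_param_SucI[OF Suc.IH[OF Ck_param_SucD[OF Suc.prems]] Suc.IH[OF F'(2)]])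
         (use F'(1) assms(3) in auto)
  qed
qed

lemma Ck_param_const: "continuous_on P f \<Longrightarrow> Ck_param k I P (\<lambda>t p. f p)"
proof (induction k arbitrary: f)
  case 0
  then show ?case
    by (auto simp: split_beta intro!: continuous_on_compose2[OF 0] continuous_intros)
next
  case (Suc k)
  have "Ck_param k I P (\<lambda>t p. 0)" by (rule Suc.IH) simp
  with Suc.IH[OF Suc.prems] show ?case by (rule Ck_param_SucI) auto
qed

lemma Ck_param_id: "Ck_param k I P (\<lambda>t p. t)"
proof (induction k)
  case 0 show ?case by (auto simp: split_beta intro!: continuous_intros)
next
  case (Suc k) show ?case
    by (rule Ck_param_SucI[OF Suc Ck_param_const[of P "\<lambda>_. 1"]]) auto
qed

lemma Ck_param_add: "Ck_param k I P F \<Longrightarrow> Ck_param k I P G \<Longrightarrow> Ck_param k I P (\<lambda>t p. F t p + G t p)"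
proof (induction k arbitrary: F G)
  case 0 then show ?case by (auto simp: split_beta intro!: continuous_intros)
next
  case (Suc k)
  from Suc.prems obtain F' G' where *: "\<forall>t\<in>I. \<forall>p\<in>P. ((\<lambda>t. F t p) has_real_derivative F' t p) (at t)" "Ck_param k I P F'"
    "\<forall>t\<in>I. \<forall>p\<in>P. ((\<lambda>t. G t p) has_real_derivative G' t p) (at t)" "Ck_param k I P G'" by auto
  show ?case
    by (rule Ck_param_SucI[OF Suc.IH Suc.IH[OF *(2,4)]])
       (use Suc.prems * in \<open>auto intro!: derivative_eq_intros dest: Ck_param_SucD simp del: Ck_param.simps\<close>)
qed

lemma Ck_param_mult: "Ck_param k I P F \<Longrightarrow> Ck_param k I P G \<Longrightarrow> Ck_param k I P (\<lambda>t p. F t p * G t p)"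
proof (induction k arbitrary: F G)
  case 0 then show ?case by (auto simp: split_beta intro!: continuous_intros)
next
  case (Suc k)
  from Suc.prems obtain F' G' where *: "\<forall>t\<in>I. \<forall>p\<in>P. ((\<lambda>t. F t p) has_real_derivative F' t p) (at t)" "Ck_param k I P F'"
    "\<forall>t\<in>I. \<forall>p\<in>P. ((\<lambda>t. G t p) has_real_derivative G' t p) (at t)" "Ck_param k I P G'" by auto
  note FG = Suc.prems[THEN Ck_param_SucD]
  show ?case
    by (rule Ck_param_SucI[OF Suc.IH[OF FG] Ck_param_add[OF Suc.IH[OF *(2) FG(2)] Suc.IH[OF FG(1) *(4)]]])
       (use * in \<open>auto intro!: derivative_eq_intros simp: algebra_simps\<close>)
qed

lemma Ck_param_real: "Ck_param k I P (\<lambda>t p. c)"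
  by (rule Ck_param_const) simp

lemma Ck_param_minus: assumes "Ck_param k I P F" shows "Ck_param k I P (\<lambda>t p. - F t p)"
  using Ck_param_mult[OF Ck_param_real[of k I P "-1"] assms] by simp

lemma Ck_param_diff: "Ck_param k I P F \<Longrightarrow> Ck_param k I P G \<Longrightarrow> Ck_param k I P (\<lambda>t p. F t p - G t p)"
  using Ck_param_add[OF _ Ck_param_minus[of k I P G], of F] by simp

lemma Ck_param_power: "Ck_param k I P F \<Longrightarrow> Ck_param k I P (\<lambda>t p. F t p ^ n)"
  by (induction n) (auto intro: Ck_param_mult Ck_param_real)

lemma Ck_0: "Ck 0 I f \<longleftrightarrow> continuous_on I f"
proof
  assume "Ck 0 I f"
  then have "continuous_on (I \<times> {0::real}) (\<lambda>z. f (fst z))" by (simp add: Ck_def split_beta)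
  then have "continuous_on I (\<lambda>t. (\<lambda>z. f (fst z)) (t, 0::real))"
    by (rule continuous_on_compose2) (auto intro: continuous_on_Pair)
  then show "continuous_on I f" by simp
next
  assume "continuous_on I f"
  from continuous_on_compose2[OF this, of "I \<times> {0::real}" fst] show "Ck 0 I f"
    by (auto simp: Ck_def split_beta continuous_on_fst)
qed

lemma Ck_continuous: "Ck k I f \<Longrightarrow> continuous_on I f"
  using Ck_param_le[of k I "{0::real}" "\<lambda>t _. f t" 0] Ck_0[of I f] by (auto simp: Ck_def)

lemma Ck_Suc: "Ck (Suc k) I f \<longleftrightarrow>
    (\<exists>f'. (\<forall>t\<in>I. (f has_real_derivative f' t) (at t)) \<and> Ck k I f')"
proof
  assume "Ck (Suc k) I f"
  show "\<exists>f'. (\<forall>t\<in>I. (f has_real_derivative f' t) (at t)) \<and> Ck k I f'"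
  proof -
    from \<open>Ck (Suc k) I f\<close> obtain F' where "\<forall>t\<in>I. (f has_real_derivative F' t (0::real)) (at t)" "Ck_param k I {0::real} F'"
      by (auto simp: Ck_def)
    moreover from this(2) have "Ck_param k I {0::real} (\<lambda>t _. F' t 0)"
      by (rule Ck_param_reindex[of k I "{0}" F' _ "\<lambda>_. 0"]) auto
    ultimately show ?thesis unfolding Ck_def by (intro exI[of _ "\<lambda>t. F' t 0"]) auto
  qed
next
  assume "\<exists>f'. (\<forall>t\<in>I. (f has_real_derivative f' t) (at t)) \<and> Ck k I f'"
  then obtain f' where f': "\<forall>t\<in>I. (f has_real_derivative f' t) (at t)" "Ck k I f'" by blast
  then have "Ck 0 I f" unfolding Ck_0 by (meson DERIV_continuous continuous_at_imp_continuous_on)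
  then show "Ck (Suc k) I f" using f' by (auto simp: Ck_def)
qed

lemma Ck_SucI: "(\<And>t. t \<in> I \<Longrightarrow> (f has_real_derivative f' t) (at t)) \<Longrightarrow> Ck k I f' \<Longrightarrow> Ck (Suc k) I f"
  using Ck_Suc by blast

lemma Ck_le: "Ck n I f \<Longrightarrow> m \<le> n \<Longrightarrow> Ck m I f"
  unfolding Ck_def by (rule Ck_param_le)

lemma Ck_subset: "Ck k I f \<Longrightarrow> I' \<subseteq> I \<Longrightarrow> Ck k I' f"
  unfolding Ck_def by (erule Ck_param_subset) auto

lemma Ck_cong: "Ck k I f \<Longrightarrow> open I \<Longrightarrow> (\<And>t. t \<in> I \<Longrightarrow> f t = g t) \<Longrightarrow> Ck k I g"
  unfolding Ck_def by (rule Ck_param_cong)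

lemma Ck_derivative:
  assumes "Ck (Suc k) I f" "open I" "\<And>t. t \<in> I \<Longrightarrow> (f has_real_derivative f' t) (at t)"
  shows "Ck k I f'"
  using assms Ck_Suc Ck_cong DERIV_unique by metis

lemma Ck_add: "Ck k I f \<Longrightarrow> Ck k I g \<Longrightarrow> Ck k I (\<lambda>t. f t + g t)"
  unfolding Ck_def by (rule Ck_param_add)

lemma Ck_mult: "Ck k I f \<Longrightarrow> Ck k I g \<Longrightarrow> Ck k I (\<lambda>t. f t * g t)"
  unfolding Ck_def by (rule Ck_param_mult)

lemma Ck_diff: "Ck k I f \<Longrightarrow> Ck k I g \<Longrightarrow> Ck k I (\<lambda>t. f t - g t)"
  unfolding Ck_def by (rule Ck_param_diff)

lemma Ck_minus: "Ck k I f \<Longrightarrow> Ck k I (\<lambda>t. - f t)"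
  unfolding Ck_def by (rule Ck_param_minus)

lemma Ck_real: "Ck k I (\<lambda>t. c)"
  unfolding Ck_def by (rule Ck_param_real)

lemma Ck_id: "Ck k I (\<lambda>t. t)"
  unfolding Ck_def by (rule Ck_param_id)

lemma Ck_param_compose:
  assumes "Ck k J f" "Ck_param k I P h" "\<And>t p. t \<in> I \<Longrightarrow> p \<in> P \<Longrightarrow> h t p \<in> J"
  shows "Ck_param k I P (\<lambda>t p. f (h t p))"
  using assms(1,2)
proof (induction k arbitrary: f)
  case 0
  then have f: "continuous_on J f" by (simp add: Ck_0)
  show ?case
    using 0 assms(3) by (auto simp: split_beta intro!: continuous_on_compose2[OF f])
next
  case (Suc k)
  then obtain f' where f': "\<forall>t\<in>J. (f has_real_derivative f' t) (at t)" "Ck k J f'"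
    by (auto simp: Ck_Suc)
  from Suc.prems obtain h' where h': "\<forall>t\<in>I. \<forall>p\<in>P. ((\<lambda>t. h t p) has_real_derivative h' t p) (at t)" "Ck_param k I P h'"
    by auto
  note h = Ck_param_SucD[OF Suc.prems(2)] and f = Ck_le[OF Suc.prems(1), of k, simplified]
  have d: "((\<lambda>t. f (h t p)) has_real_derivative f' (h t p) * h' t p) (at t)"
    if "t \<in> I" "p \<in> P" for t p
    using DERIV_chain2[of f "f' (h t p)" "\<lambda>t. h t p" t "h' t p" UNIV] f' h' assms(3) that by auto
  show ?case
    by (rule Ck_param_SucI[OF Suc.IH[OF f h] Ck_param_mult[OF Suc.IH[OF f'(2) h] h'(2)] d])
qed

lemma Ck_compose:
  "Ck k J f \<Longrightarrow> Ck k I h \<Longrightarrow> (\<And>t. t \<in> I \<Longrightarrow> h t \<in> J) \<Longrightarrow> Ck k I (\<lambda>t. f (h t))"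
  using Ck_param_compose[of k J f I "{0::real}" "\<lambda>t _. h t"] by (auto simp: Ck_def)

lemma Ck_param_of_Ck: "Ck k I f \<Longrightarrow> Ck_param k I P (\<lambda>t p. f t)"
  by (rule Ck_param_compose[OF _ Ck_param_id])

lemma Ck_param_integral:
  fixes F :: "real \<Rightarrow> 'p::topological_space \<Rightarrow> real \<Rightarrow> real"
  assumes I: "open I" "convex I" and F: "Ck_param k I (P \<times> {a..b}) (\<lambda>t (p, \<eta>). F t p \<eta>)"
  shows "Ck_param k I P (\<lambda>t p. integral {a..b} (F t p))"
proof -
  have c: "continuous_on (I \<times> P) (\<lambda>(t, p). integral {a..b} (F t p))"
    if "continuous_on (I \<times> (P \<times> {a..b})) (\<lambda>(t, (p, \<eta>)). F t p \<eta>)" for F :: "real \<Rightarrow> 'p \<Rightarrow> real \<Rightarrow> real"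
  proof -
    have "continuous_on ((I \<times> P) \<times> cbox a b) (\<lambda>z. (fst (fst z), (snd (fst z), snd z)))"
      by (intro continuous_intros)
    then have "continuous_on ((I \<times> P) \<times> cbox a b)
        (\<lambda>z. (\<lambda>(t, (p, \<eta>)). F t p \<eta>) (fst (fst z), (snd (fst z), snd z)))"
      by (rule continuous_on_compose2[OF that]) auto
    then have "continuous_on ((I \<times> P) \<times> cbox a b) (\<lambda>(z, \<eta>). F (fst z) (snd z) \<eta>)"
      by (simp add: split_beta)
    from integral_continuous_on_param[OF this] show ?thesis by (simp add: split_beta)
  qed
  show ?thesis
    using F
  proof (induction k arbitrary: F)
    case 0 then show ?case using c by (auto simp: split_beta)
  next
    case (Suc k)
    then obtain F' where F': "\<forall>t\<in>I. \<forall>p\<in>P\<times>{a..b}. ((\<lambda>t. case p of (p, \<eta>) \<Rightarrow> F t p \<eta>) has_real_derivative F' t p) (at t)"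
      "Ck_param k I (P \<times> {a..b}) F'" by auto
    have F'': "Ck_param k I (P \<times> {a..b}) (\<lambda>t (p, \<eta>). F' t (p, \<eta>))" using F'(2) by simp
    have cF: "continuous_on (I \<times> (P \<times> {a..b})) (\<lambda>(t, (p, \<eta>)). F t p \<eta>)"
      using Ck_param_continuous[OF Suc.prems] by (simp add: split_beta)
    have d: "((\<lambda>t. integral {a..b} (F t p)) has_real_derivative integral {a..b} (\<lambda>\<eta>. F' t (p, \<eta>))) (at t)"
      if "t \<in> I" "p \<in> P" for t p
    proof -
      have m: "continuous_on (I \<times> cbox a b) (\<lambda>z. (fst z, (p, snd z)))"
        by (intro continuous_intros)
      have "((\<lambda>t. integral (cbox a b) (F t p)) has_real_derivative integral (cbox a b) (\<lambda>\<eta>. F' t (p, \<eta>))) (at t within I)"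
      proof (rule leibniz_rule_field_derivative[where fx = "\<lambda>t \<eta>. F' t (p, \<eta>)", OF _ _ _ that(1) I(2)])
        show "((\<lambda>t. F t p \<eta>) has_real_derivative F' t (p, \<eta>)) (at t within I)" if "t \<in> I" "\<eta> \<in> cbox a b" for t \<eta>
          using F'(1) that \<open>p \<in> P\<close> by (auto intro: has_field_derivative_at_within)
        show "F t p integrable_on cbox a b" if "t \<in> I" for t
        proof (rule integrable_continuous)
          have "continuous_on (cbox a b) (\<lambda>\<eta>. (\<lambda>(t, (p, \<eta>)). F t p \<eta>) (t, (p, \<eta>)))"
            by (rule continuous_on_compose2[OF cF]) (use that \<open>p \<in> P\<close> in \<open>auto intro!: continuous_intros\<close>)
          then show "continuous_on (cbox a b) (F t p)" by simp
        qed
        show "continuous_on (I \<times> cbox a b) (\<lambda>(t, \<eta>). F' t (p, \<eta>))"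
        proof -
          from m have "continuous_on (I \<times> cbox a b) (\<lambda>z. (\<lambda>(t, q). F' t q) (fst z, (p, snd z)))"
            by (rule continuous_on_compose2[OF Ck_param_continuous[OF F'(2)]]) (use \<open>p \<in> P\<close> in auto)
          moreover have "(\<lambda>(t, \<eta>). F' t (p, \<eta>)) = (\<lambda>z. (\<lambda>(t, q). F' t q) (fst z, (p, snd z)))"
            by (rule ext) (simp add: case_prod_unfold)
          ultimately show ?thesis by (simp only:)
        qed
      qed
      then show ?thesis using at_within_open[OF \<open>t \<in> I\<close> I(1)] by (simp only: cbox_interval)
    qed
    have "Ck_param k I P (\<lambda>t p. integral {a..b} (F t p))"
      using Suc.IH[of F] Ck_param_SucD[OF Suc.prems] by blast
    moreover have "Ck_param k I P (\<lambda>t p. integral {a..b} (\<lambda>\<eta>. F' t (p, \<eta>)))"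
      using Suc.IH[of "\<lambda>t p \<eta>. F' t (p, \<eta>)"] F'' by blast
    ultimately show ?case
      by (rule Ck_param_SucI[where F' = "\<lambda>t p. integral {a..b} (\<lambda>\<eta>. F' t (p, \<eta>))"]) (rule d)
  qed
qed

lemma Ck_integral:
  fixes F :: "real \<Rightarrow> real \<Rightarrow> real"
  assumes I: "open I" "convex I" and F: "Ck_param k I {a..b} F"
  shows "Ck k I (\<lambda>t. integral {a..b} (F t))"
proof -
  have "Ck_param k I ({0::real} \<times> {a..b}) (\<lambda>t (p, \<eta>). F t \<eta>)"
  proof -
    have "Ck_param k I ({0::real} \<times> {a..b}) (\<lambda>t q. F t (snd q))"
      by (rule Ck_param_reindex[OF F]) (auto simp: continuous_on_snd)
    moreover have "(\<lambda>t q. F t (snd q)) = (\<lambda>t (p :: real, \<eta>). F t \<eta>)"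
      by (auto simp: fun_eq_iff)
    ultimately show ?thesis by simp
  qed
  from Ck_param_integral[OF I, of k "{0}" a b "\<lambda>t p. F t", OF this] show ?thesis by (simp add: Ck_def)
qed

text \<open>
  Uniqueness of derivatives is what makes the class local: the local derivatives in the definition
  all agree with \<open>deriv\<close>.
\<close>

lemma Ck_local:
  assumes "open I" "\<And>t. t \<in> I \<Longrightarrow> \<exists>J. open J \<and> t \<in> J \<and> Ck k J f"
  shows "Ck k I f"
  using assms(2)
proof (induction k arbitrary: f)
  case 0
  have "isCont f t" if "t \<in> I" for t
    using 0[OF that] by (auto simp: Ck_0 continuous_on_eq_continuous_at)
  then show ?case by (simp add: Ck_0 continuous_at_imp_continuous_on)
next
  case (Suc k)
  have d: "(f has_real_derivative deriv f t) (at t)" if "t \<in> J" "Ck (Suc k) J f" for t J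
    using that unfolding Ck_Suc by (metis DERIV_imp_deriv)
  have "Ck k I (deriv f)"
    using Suc.IH[of "deriv f"] Suc.prems Ck_derivative d by metis
  then show ?case using Ck_SucI[of I f "deriv f"] d Suc.prems by blast
qed

lemma Ck_positive_half_line:
  assumes "\<And>c. c > 0 \<Longrightarrow> Ck k {c<..} f" shows "Ck k {(0::real)<..} f"
proof (rule Ck_local)
  fix t :: real assume "t \<in> {0<..}"
  then show "\<exists>J. open J \<and> t \<in> J \<and> Ck k J f"
    using assms[of "t/2"] by (intro exI[of _ "{t/2<..}"]) auto
qed simp

lemma C_infinity_on_iff: assumes "open S" shows "C_infinity_on S f \<longleftrightarrow> (\<forall>k. Ck k S f)"
proof
  assume C: "C_infinity_on S f"
  have "Ck k S ((deriv ^^ j) f)" for k j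
  proof (induction k arbitrary: j)
    case 0
    show ?case using C unfolding C_infinity_on_def Ck_0
      by (meson continuous_at_imp_continuous_on field_differentiable_imp_continuous_at)
  next
    case (Suc k)
    show ?case
      by (rule Ck_SucI[OF _ Suc[of "Suc j"]])
         (use C in \<open>auto simp: C_infinity_on_def field_differentiable_derivI\<close>)
  qed
  from this[of _ 0] show "\<forall>k. Ck k S f" by simp
next
  assume C: "\<forall>k. Ck k S f"
  have *: "\<forall>k. Ck k S ((deriv ^^ j) f)" for j
  proof (induction j)
    case (Suc j)
    have "(((deriv ^^ j) f) has_real_derivative deriv ((deriv ^^ j) f) t) (at t)" if "t \<in> S" for t
      using Suc[rule_format, of "Suc 0"] that unfolding Ck_Suc by (metis DERIV_imp_deriv)
    then show ?case using Suc Ck_derivative[OF _ assms, of _ "(deriv ^^ j) f" "deriv ((deriv ^^ j) f)"] by simp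
  qed (use C in simp)
  have "((deriv ^^ j) f) field_differentiable (at t)" if "t \<in> S" for j t
    using *[of j, rule_format, of 1] that by (auto simp: Ck_Suc[of 0, simplified] field_differentiable_def)
  then show "C_infinity_on S f" by (auto simp: C_infinity_on_def)
qed

lemma Ck_exp: "Ck k I exp" for I :: "real set"
proof (induction k)
  case 0 show ?case by (auto simp: Ck_0 intro: continuous_intros)
next
  case (Suc k) show ?case by (rule Ck_SucI[OF _ Suc]) simp
qed

lemma Ck_inverse: "Ck k {0<..} (inverse :: real \<Rightarrow> real)"
proof (induction k)
  case 0 show ?case by (auto simp: Ck_0 intro!: continuous_intros)
next
  case (Suc k)
  show ?case
    by (rule Ck_SucI[OF _ Ck_minus[OF Ck_mult[OF Suc Suc]]]) (auto intro!: derivative_eq_intros)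
qed

lemma Ck_sqrt: "Ck k {0<..} sqrt"
proof (induction k)
  case 0 show ?case by (auto simp: Ck_0 intro!: continuous_intros)
next
  case (Suc k)
  have "Ck k {0<..} (\<lambda>t. inverse (sqrt t))"
    by (rule Ck_compose[OF Ck_inverse Suc]) auto
  note * = Ck_mult[OF Ck_real[of _ _ "1/2"] this]
  show ?case by (rule Ck_SucI[OF _ *]) (auto intro!: derivative_eq_intros simp: field_simps)
qed

lemma Ck_param_exp: "Ck_param k I P h \<Longrightarrow> Ck_param k I P (\<lambda>t p. exp (h t p))"
  by (rule Ck_param_compose[OF Ck_exp[of _ UNIV]]) auto

lemma Ck_param_sqrt: "Ck_param k I P h \<Longrightarrow> (\<And>t p. t \<in> I \<Longrightarrow> p \<in> P \<Longrightarrow> h t p > 0) \<Longrightarrow> Ck_param k I P (\<lambda>t p. sqrt (h t p))"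
  by (rule Ck_param_compose[OF Ck_sqrt]) auto

lemma Ck_param_divide:
  assumes "Ck_param k I P g" "Ck_param k I P h" "\<And>t p. t \<in> I \<Longrightarrow> p \<in> P \<Longrightarrow> h t p > 0"
  shows "Ck_param k I P (\<lambda>t p. g t p / h t p)"
  using Ck_param_mult[OF assms(1) Ck_param_compose[OF Ck_inverse assms(2)]] assms(3) by (simp add: divide_inverse)

lemma convex_combination_pos:
  fixes x y \<eta> :: real
  assumes "0 < x" "0 < y" "0 \<le> \<eta>" "\<eta> \<le> 1" shows "0 < y + \<eta> * (x - y)"
proof (cases "\<eta> = 0")
  case False
  then have "0 < \<eta> * x" "0 \<le> (1 - \<eta>) * y" using assms by simp_all
  then have "0 < (1 - \<eta>) * y + \<eta> * x" by linarith
  then show ?thesis by (simp add: algebra_simps)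
qed (use assms in simp)

text \<open>
  Means over the segment from \<open>\<tau>\<close> to \<open>t\<close>. Difference quotients and their derivatives take this form,
  which is regular across the diagonal \<open>t = \<tau>\<close>.
\<close>

definition weighted_mean :: "(real \<Rightarrow> real) \<Rightarrow> (real \<Rightarrow> real) \<Rightarrow> real \<Rightarrow> real \<Rightarrow> real" where
  "weighted_mean \<psi> \<phi> t \<tau> = integral {0..1} (\<lambda>\<eta>. \<psi> \<eta> * \<phi> (\<tau> + \<eta> * (t - \<tau>)))"

lemma mean_value_integral:
  assumes \<phi>: "\<And>t. 0 < t \<Longrightarrow> (\<phi> has_real_derivative \<phi>' t) (at t)" and t: "0 < t" "0 < \<tau>"
  shows "\<phi> t - \<phi> \<tau> = (t - \<tau>) * weighted_mean (\<lambda>_. 1) \<phi>' t \<tau>"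
proof -
  have "((\<lambda>\<eta>. (t - \<tau>) * \<phi>' (\<tau> + \<eta> * (t - \<tau>))) has_integral
      \<phi> (\<tau> + 1 * (t - \<tau>)) - \<phi> (\<tau> + 0 * (t - \<tau>))) {0..1}"
  proof (rule fundamental_theorem_of_calculus)
    fix \<eta> :: real assume "\<eta> \<in> {0..1}"
    then have pos: "0 < \<tau> + \<eta> * (t - \<tau>)" using convex_combination_pos t by auto
    have "((\<lambda>\<eta>. \<tau> + \<eta> * (t - \<tau>)) has_real_derivative t - \<tau>) (at \<eta> within {0..1})"
      by (auto intro!: derivative_eq_intros)
    from DERIV_chain2[where f = \<phi> and g = "\<lambda>\<eta>. \<tau> + \<eta> * (t - \<tau>)" and x = \<eta>, OF \<phi>[OF pos] this]
    show "((\<lambda>\<eta>. \<phi> (\<tau> + \<eta> * (t - \<tau>))) has_vector_derivative (t - \<tau>) * \<phi>' (\<tau> + \<eta> * (t - \<tau>))) (at \<eta> within {0..1})"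
      by (simp add: has_real_derivative_iff_has_vector_derivative mult.commute)
  qed simp
  from integral_unique[OF this] show ?thesis by (simp add: weighted_mean_def)
qed

lemma weighted_mean_deriv:
  assumes \<phi>: "\<And>t. 0 < t \<Longrightarrow> (\<phi> has_real_derivative \<phi>' t) (at t)" and \<phi>': "continuous_on {0<..} \<phi>'"
    and \<psi>: "continuous_on {0..1} \<psi>" and t: "0 < t" "0 < \<tau>"
  shows "((\<lambda>t. weighted_mean \<psi> \<phi> t \<tau>) has_real_derivative weighted_mean (\<lambda>\<eta>. \<psi> \<eta> * \<eta>) \<phi>' t \<tau>) (at t)"
proof -
  have c\<phi>: "continuous_on {0<..} \<phi>"
    using \<phi> by (intro continuous_at_imp_continuous_on) (auto intro: DERIV_isCont)
  have m: "continuous_on ({0<..} \<times> {0..1}) (\<lambda>z. \<tau> + snd z * (fst z - \<tau>))"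
    by (intro continuous_intros)
  have "((\<lambda>t. integral (cbox 0 1) (\<lambda>\<eta>. \<psi> \<eta> * \<phi> (\<tau> + \<eta> * (t - \<tau>)))) has_real_derivative
      integral (cbox 0 1) (\<lambda>\<eta>. \<psi> \<eta> * \<eta> * \<phi>' (\<tau> + \<eta> * (t - \<tau>)))) (at t within {0<..})"
  proof (rule leibniz_rule_field_derivative[where fx = "\<lambda>t \<eta>. \<psi> \<eta> * \<eta> * \<phi>' (\<tau> + \<eta> * (t - \<tau>))"])
    fix t \<eta> :: real assume *: "t \<in> {0<..}" "\<eta> \<in> cbox 0 1"
    then have pos: "0 < \<tau> + \<eta> * (t - \<tau>)" using convex_combination_pos t by auto
    have "((\<lambda>t. \<tau> + \<eta> * (t - \<tau>)) has_real_derivative \<eta>) (at t within {0<..})"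
      by (auto intro!: derivative_eq_intros)
    from DERIV_cmult[OF DERIV_chain2[where f = \<phi> and g = "\<lambda>t. \<tau> + \<eta> * (t - \<tau>)" and x = t, OF \<phi>[OF pos] this], of "\<psi> \<eta>"]
    show "((\<lambda>t. \<psi> \<eta> * \<phi> (\<tau> + \<eta> * (t - \<tau>))) has_real_derivative \<psi> \<eta> * \<eta> * \<phi>' (\<tau> + \<eta> * (t - \<tau>))) (at t within {0<..})"
      by (simp add: mult_ac)
  next
    fix t :: real assume "t \<in> {0<..}"
    then have "continuous_on {0..1} (\<lambda>\<eta>. \<psi> \<eta> * \<phi> (\<tau> + \<eta> * (t - \<tau>)))"
      using convex_combination_pos t by (intro continuous_intros \<psi> continuous_on_compose2[OF c\<phi>]) auto
    then show "(\<lambda>\<eta>. \<psi> \<eta> * \<phi> (\<tau> + \<eta> * (t - \<tau>))) integrable_on cbox 0 1"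
      by (auto intro: integrable_continuous_real)
  next
    have "continuous_on ({0<..} \<times> {0..1}) (\<lambda>z. \<psi> (snd z) * snd z * \<phi>' (\<tau> + snd z * (fst z - \<tau>)))"
      by (intro continuous_on_mult continuous_on_compose2[OF \<psi>] continuous_on_compose2[OF \<phi>' m] continuous_on_snd continuous_on_id)
         (use convex_combination_pos t in auto)
    then show "continuous_on ({0<..} \<times> cbox 0 1) (\<lambda>(t, \<eta>). \<psi> \<eta> * \<eta> * \<phi>' (\<tau> + \<eta> * (t - \<tau>)))"
      by (simp add: case_prod_unfold)
  qed (use t in \<open>auto intro: convex_real_interval\<close>)
  then show ?thesis
    unfolding weighted_mean_def using at_within_open[of t "{0<..}"] t by simp
qed

section \<open>Kernels of class C^k\<close>

text \<open>
  In essence this says that \<open>\<kappa>\<close> is of class \<open>C^k\<close> in both variables on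
  the open positive quadrant. It is phrased through composition with \<open>C^k\<close> families because the
  kernels are only ever evaluated along such families, and because this form is inherited by sums,
  products and means without mixed partial derivatives. The parameter type is an argument since a
  mean uses up one additional real parameter.
\<close>

definition smooth_kernel :: "'p::topological_space itself \<Rightarrow> nat \<Rightarrow> (real \<Rightarrow> real \<Rightarrow> real) \<Rightarrow> bool" where
  "smooth_kernel _ k \<kappa> \<longleftrightarrow> (\<forall>I (P :: 'p set) h1 h2. open I \<longrightarrow> convex I \<longrightarrow> Ck_param k I P h1 \<longrightarrow> Ck_param k I P h2 \<longrightarrow>
     (\<forall>t\<in>I. \<forall>p\<in>P. 0 < h1 t p \<and> 0 < h2 t p) \<longrightarrow> Ck_param k I P (\<lambda>t p. \<kappa> (h1 t p) (h2 t p)))"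

lemma smooth_kernelD:
  fixes P :: "'p::topological_space set"
  assumes "smooth_kernel TYPE('p) k \<kappa>" "open I" "convex I" "Ck_param k I P h1" "Ck_param k I P h2"
    "\<And>t p. t \<in> I \<Longrightarrow> p \<in> P \<Longrightarrow> 0 < h1 t p" "\<And>t p. t \<in> I \<Longrightarrow> p \<in> P \<Longrightarrow> 0 < h2 t p"
  shows "Ck_param k I P (\<lambda>t p. \<kappa> (h1 t p) (h2 t p))"
  using assms unfolding smooth_kernel_def by blast

lemma smooth_kernel_continuous:
  assumes "smooth_kernel TYPE(real) k \<kappa>"
  shows "continuous_on ({0<..} \<times> {0<..}) (\<lambda>(t, \<tau>). \<kappa> t \<tau>)"
  by (rule Ck_param_continuous[of k], rule smooth_kernelD[OF assms _ _ Ck_param_id Ck_param_const])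
     (auto intro: convex_real_interval)

lemma smooth_kernel_single:
  assumes "smooth_kernel TYPE(real \<times> real) k \<kappa>" shows "smooth_kernel TYPE(real) k \<kappa>"
  unfolding smooth_kernel_def
proof (intro allI impI)
  fix I P and h1 h2 :: "real \<Rightarrow> real \<Rightarrow> real"
  assume *: "open I" "convex I" "Ck_param k I P h1" "Ck_param k I P h2" "\<forall>t\<in>I. \<forall>p\<in>P. 0 < h1 t p \<and> 0 < h2 t p"
  have **: "Ck_param k I (P \<times> {0::real}) (\<lambda>t p. \<kappa> (h1 t (fst p)) (h2 t (fst p)))"
    by (rule smooth_kernelD[OF assms *(1,2)])
       (use *(5) in \<open>auto intro!: Ck_param_reindex[OF *(3)] Ck_param_reindex[OF *(4)] continuous_on_fst\<close>)
  have "continuous_on P (\<lambda>p. (p, 0::real))" by (intro continuous_intros)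
  from Ck_param_reindex[OF ** this]
  show "Ck_param k I P (\<lambda>t p. \<kappa> (h1 t p) (h2 t p))" by auto
qed

lemma smooth_kernel_combine:
  assumes \<kappa>: "smooth_kernel TYPE('p::topological_space) k \<kappa>" "smooth_kernel TYPE('p) k \<kappa>'"
    and g: "\<And>I (P :: 'p set) F G. Ck_param k I P F \<Longrightarrow> Ck_param k I P G \<Longrightarrow> Ck_param k I P (\<lambda>t p. g (F t p) (G t p))"
  shows "smooth_kernel TYPE('p) k (\<lambda>t \<tau>. g (\<kappa> t \<tau>) (\<kappa>' t \<tau>))"
  unfolding smooth_kernel_def
proof (intro allI impI)
  fix I and P :: "'p set" and h1 h2
  assume *: "open I" "convex I" "Ck_param k I P h1" "Ck_param k I P h2" "\<forall>t\<in>I. \<forall>p\<in>P. 0 < h1 t p \<and> 0 < h2 t p"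
  have "Ck_param k I P (\<lambda>t p. \<kappa> (h1 t p) (h2 t p))" "Ck_param k I P (\<lambda>t p. \<kappa>' (h1 t p) (h2 t p))"
    by (rule smooth_kernelD[OF _ *(1-4)], use \<kappa> *(5) in auto)+
  then show "Ck_param k I P (\<lambda>t p. g (\<kappa> (h1 t p) (h2 t p)) (\<kappa>' (h1 t p) (h2 t p)))" by (rule g)
qed

lemmas smooth_kernel_add = smooth_kernel_combine[where g = "(+)", OF _ _ Ck_param_add]
lemmas smooth_kernel_diff = smooth_kernel_combine[where g = "(-)", OF _ _ Ck_param_diff]
lemmas smooth_kernel_mult = smooth_kernel_combine[where g = "(*)", OF _ _ Ck_param_mult]

lemma smooth_kernel_exp:
  "smooth_kernel TYPE('p::topological_space) k \<kappa> \<Longrightarrow> smooth_kernel TYPE('p) k (\<lambda>t \<tau>. exp (\<kappa> t \<tau>))"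
  by (rule smooth_kernel_combine[where g = "\<lambda>x _. exp x"]) (auto intro: Ck_param_exp)

lemma smooth_kernel_const: "smooth_kernel TYPE('p::topological_space) k (\<lambda>t \<tau>. a)"
  unfolding smooth_kernel_def by (auto intro: Ck_param_real)

lemma smooth_kernel_left:
  assumes "Ck k {0<..} \<phi>" shows "smooth_kernel TYPE('p::topological_space) k (\<lambda>t \<tau>. \<phi> t)"
  unfolding smooth_kernel_def by (auto intro: Ck_param_compose[OF assms])

lemma smooth_kernel_right:
  assumes "Ck k {0<..} \<phi>" shows "smooth_kernel TYPE('p::topological_space) k (\<lambda>t \<tau>. \<phi> \<tau>)"
  unfolding smooth_kernel_def by (auto intro: Ck_param_compose[OF assms])

lemma smooth_kernel_weighted_mean:
  assumes \<phi>: "Ck k {0<..} \<phi>" and \<psi>: "continuous_on {0..1} \<psi>"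
  shows "smooth_kernel TYPE('p::topological_space) k (weighted_mean \<psi> \<phi>)"
  unfolding smooth_kernel_def
proof (intro allI impI)
  fix I and P :: "'p set" and h1 h2
  assume *: "open I" "convex I" "Ck_param k I P h1" "Ck_param k I P h2" "\<forall>t\<in>I. \<forall>p\<in>P. 0 < h1 t p \<and> 0 < h2 t p"
  have fst: "continuous_on (P \<times> {0..1}) fst" by (simp add: continuous_on_fst)
  have h1: "Ck_param k I (P \<times> {0..1::real}) (\<lambda>t p. h1 t (fst p))" by (rule Ck_param_reindex[OF *(3) fst]) auto
  have h2: "Ck_param k I (P \<times> {0..1::real}) (\<lambda>t p. h2 t (fst p))" by (rule Ck_param_reindex[OF *(4) fst]) auto
  have \<eta>: "Ck_param k I (P \<times> {0..1::real}) (\<lambda>t p. snd p)" by (rule Ck_param_const) (simp add: continuous_on_snd)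
  have "Ck_param k I (P \<times> {0..1::real}) (\<lambda>t p. \<psi> (snd p))"
    by (rule Ck_param_const) (auto intro!: continuous_on_compose2[OF \<psi>] continuous_on_snd)
  moreover have "Ck_param k I (P \<times> {0..1::real}) (\<lambda>t p. \<phi> (h2 t (fst p) + snd p * (h1 t (fst p) - h2 t (fst p))))"
  proof (rule Ck_param_compose[OF \<phi> Ck_param_add[OF h2 Ck_param_mult[OF \<eta> Ck_param_diff[OF h1 h2]]]])
    fix t and p :: "'p \<times> real" assume "t \<in> I" "p \<in> P \<times> {0..1}"
    then show "h2 t (fst p) + snd p * (h1 t (fst p) - h2 t (fst p)) \<in> {0<..}"
      using convex_combination_pos *(5) by auto
  qed
  ultimately have "Ck_param k I (P \<times> {0..1::real}) (\<lambda>t p. \<psi> (snd p) * \<phi> (h2 t (fst p) + snd p * (h1 t (fst p) - h2 t (fst p))))"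
    by (rule Ck_param_mult)
  then have "Ck_param k I (P \<times> {0..1::real}) (\<lambda>t (p, \<eta>). \<psi> \<eta> * \<phi> (h2 t p + \<eta> * (h1 t p - h2 t p)))"
    by (simp only: case_prod_unfold)
  from Ck_param_integral[OF *(1,2) this]
  show "Ck_param k I P (\<lambda>t p. weighted_mean \<psi> \<phi> (h1 t p) (h2 t p))"
    unfolding weighted_mean_def .
qed

text \<open>
  If \<open>a\<close> vanishes on the diagonal and \<open>\<alpha>\<close> is its derivative in the first variable, then
  \<open>gain_kernel \<alpha> t \<tau> / sqrt (t - \<tau>)\<close> is the \<open>t\<close>-derivative of \<open>a t \<tau> / sqrt (t - \<tau>)\<close>: differentiating
  the root produces \<open>a t \<tau> / (2 * (t - \<tau>))\<close>, and \<open>a t \<tau> / (t - \<tau>)\<close> is a mean of \<open>\<alpha>\<close>.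
\<close>

definition gain_kernel :: "(real \<Rightarrow> real \<Rightarrow> real) \<Rightarrow> real \<Rightarrow> real \<Rightarrow> real" where
  "gain_kernel \<alpha> t \<tau> = \<alpha> t \<tau> - 1/2 * integral {0..1} (\<lambda>\<eta>. \<alpha> (\<tau> + \<eta> * (t - \<tau>)) \<tau>)"

lemma smooth_kernel_gain:
  assumes \<alpha>: "smooth_kernel TYPE(real \<times> real) k \<alpha>"
  shows "smooth_kernel TYPE(real) k (gain_kernel \<alpha>)"
  unfolding smooth_kernel_def
proof (intro allI impI)
  fix I P and h1 h2 :: "real \<Rightarrow> real \<Rightarrow> real"
  assume *: "open I" "convex I" "Ck_param k I P h1" "Ck_param k I P h2" "\<forall>t\<in>I. \<forall>p\<in>P. 0 < h1 t p \<and> 0 < h2 t p"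
  have fst: "continuous_on (P \<times> {0..1}) fst" by (simp add: continuous_on_fst)
  have h1: "Ck_param k I (P \<times> {0..1::real}) (\<lambda>t p. h1 t (fst p))" by (rule Ck_param_reindex[OF *(3) fst]) auto
  have h2: "Ck_param k I (P \<times> {0..1::real}) (\<lambda>t p. h2 t (fst p))" by (rule Ck_param_reindex[OF *(4) fst]) auto
  have \<eta>: "Ck_param k I (P \<times> {0..1::real}) (\<lambda>t p. snd p)" by (rule Ck_param_const) (simp add: continuous_on_snd)
  have "Ck_param k I (P \<times> {0..1::real}) (\<lambda>t p. \<alpha> (h2 t (fst p) + snd p * (h1 t (fst p) - h2 t (fst p))) (h2 t (fst p)))"
  proof (rule smooth_kernelD[OF \<alpha> *(1,2) Ck_param_add[OF h2 Ck_param_mult[OF \<eta> Ck_param_diff[OF h1 h2]]] h2])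
    fix t and p :: "real \<times> real" assume t: "t \<in> I" "p \<in> P \<times> {0..1}"
    then have pos: "0 < h1 t (fst p)" "0 < h2 t (fst p)" "0 \<le> snd p" "snd p \<le> 1" using *(5) by auto
    then show "0 < h2 t (fst p) + snd p * (h1 t (fst p) - h2 t (fst p))" by (rule convex_combination_pos)
    show "0 < h2 t (fst p)" by (rule pos(2))
  qed
  then have "Ck_param k I (P \<times> {0..1::real}) (\<lambda>t (p, \<eta>). \<alpha> (h2 t p + \<eta> * (h1 t p - h2 t p)) (h2 t p))"
    by (simp only: case_prod_unfold)
  from Ck_param_integral[OF *(1,2) this]
  have "Ck_param k I P (\<lambda>t p. integral {0..1} (\<lambda>\<eta>. \<alpha> (h2 t p + \<eta> * (h1 t p - h2 t p)) (h2 t p)))" .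
  moreover have "Ck_param k I P (\<lambda>t p. \<alpha> (h1 t p) (h2 t p))"
    by (rule smooth_kernelD[OF smooth_kernel_single[OF \<alpha>] *(1-4)]) (use *(5) in auto)
  ultimately show "Ck_param k I P (\<lambda>t p. gain_kernel \<alpha> (h1 t p) (h2 t p))"
    unfolding gain_kernel_def by (intro Ck_param_diff Ck_param_mult Ck_param_real)
qed

section \<open>The half-order Abel operator\<close>

text \<open>
  Up to the factor \<open>sqrt pi\<close> this is the Riemann-Liouville integral of order one half. At \<open>\<tau> = t\<close> the
  integrand has the default value \<open>0\<close>, which does not affect the integral.
\<close>

definition abel :: "real \<Rightarrow> (real \<Rightarrow> real) \<Rightarrow> real \<Rightarrow> real" where
  "abel c \<Phi> t = integral {c..t} (\<lambda>\<tau>. \<Phi> \<tau> / sqrt (t - \<tau>))"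

lemma scaled_in_interval:
  assumes "c \<le> t" "\<theta> \<in> {0..1}" shows "t - (t - c) * \<theta>\<^sup>2 \<in> {c..t::real}"
proof -
  have "(t - c) * \<theta>\<^sup>2 \<le> (t - c) * 1"
    by (rule mult_left_mono) (use assms power_le_one in auto)
  then show ?thesis using assms by auto
qed

text \<open>
  The substitution \<open>\<tau> = t - (t - c) * \<theta>^2\<close> removes the singularity and fixes the domain of
  integration. The continuity of \<open>abel\<close> and its action on functions of class \<open>C^k\<close> are read off from this form.
\<close>

lemma abel_has_integral_scaled:
  assumes ct: "c \<le> t" and \<Phi>: "continuous_on {c..t} \<Phi>"
  shows "((\<lambda>\<tau>. \<Phi> \<tau> / sqrt (t - \<tau>)) has_integral
           2 * sqrt (t - c) * integral {0..1} (\<lambda>\<theta>. \<Phi> (t - (t - c) * \<theta>\<^sup>2))) {c..t}"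
proof (cases "c = t")
  case True then show ?thesis by (simp add: has_integral_refl)
next
  case False
  with ct have "c < t" by simp
  define \<psi> where "\<psi> \<theta> = 2 * sqrt (t - c) * \<Phi> (t - (t - c) * \<theta>\<^sup>2)" for \<theta>
  define \<Xi> where "\<Xi> = (\<lambda>\<theta>. integral {0..\<theta>} \<psi>)"
  define q where "q = (\<lambda>\<tau>. sqrt ((t - \<tau>) / (t - c)))"
  have \<psi>: "continuous_on {0..1} \<psi>"
    unfolding \<psi>_def using scaled_in_interval[OF ct]
    by (intro continuous_intros continuous_on_compose2[OF \<Phi>]) auto
  have q01: "q \<tau> \<in> {0..1}" if "\<tau> \<in> {c..t}" for \<tau>
    using that \<open>c < t\<close> by (auto simp: q_def)
  have \<Xi>: "continuous_on {0..1} \<Xi>"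
    unfolding \<Xi>_def by (rule indefinite_integral_continuous_1[OF integrable_continuous_real[OF \<psi>]])
  have "continuous_on {c..t} q"
    unfolding q_def using \<open>c < t\<close> by (intro continuous_intros) auto
  then have "continuous_on {c..t} (\<lambda>\<tau>. \<Xi> (q \<tau>))"
    by (rule continuous_on_compose2[OF \<Xi>]) (use q01 in auto)
  then have cont: "continuous_on {c..t} (\<lambda>\<tau>. - \<Xi> (q \<tau>))"
    by (rule continuous_on_minus)
  have der: "((\<lambda>\<tau>. - \<Xi> (q \<tau>)) has_vector_derivative \<Phi> \<tau> / sqrt (t - \<tau>)) (at \<tau>)"
    if \<tau>: "\<tau> \<in> {c<..<t}" for \<tau>
  proof -
    have q: "q \<tau> \<in> {0<..<1}" using \<tau> by (auto simp: q_def)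
    have "(\<Xi> has_real_derivative \<psi> (q \<tau>)) (at (q \<tau>) within {0..1})"
      unfolding \<Xi>_def by (rule integral_has_real_derivative[OF \<psi>]) (use q in auto)
    then have \<Xi>': "(\<Xi> has_real_derivative \<psi> (q \<tau>)) (at (q \<tau>))"
      using q at_within_Icc_at[of 0 "q \<tau>" 1] by (simp only: greaterThanLessThan_iff)
    have "((\<lambda>\<tau>. (t - \<tau>) / (t - c)) has_real_derivative - 1 / (t - c)) (at \<tau>)"
      by (rule DERIV_cdivide) (auto intro!: derivative_eq_intros)
    then have q': "(q has_real_derivative inverse (q \<tau>) / 2 * (- 1 / (t - c))) (at \<tau>)"
      unfolding q_def by (rule DERIV_chain2[OF DERIV_real_sqrt, rotated]) (use \<tau> in auto)
    define S where "S = sqrt (t - c)"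
    have S: "t - c = S * S" "S > 0" using \<open>c < t\<close> by (auto simp: S_def)
    have "(t - c) * (q \<tau>)\<^sup>2 = t - \<tau>" using \<tau> by (auto simp: q_def)
    then have \<psi>q: "\<psi> (q \<tau>) = 2 * S * \<Phi> \<tau>" by (simp add: \<psi>_def S_def)
    have "sqrt (t - \<tau>) = S * q \<tau>"
      using \<tau> by (simp add: q_def S_def flip: real_sqrt_mult)
    then have "- (\<psi> (q \<tau>) * (inverse (q \<tau>) / 2 * (- 1 / (t - c)))) = \<Phi> \<tau> / sqrt (t - \<tau>)"
      unfolding \<psi>q S(1) using S(2) q by (simp add: field_simps)
    with DERIV_minus[OF DERIV_chain2[OF \<Xi>' q']] show ?thesis
      by (simp only: has_real_derivative_iff_has_vector_derivative)
  qed
  have "((\<lambda>\<tau>. \<Phi> \<tau> / sqrt (t - \<tau>)) has_integral (- \<Xi> (q t) - - \<Xi> (q c))) {c..t}"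
    by (rule fundamental_theorem_of_calculus_interior[OF ct cont der])
  moreover have "q t = 0" "q c = 1" using \<open>c < t\<close> by (auto simp: q_def)
  moreover have "integral {0..1} \<psi> = 2 * sqrt (t - c) * integral {0..1} (\<lambda>\<theta>. \<Phi> (t - (t - c) * \<theta>\<^sup>2))"
    unfolding \<psi>_def by (rule integral_mult_right)
  ultimately show ?thesis by (simp add: \<Xi>_def)
qed

lemma abel_scaled:
  assumes "c \<le> t" "continuous_on {c..t} \<Phi>"
  shows "abel c \<Phi> t = 2 * sqrt (t - c) * integral {0..1} (\<lambda>\<theta>. \<Phi> (t - (t - c) * \<theta>\<^sup>2))"
  unfolding abel_def using abel_has_integral_scaled[OF assms] by (rule integral_unique)

lemma abel_has_integral:
  assumes "c \<le> t" "continuous_on {c..t} \<Phi>"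
  shows "((\<lambda>\<tau>. \<Phi> \<tau> / sqrt (t - \<tau>)) has_integral abel c \<Phi> t) {c..t}"
  using abel_has_integral_scaled[OF assms] abel_scaled[OF assms] by simp

lemma abel_add:
  assumes "c \<le> t" "continuous_on {c..t} \<Phi>" "continuous_on {c..t} \<Psi>"
  shows "abel c (\<lambda>\<tau>. \<Phi> \<tau> + \<Psi> \<tau>) t = abel c \<Phi> t + abel c \<Psi> t"
  using has_integral_add[OF abel_has_integral[OF assms(1,2)] abel_has_integral[OF assms(1,3)]]
  unfolding abel_def by (auto intro!: integral_unique simp: add_divide_distrib)

lemma abel_cmult: "abel c (\<lambda>\<tau>. k * \<Phi> \<tau>) t = k * abel c \<Phi> t"
  unfolding abel_def by (simp flip: times_divide_eq_right)

lemma continuous_on_triangle_row: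
  assumes "continuous_on {(r, \<tau>). c \<le> \<tau> \<and> \<tau> \<le> r \<and> r \<le> t} (\<lambda>(r, \<tau>). M r \<tau>)" "r \<le> t"
  shows "continuous_on {c..r} (M r)"
proof -
  have "continuous_on {c..r} (\<lambda>\<tau>. (r, \<tau>))" by (intro continuous_intros)
  from continuous_on_compose2[OF assms(1) this] assms(2) show ?thesis by force
qed

lemma abel_continuous:
  assumes M: "continuous_on {(r, \<tau>). c \<le> \<tau> \<and> \<tau> \<le> r \<and> r \<le> t} (\<lambda>(r, \<tau>). M r \<tau>)"
  shows "continuous_on {c..t} (\<lambda>r. abel c (M r) r)"
proof -
  let ?g = "\<lambda>r. 2 * sqrt (r - c) * integral {0..1} (\<lambda>\<theta>. M r (r - (r - c) * \<theta>\<^sup>2))"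
  have "continuous_on ({c..t} \<times> cbox 0 1) (\<lambda>z. (fst z, fst z - (fst z - c) * (snd z)\<^sup>2))"
    by (intro continuous_intros)
  from continuous_on_compose2[OF M this]
  have "continuous_on ({c..t} \<times> cbox 0 1) (\<lambda>(r, \<theta>). M r (r - (r - c) * \<theta>\<^sup>2))"
    using scaled_in_interval by (force simp: split_beta)
  from integral_continuous_on_param[OF this]
  have "continuous_on {c..t} ?g" by (auto intro!: continuous_intros)
  then show ?thesis
    by (rule continuous_on_eq) (use abel_scaled continuous_on_triangle_row[OF M] in auto)
qed

lemma has_bochner_integral_of_nonneg:
  assumes "f \<in> borel_measurable borel" "\<And>x. 0 \<le> f x" "(f has_integral I) UNIV"
  shows "has_bochner_integral lborel f (I::real)"
proof (rule has_bochner_integral_nn_integral)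
  show "0 \<le> I" using assms(2,3) by (meson has_integral_nonneg)
  show "(\<integral>\<^sup>+x. f x \<partial>lborel) = ennreal I"
    by (rule nn_integral_has_integral_lborel[OF assms])
qed (use assms in auto)

text \<open>
  The Lebesgue version is needed only to apply Fubini's theorem. Adding a constant reduces the claim to
  nonnegative densities, for which the integral in the sense of Henstock and Kurzweil is absolute.
\<close>

lemma abel_has_bochner_integral:
  assumes ct: "c \<le> t" and \<Phi>: "continuous_on {c..t} \<Phi>"
  shows "has_bochner_integral lborel (\<lambda>\<tau>. indicator {c..t} \<tau> * \<Phi> \<tau> / sqrt (t - \<tau>)) (abel c \<Phi> t)"
proof -
  have nonneg: "has_bochner_integral lborel (\<lambda>\<tau>. indicator {c..t} \<tau> * \<Psi> \<tau> / sqrt (t - \<tau>)) (abel c \<Psi> t)"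
    if \<Psi>: "continuous_on {c..t} \<Psi>" "\<And>\<tau>. \<tau> \<in> {c..t} \<Longrightarrow> 0 \<le> \<Psi> \<tau>" for \<Psi>
  proof (rule has_bochner_integral_of_nonneg)
    have "(\<lambda>\<tau>. indicator {c..t} \<tau> *\<^sub>R \<Psi> \<tau>) \<in> borel_measurable borel"
      by (rule borel_measurable_continuous_on_indicator[OF _ \<Psi>(1)]) simp
    then show "(\<lambda>\<tau>. indicator {c..t} \<tau> * \<Psi> \<tau> / sqrt (t - \<tau>)) \<in> borel_measurable borel"
      by simp
    show "0 \<le> indicator {c..t} \<tau> * \<Psi> \<tau> / sqrt (t - \<tau>)" for \<tau>
      using \<Psi>(2) by (auto simp: indicator_def)
    have "((\<lambda>\<tau>. if \<tau> \<in> {c..t} then \<Psi> \<tau> / sqrt (t - \<tau>) else 0) has_integral abel c \<Psi> t) UNIV"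
      using abel_has_integral[OF ct \<Psi>(1)] by (simp only: has_integral_restrict_UNIV)
    then show "((\<lambda>\<tau>. indicator {c..t} \<tau> * \<Psi> \<tau> / sqrt (t - \<tau>)) has_integral abel c \<Psi> t) UNIV"
      by (rule has_integral_eq[rotated]) (auto simp: indicator_def)
  qed
  have "bounded (\<Phi> ` {c..t})"
    by (intro compact_imp_bounded compact_continuous_image \<Phi>) simp
  then obtain C where C: "\<And>\<tau>. \<tau> \<in> {c..t} \<Longrightarrow> \<bar>\<Phi> \<tau>\<bar> \<le> C"
    unfolding bounded_iff by (metis image_eqI real_norm_def)
  have "has_bochner_integral lborel (\<lambda>\<tau>. indicator {c..t} \<tau> * (\<bar>C\<bar> + \<Phi> \<tau>) / sqrt (t - \<tau>)
      - indicator {c..t} \<tau> * \<bar>C\<bar> / sqrt (t - \<tau>)) (abel c (\<lambda>\<tau>. \<bar>C\<bar> + \<Phi> \<tau>) t - abel c (\<lambda>_. \<bar>C\<bar>) t)"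
    by (intro has_bochner_integral_diff nonneg continuous_intros \<Phi>) (use C in \<open>force\<close>)+
  then show ?thesis using abel_add[OF ct _ \<Phi>, of "\<lambda>_. \<bar>C\<bar>"]
    by (simp add: algebra_simps add_divide_distrib)
qed

text \<open>
  Fubini's theorem on the triangle \<open>c \<le> \<tau> \<le> r \<le> t\<close> for an integrand with inverse square root
  singularities at \<open>r = t\<close> and at \<open>r = \<tau>\<close>. Integrability follows from Tonelli's theorem, since
  integrating the absolute value over \<open>\<tau>\<close> again gives an Abel integrand with continuous density. The
  inner integral over \<open>r\<close> is supplied by the caller in closed form.
\<close>

lemma abel_iterated:
  assumes ct: "c \<le> t"
    and M: "continuous_on {(r, \<tau>). c \<le> \<tau> \<and> \<tau> \<le> r \<and> r \<le> t} (\<lambda>(r, \<tau>). M r \<tau>)"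
    and N: "(\<lambda>\<tau>. indicator {c..t} \<tau> * N \<tau>) \<in> borel_measurable borel"
    and inner: "\<And>\<tau>. c \<le> \<tau> \<Longrightarrow> \<tau> < t \<Longrightarrow>
      ((\<lambda>r. M r \<tau> / (sqrt (t - r) * sqrt (r - \<tau>))) has_integral N \<tau>) {\<tau>..t}"
  shows "abel c (\<lambda>r. abel c (M r) r) t = integral {c..t} N"
proof -
  define T where "T = {(r, \<tau>). c \<le> \<tau> \<and> \<tau> \<le> r \<and> r \<le> t}"
  define f where "f r \<tau> = indicator T (r, \<tau>) * M r \<tau> / (sqrt (t - r) * sqrt (r - \<tau>))" for r \<tau>
  have T: "closed T"
  proof -
    have "T = {z. c \<le> snd z} \<inter> {z. snd z \<le> fst z} \<inter> {z. fst z \<le> t}" by (auto simp: T_def)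
    then show ?thesis by (auto intro!: closed_Int closed_Collect_le continuous_intros)
  qed
  have row: "has_bochner_integral lborel (\<lambda>\<tau>. indicator T (r, \<tau>) * L r \<tau> / (sqrt (t - r) * sqrt (r - \<tau>)))
      (indicator {c..t} r * abel c (L r) r / sqrt (t - r))"
    if L: "continuous_on T (\<lambda>(r, \<tau>). L r \<tau>)" for L r
  proof (cases "r \<in> {c..t}")
    case True
    have "has_bochner_integral lborel (\<lambda>\<tau>. indicator {c..r} \<tau> * L r \<tau> / sqrt (r - \<tau>)) (abel c (L r) r)"
      by (rule abel_has_bochner_integral) (use True continuous_on_triangle_row[OF L[unfolded T_def]] in auto)
    from has_bochner_integral_divide_zero[OF this, of "sqrt (t - r)"]
    show ?thesis using True
      by (simp add: T_def indicator_def if_distrib cong: if_cong has_bochner_integral_cong)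
        (simp add: mult.commute)
  next
    case False
    then have "(\<lambda>\<tau>. indicator T (r, \<tau>) * L r \<tau> / (sqrt (t - r) * sqrt (r - \<tau>))) = (\<lambda>_. 0)"
      by (auto simp: T_def fun_eq_iff indicator_def)
    then show ?thesis using False by (simp add: has_bochner_integral_zero)
  qed
  have M': "continuous_on T (\<lambda>(r, \<tau>). \<bar>M r \<tau>\<bar>)"
    using continuous_on_rabs[OF M[folded T_def]] by (simp add: split_beta)
  have meas: "case_prod f \<in> borel_measurable (lborel \<Otimes>\<^sub>M lborel)"
  proof -
    have "(\<lambda>z. indicator T z *\<^sub>R (\<lambda>(r, \<tau>). M r \<tau>) z) \<in> borel_measurable borel"
      by (rule borel_measurable_continuous_on_indicator[OF _ M[folded T_def]]) (use T in auto)
    moreover have "(\<lambda>z::real \<times> real. sqrt (t - fst z) * sqrt (fst z - snd z)) \<in> borel_measurable borel"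
      by (intro borel_measurable_continuous_onI continuous_intros)
    ultimately have "(\<lambda>z. indicator T z *\<^sub>R (\<lambda>(r, \<tau>). M r \<tau>) z / (sqrt (t - fst z) * sqrt (fst z - snd z)))
        \<in> borel_measurable borel" by simp
    moreover have "case_prod f = (\<lambda>z. indicator T z *\<^sub>R (\<lambda>(r, \<tau>). M r \<tau>) z / (sqrt (t - fst z) * sqrt (fst z - snd z)))"
      by (auto simp: f_def fun_eq_iff)
    ultimately show ?thesis by (simp only: lborel_prod measurable_lborel2)
  qed
  have int: "integrable (lborel \<Otimes>\<^sub>M lborel) (case_prod f)"
  proof (rule lborel_pair.Fubini_integrable[OF meas])
    have nf: "norm (case_prod f (r, \<tau>)) = indicator T (r, \<tau>) * \<bar>M r \<tau>\<bar> / (sqrt (t - r) * sqrt (r - \<tau>))" for r \<tau>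
      by (auto simp: f_def T_def indicator_def abs_mult)
    have "integrable lborel (\<lambda>r. indicator {c..t} r * abel c (\<lambda>\<tau>. \<bar>M r \<tau>\<bar>) r / sqrt (t - r))"
      using abel_has_bochner_integral[OF ct abel_continuous[OF M'[unfolded T_def]]]
      by (rule integrable.intros)
    then show "integrable lborel (\<lambda>r. LINT \<tau>|lborel. norm (case_prod f (r, \<tau>)))"
      unfolding nf has_bochner_integral_integral_eq[OF row[OF M']] .
    show "AE r in lborel. integrable lborel (\<lambda>\<tau>. case_prod f (r, \<tau>))"
      using row[OF M[folded T_def]] by (auto simp: f_def integrable.simps)
  qed
  have "abel c (\<lambda>r. abel c (M r) r) t = (LINT r|lborel. indicator {c..t} r * abel c (M r) r / sqrt (t - r))"
    using abel_has_bochner_integral[OF ct abel_continuous[OF M]] has_bochner_integral_integral_eq by metis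
  also have "\<dots> = (LINT r|lborel. LINT \<tau>|lborel. f r \<tau>)"
    using has_bochner_integral_integral_eq[OF row[OF M[folded T_def]]] by (simp add: f_def)
  also have "\<dots> = (LINT \<tau>|lborel. LINT r|lborel. f r \<tau>)"
    by (rule lborel_pair.Fubini_integral[OF int, symmetric])
  also have "\<dots> = integral {c..t} N"
  proof -
    have ae: "AE \<tau> in lborel. (LINT r|lborel. f r \<tau>) = indicator {c..t} \<tau> * N \<tau>"
    proof -
      have "AE \<tau> in lborel. \<tau> \<noteq> t" by (rule AE_lborel_singleton)
      moreover have "AE \<tau> in lborel. integrable lborel (\<lambda>r. f r \<tau>)"
        using lborel_pair.AE_integrable_snd[OF int] by simp
      ultimately show ?thesis
      proof eventually_elim
        case (elim \<tau>)
        show ?case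
        proof (cases "\<tau> \<in> {c..t}")
          case True
          have "(LINT r|lborel. f r \<tau>) = integral UNIV (\<lambda>r. f r \<tau>)"
            using integral_lborel[OF elim(2)] by simp
          also have "\<dots> = integral {\<tau>..t} (\<lambda>r. M r \<tau> / (sqrt (t - r) * sqrt (r - \<tau>)))"
          proof -
            have fe: "(\<lambda>r. f r \<tau>) = (\<lambda>r. if r \<in> {\<tau>..t} then M r \<tau> / (sqrt (t - r) * sqrt (r - \<tau>)) else 0)"
              using True by (auto simp: f_def T_def indicator_def fun_eq_iff)
            show ?thesis unfolding fe by (rule integral_restrict_UNIV)
          qed
          also have "\<dots> = N \<tau>"
            by (rule integral_unique[OF inner]) (use True elim(1) in auto)
          finally show ?thesis using True by simp
        next
          case False
          then have "f r \<tau> = 0" for r by (auto simp: f_def T_def)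
          then show ?thesis using False by simp
        qed
      qed
    qed
    have "integrable lborel (\<lambda>\<tau>. LINT r|lborel. f r \<tau>)"
      using lborel_pair.integrable_snd[OF int] by simp
    then have i: "integrable lborel (\<lambda>\<tau>. indicator {c..t} \<tau> * N \<tau>)"
      using integrable_cong_AE[OF _ _ ae] N by auto
    have "(LINT \<tau>|lborel. LINT r|lborel. f r \<tau>) = (LINT \<tau>|lborel. indicator {c..t} \<tau> * N \<tau>)"
      by (rule integral_cong_AE[OF _ _ ae]) (use N \<open>integrable lborel (\<lambda>\<tau>. LINT r|lborel. f r \<tau>)\<close> in auto)
    also have "\<dots> = integral UNIV (\<lambda>\<tau>. if \<tau> \<in> {c..t} then N \<tau> else 0)"
      unfolding integral_lborel[OF i, symmetric] by (rule integral_cong) (auto simp: indicator_def)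
    finally show ?thesis by (simp only: integral_restrict_UNIV)
  qed
  finally show ?thesis .
qed

lemma arcsine_integral:
  assumes "\<tau> < (t::real)"
  shows "((\<lambda>r. 1 / (sqrt (t - r) * sqrt (r - \<tau>))) has_integral pi) {\<tau>..t}"
proof -
  define q where "q = (\<lambda>r. (2 * r - t - \<tau>) / (t - \<tau>))"
  have "((\<lambda>r. 1 / (sqrt (t - r) * sqrt (r - \<tau>))) has_integral arcsin (q t) - arcsin (q \<tau>)) {\<tau>..t}"
  proof (rule fundamental_theorem_of_calculus_interior)
    show "continuous_on {\<tau>..t} (\<lambda>r. arcsin (q r))"
    proof (rule continuous_on_arcsin)
      show "continuous_on {\<tau>..t} q" unfolding q_def using assms by (intro continuous_intros) auto
      show "\<forall>r\<in>{\<tau>..t}. - 1 \<le> q r \<and> q r \<le> 1" using assms by (auto simp: q_def field_simps)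
    qed
    fix r assume r: "r \<in> {\<tau><..<t}"
    have q1: "- 1 < q r" "q r < 1" using r by (auto simp: q_def field_simps)
    have "1 - (q r)\<^sup>2 = 4 * ((t - r) * (r - \<tau>)) / (t - \<tau>)\<^sup>2"
    proof -
      have "(t - \<tau>)\<^sup>2 - (2 * r - t - \<tau>)\<^sup>2 = 4 * ((t - r) * (r - \<tau>))"
        by (simp add: power2_eq_square algebra_simps)
      then show ?thesis using assms by (simp add: q_def power_divide flip: diff_divide_distrib)
        (simp add: field_simps)
    qed
    then have sq: "sqrt (1 - (q r)\<^sup>2) = 2 * (sqrt (t - r) * sqrt (r - \<tau>)) / (t - \<tau>)"
      using assms by (simp add: real_sqrt_mult real_sqrt_divide)
    have "(q has_real_derivative 2 / (t - \<tau>)) (at r)"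
      unfolding q_def by (rule DERIV_cdivide) (auto intro!: derivative_eq_intros)
    from DERIV_chain2[OF DERIV_arcsin[OF q1] this]
    have "((\<lambda>r. arcsin (q r)) has_real_derivative inverse (sqrt (1 - (q r)\<^sup>2)) * (2 / (t - \<tau>))) (at r)" .
    moreover have "inverse (sqrt (1 - (q r)\<^sup>2)) * (2 / (t - \<tau>)) = 1 / (sqrt (t - r) * sqrt (r - \<tau>))"
    proof -
      have "sqrt (t - r) * sqrt (r - \<tau>) > 0" using r by simp
      then show ?thesis unfolding sq using assms by (simp add: divide_simps)
    qed
    ultimately show "((\<lambda>r. arcsin (q r)) has_vector_derivative 1 / (sqrt (t - r) * sqrt (r - \<tau>))) (at r)"
      by (simp add: has_real_derivative_iff_has_vector_derivative)
  qed (use assms in simp)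
  moreover have "q t = 1" "q \<tau> = -1" using assms by (auto simp: q_def field_simps)
  ultimately show ?thesis by simp
qed

text \<open>
  Two half integrations are one integration; the factor \<open>\<pi>\<close> is the arcsine integral, that is,
  Euler's Beta function at \<open>(1/2, 1/2)\<close>.
\<close>

lemma abel_abel:
  assumes ct: "c \<le> t" and h: "continuous_on {c..t} h"
  shows "abel c (abel c h) t = pi * integral {c..t} h"
proof -
  have "abel c (\<lambda>r. abel c ((\<lambda>r \<tau>. h \<tau>) r) r) t = integral {c..t} (\<lambda>\<tau>. pi * h \<tau>)"
  proof (rule abel_iterated[OF ct])
    show "continuous_on {(r, \<tau>). c \<le> \<tau> \<and> \<tau> \<le> r \<and> r \<le> t} (\<lambda>(r, \<tau>). h \<tau>)"
    proof -
      have "continuous_on {(r, \<tau>). c \<le> \<tau> \<and> \<tau> \<le> r \<and> r \<le> t} (\<lambda>z. h (snd z))"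
        by (rule continuous_on_compose2[OF h]) (auto intro!: continuous_on_snd)
      then show ?thesis by (simp only: case_prod_unfold)
    qed
    have "continuous_on {c..t} (\<lambda>\<tau>. pi * h \<tau>)" by (intro continuous_intros h)
    from borel_measurable_continuous_on_indicator[OF _ this]
    show "(\<lambda>\<tau>. indicator {c..t} \<tau> * (pi * h \<tau>)) \<in> borel_measurable borel" by simp
    show "((\<lambda>r. h \<tau> / (sqrt (t - r) * sqrt (r - \<tau>))) has_integral pi * h \<tau>) {\<tau>..t}" if "\<tau> < t" for \<tau>
      using has_integral_mult_right[OF arcsine_integral[OF that], of "h \<tau>"] by (simp add: mult.commute)
  qed
  then show ?thesis by simp
qed

text \<open>
  A kernel that vanishes on the diagonal turns the half-order smoothing of \<open>abel\<close> into the gain of a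
  full derivative: write \<open>a t \<tau> / sqrt (t - \<tau>)\<close> as the integral of its derivative over \<open>r\<close> between \<open>\<tau>\<close> and
  \<open>t\<close> and exchange the order of integration. The density \<open>h\<close> is never differentiated.
\<close>

lemma abel_gain:
  assumes c: "0 < c" "c \<le> t" and h: "continuous_on {c..t} h"
    and diag: "\<And>\<tau>. 0 < \<tau> \<Longrightarrow> a \<tau> \<tau> = 0"
    and der: "\<And>r \<tau>. 0 < r \<Longrightarrow> 0 < \<tau> \<Longrightarrow> ((\<lambda>r. a r \<tau>) has_real_derivative \<alpha> r \<tau>) (at r)"
    and \<alpha>: "continuous_on ({0<..} \<times> {0<..}) (\<lambda>(r, \<tau>). \<alpha> r \<tau>)"
    and gk: "continuous_on ({0<..} \<times> {0<..}) (\<lambda>(r, \<tau>). gain_kernel \<alpha> r \<tau>)"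
    and at: "continuous_on {c..t} (a t)"
  shows "abel c (\<lambda>\<tau>. a t \<tau> * h \<tau>) t = integral {c..t} (\<lambda>r. abel c (\<lambda>\<tau>. gain_kernel \<alpha> r \<tau> * h \<tau>) r)"
proof -
  let ?T = "{(r, \<tau>). c \<le> \<tau> \<and> \<tau> \<le> r \<and> r \<le> t}"
  \<comment> \<open>The factor \<open>sqrt (t - r)\<close> cancels the outer singularity of \<open>abel_iterated\<close>, which is not present here.\<close>
  define M where "M r \<tau> = sqrt (t - r) * (gain_kernel \<alpha> r \<tau> * h \<tau>)" for r \<tau>
  have mean: "a r \<tau> = (r - \<tau>) * integral {0..1} (\<lambda>\<eta>. \<alpha> (\<tau> + \<eta> * (r - \<tau>)) \<tau>)" if "0 < \<tau>" "\<tau> \<le> r" for r \<tau>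
  proof -
    have "a r \<tau> - a \<tau> \<tau> = (r - \<tau>) * weighted_mean (\<lambda>_. 1) (\<lambda>r. \<alpha> r \<tau>) r \<tau>"
      by (rule mean_value_integral[where \<phi> = "\<lambda>r. a r \<tau>"]) (use that der in auto)
    then show ?thesis using diag[OF that(1)] by (simp add: weighted_mean_def)
  qed
  have der': "((\<lambda>r. a r \<tau> / sqrt (r - \<tau>)) has_real_derivative gain_kernel \<alpha> r \<tau> / sqrt (r - \<tau>)) (at r)"
    if "0 < \<tau>" "\<tau> < r" for r \<tau>
  proof -
    define S where "S = sqrt (r - \<tau>)"
    have S: "S > 0" "S * S = r - \<tau>" using that by (auto simp: S_def)
    define A where "A = integral {0..1} (\<lambda>\<eta>. \<alpha> (\<tau> + \<eta> * (r - \<tau>)) \<tau>)"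
    have "((\<lambda>r. r - \<tau>) has_real_derivative 1) (at r)" by (auto intro!: derivative_eq_intros)
    then have "((\<lambda>r. sqrt (r - \<tau>)) has_real_derivative inverse S / 2 * 1) (at r)"
      unfolding S_def by (rule DERIV_chain2[OF DERIV_real_sqrt, rotated]) (use that in auto)
    from DERIV_divide[OF der[of r \<tau>] this]
    have "((\<lambda>r. a r \<tau> / sqrt (r - \<tau>)) has_real_derivative (\<alpha> r \<tau> * S - a r \<tau> * (inverse S / 2)) / (S * S)) (at r)"
      using that S unfolding S_def by simp
    moreover have "(\<alpha> r \<tau> * S - a r \<tau> * (inverse S / 2)) / (S * S) = gain_kernel \<alpha> r \<tau> / S"
    proof -
      have "a r \<tau> = S * S * A" using mean[of \<tau> r] that S by (simp add: A_def)
      then show ?thesis unfolding gain_kernel_def A_def[symmetric] using S(1) by (simp add: field_simps)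
    qed
    ultimately show ?thesis by (simp add: S_def)
  qed
  have T0: "?T \<subseteq> {0<..} \<times> {0<..}" using c by auto
  have ch: "continuous_on ?T (\<lambda>z. h (snd z))"
    by (rule continuous_on_compose2[OF h]) (auto intro!: continuous_on_snd)
  have cg: "continuous_on ?T (\<lambda>z. gain_kernel \<alpha> (fst z) (snd z))"
    using continuous_on_subset[OF gk T0] by (simp only: case_prod_unfold)
  have "continuous_on ?T (\<lambda>z. sqrt (t - fst z) * (gain_kernel \<alpha> (fst z) (snd z) * h (snd z)))"
    by (intro continuous_intros ch cg)
  then have M: "continuous_on ?T (\<lambda>(r, \<tau>). M r \<tau>)"
    by (simp only: case_prod_unfold M_def)
  have ca: "continuous_on {c..t} (\<lambda>\<tau>. a t \<tau> * h \<tau>)" by (intro continuous_intros at h)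
  have "abel c (\<lambda>r. abel c (M r) r) t = integral {c..t} (\<lambda>\<tau>. a t \<tau> * h \<tau> / sqrt (t - \<tau>))"
  proof (rule abel_iterated[OF c(2) M])
    show "(\<lambda>\<tau>. indicator {c..t} \<tau> * (a t \<tau> * h \<tau> / sqrt (t - \<tau>))) \<in> borel_measurable borel"
      using abel_has_bochner_integral[OF c(2) ca] by (auto dest!: integrable.intros)
  next
    fix \<tau> assume \<tau>: "c \<le> \<tau>" "\<tau> < t"
    have cg\<tau>: "continuous_on {\<tau>..t} (\<lambda>r. gain_kernel \<alpha> r \<tau>)"
    proof -
      have "continuous_on {\<tau>..t} (\<lambda>r. (\<lambda>(r, \<tau>). gain_kernel \<alpha> r \<tau>) (r, \<tau>))"
        by (rule continuous_on_compose2[OF gk]) (use \<tau> c in \<open>auto intro!: continuous_on_Pair\<close>)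
      then show ?thesis by simp
    qed
    have "((\<lambda>r. gain_kernel \<alpha> r \<tau> / sqrt (r - \<tau>)) has_integral a t \<tau> / sqrt (t - \<tau>) - a \<tau> \<tau> / sqrt (\<tau> - \<tau>)) {\<tau>..t}"
    proof (rule fundamental_theorem_of_calculus_interior)
      have c\<alpha>: "continuous_on {\<tau>..t} (\<lambda>r. integral {0..1} (\<lambda>\<eta>. \<alpha> (\<tau> + \<eta> * (r - \<tau>)) \<tau>))"
      proof -
        have "continuous_on ({\<tau>..t} \<times> cbox 0 1) (\<lambda>z. (\<lambda>(r, \<tau>). \<alpha> r \<tau>) (\<tau> + snd z * (fst z - \<tau>), \<tau>))"
          by (rule continuous_on_compose2[OF \<alpha>])
             (use \<tau> c in \<open>auto intro!: continuous_intros add_pos_nonneg\<close>)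
        then have "continuous_on ({\<tau>..t} \<times> cbox 0 1) (\<lambda>(r, \<eta>). \<alpha> (\<tau> + \<eta> * (r - \<tau>)) \<tau>)"
          by (simp add: case_prod_unfold)
        from integral_continuous_on_param[OF this] show ?thesis by simp
      qed
      have "continuous_on {\<tau>..t} (\<lambda>r. sqrt (r - \<tau>) * integral {0..1} (\<lambda>\<eta>. \<alpha> (\<tau> + \<eta> * (r - \<tau>)) \<tau>))"
        by (intro continuous_intros c\<alpha>)
      then show "continuous_on {\<tau>..t} (\<lambda>r. a r \<tau> / sqrt (r - \<tau>))"
      proof (rule continuous_on_eq)
        fix r assume "r \<in> {\<tau>..t}"
        then have "a r \<tau> = (r - \<tau>) * integral {0..1} (\<lambda>\<eta>. \<alpha> (\<tau> + \<eta> * (r - \<tau>)) \<tau>)"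
          using mean[of \<tau> r] \<tau> c by simp
        then show "sqrt (r - \<tau>) * integral {0..1} (\<lambda>\<eta>. \<alpha> (\<tau> + \<eta> * (r - \<tau>)) \<tau>) = a r \<tau> / sqrt (r - \<tau>)"
          using real_div_sqrt[of "r - \<tau>"] \<open>r \<in> {\<tau>..t}\<close> by (metis atLeastAtMost_iff diff_ge_0_iff_ge times_divide_eq_left)
      qed
      show "((\<lambda>r. a r \<tau> / sqrt (r - \<tau>)) has_vector_derivative gain_kernel \<alpha> r \<tau> / sqrt (r - \<tau>)) (at r)"
        if "r \<in> {\<tau><..<t}" for r
        using der'[of \<tau> r] that \<tau> c by (simp add: has_real_derivative_iff_has_vector_derivative)
    qed (use \<tau> in simp)
    then have "((\<lambda>r. gain_kernel \<alpha> r \<tau> / sqrt (r - \<tau>)) has_integral a t \<tau> / sqrt (t - \<tau>)) {\<tau>..t}"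
      by simp
    from has_integral_mult_left[OF this, of "h \<tau>"]
    have "((\<lambda>r. gain_kernel \<alpha> r \<tau> / sqrt (r - \<tau>) * h \<tau>) has_integral a t \<tau> * h \<tau> / sqrt (t - \<tau>)) {\<tau>..t}"
      by simp
    then show "((\<lambda>r. M r \<tau> / (sqrt (t - r) * sqrt (r - \<tau>))) has_integral a t \<tau> * h \<tau> / sqrt (t - \<tau>)) {\<tau>..t}"
      by (rule has_integral_spike[OF negligible_sing[of t], rotated]) (auto simp: M_def)
  qed
  moreover have "abel c (\<lambda>r. abel c (M r) r) t = integral {c..t} (\<lambda>r. abel c (\<lambda>\<tau>. gain_kernel \<alpha> r \<tau> * h \<tau>) r)"
    unfolding abel_def[of _ "\<lambda>r. abel c (M r) r"]
  proof (rule integral_spike[OF negligible_sing[of t]])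
    fix r assume "r \<in> {c..t} - {t}"
    moreover have "M r = (\<lambda>\<tau>. sqrt (t - r) * (gain_kernel \<alpha> r \<tau> * h \<tau>))"
      by (rule ext) (simp add: M_def)
    ultimately show "abel c (\<lambda>\<tau>. gain_kernel \<alpha> r \<tau> * h \<tau>) r = abel c (M r) r / sqrt (t - r)"
      by (simp add: abel_cmult)
  qed
  ultimately show ?thesis unfolding abel_def[of c "\<lambda>\<tau>. a t \<tau> * h \<tau>"] by simp
qed

lemma continuous_on_half_line:
  fixes f :: "real \<Rightarrow> real"
  assumes "\<And>T. continuous_on {c..T} f" shows "continuous_on {c..} f"
  unfolding continuous_on_eq_continuous_within
proof
  fix x assume "x \<in> {c..}"
  have "at x within {c..} = at x within {c..x + 1}"
    by (rule at_within_nhd[of _ "{..<x + 1}"]) auto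
  then show "continuous (at x within {c..}) f"
    using assms[of "x + 1"] \<open>x \<in> {c..}\<close> by (simp add: continuous_on_eq_continuous_within)
qed

lemma abel_kernel_triangle:
  fixes \<kappa> :: "real \<Rightarrow> real \<Rightarrow> real"
  assumes c: "0 < c" and \<kappa>: "continuous_on ({0<..} \<times> {0<..}) (\<lambda>(t, \<tau>). \<kappa> t \<tau>)" and h: "continuous_on {c..} h"
  shows "continuous_on {(r, \<tau>). c \<le> \<tau> \<and> \<tau> \<le> r \<and> r \<le> t} (\<lambda>(r, \<tau>). \<kappa> r \<tau> * h \<tau>)"
proof -
  let ?T = "{(r, \<tau>). c \<le> \<tau> \<and> \<tau> \<le> r \<and> r \<le> t}"
  have "continuous_on ?T (\<lambda>z. (\<lambda>(t, \<tau>). \<kappa> t \<tau>) z)"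
  proof (rule continuous_on_subset[OF \<kappa>])
    have "0 < \<tau> \<and> 0 < r" if "c \<le> \<tau>" "\<tau> \<le> r" for r \<tau>
      using c that by linarith
    then show "?T \<subseteq> {0<..} \<times> {0<..}" by auto
  qed
  moreover have "continuous_on ?T (\<lambda>z. h (snd z))"
    by (rule continuous_on_compose2[OF h]) (auto intro!: continuous_on_snd)
  ultimately have "continuous_on ?T (\<lambda>z. (\<lambda>(t, \<tau>). \<kappa> t \<tau>) z * h (snd z))"
    by (rule continuous_on_mult)
  then show ?thesis by (simp only: case_prod_unfold)
qed

lemma abel_kernel_continuous:
  assumes "0 < c" "continuous_on ({0<..} \<times> {0<..}) (\<lambda>(t, \<tau>). \<kappa> t \<tau>)" "continuous_on {c..} h"
  shows "continuous_on {c..} (\<lambda>t. abel c (\<lambda>\<tau>. \<kappa> t \<tau> * h \<tau>) t)"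
  by (rule continuous_on_half_line, rule abel_continuous, rule abel_kernel_triangle[OF assms])

text \<open>
  The density may be irregular at the starting point \<open>c\<close>:
  for \<open>t\<close> beyond an intermediate point \<open>c'\<close> the part of the integral before \<open>c'\<close> has a kernel regular in
  \<open>t\<close>, and the part after \<open>c'\<close> is regular by the scaled form.
\<close>

lemma abel_kernel_Ck:
  assumes c: "0 < c" and \<kappa>: "smooth_kernel TYPE(real) k \<kappa>"
    and h: "continuous_on {c..} h" "Ck k {c<..} h"
  shows "Ck k {c<..} (\<lambda>t. abel c (\<lambda>\<tau>. \<kappa> t \<tau> * h \<tau>) t)"
proof (rule Ck_local)
  fix t0 assume "t0 \<in> {c<..}"
  \<comment> \<open>Any point between \<open>c\<close> and \<open>t0\<close> separates the irregular starting point from \<open>t0\<close>.\<close>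
  define c' where "c' = (c + t0) / 2"
  have c': "c < c'" "c' < t0" using \<open>t0 \<in> {c<..}\<close> by (auto simp: c'_def)
  let ?J = "{c'<..}"
  have J: "open ?J" "convex ?J" by (auto intro: convex_real_interval)
  have off: "Ck k ?J (\<lambda>t. integral {c..c'} (\<lambda>\<tau>. \<kappa> t \<tau> * h \<tau> / sqrt (t - \<tau>)))"
  proof (rule Ck_integral[OF J])
    have "Ck_param k ?J {c..c'} (\<lambda>t \<tau>. \<kappa> t \<tau>)"
      by (rule smooth_kernelD[OF \<kappa> J Ck_param_id Ck_param_const]) (use c c' in auto)
    moreover have "Ck_param k ?J {c..c'} (\<lambda>t \<tau>. h \<tau>)"
      by (rule Ck_param_const) (rule continuous_on_subset[OF h(1)], auto)
    moreover have "Ck_param k ?J {c..c'} (\<lambda>t \<tau>. sqrt (t - \<tau>))"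
      by (intro Ck_param_sqrt Ck_param_diff Ck_param_id Ck_param_const) auto
    ultimately show "Ck_param k ?J {c..c'} (\<lambda>t \<tau>. \<kappa> t \<tau> * h \<tau> / sqrt (t - \<tau>))"
      by (intro Ck_param_divide Ck_param_mult) auto
  qed
  let ?\<sigma> = "\<lambda>t \<theta>. t - (t - c') * \<theta>\<^sup>2"
  have \<sigma>: "Ck_param k ?J {0..1} ?\<sigma>"
    by (intro Ck_param_diff Ck_param_mult Ck_param_id Ck_param_const Ck_param_real continuous_intros)
  have \<sigma>c': "c' \<le> ?\<sigma> t \<theta>" if "t \<in> ?J" "\<theta> \<in> {0..1}" for t \<theta>
    using scaled_in_interval[of c' t \<theta>] that by auto
  have on: "Ck k ?J (\<lambda>t. 2 * sqrt (t - c') * integral {0..1} (\<lambda>\<theta>. \<kappa> t (?\<sigma> t \<theta>) * h (?\<sigma> t \<theta>)))"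
  proof (intro Ck_mult Ck_real)
    show "Ck k ?J (\<lambda>t. sqrt (t - c'))"
      unfolding Ck_def by (intro Ck_param_sqrt Ck_param_diff Ck_param_id Ck_param_real) auto
    show "Ck k ?J (\<lambda>t. integral {0..1} (\<lambda>\<theta>. \<kappa> t (?\<sigma> t \<theta>) * h (?\<sigma> t \<theta>)))"
    proof (intro Ck_integral J Ck_param_mult)
      show "Ck_param k ?J {0..1} (\<lambda>t \<theta>. \<kappa> t (?\<sigma> t \<theta>))"
        by (rule smooth_kernelD[OF \<kappa> J Ck_param_id \<sigma>]) (use \<sigma>c' c c' in force)+
      show "Ck_param k ?J {0..1} (\<lambda>t \<theta>. h (?\<sigma> t \<theta>))"
        by (rule Ck_param_compose[OF h(2) \<sigma>]) (use \<sigma>c' c' in force)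
    qed
  qed
  have eq: "abel c (\<lambda>\<tau>. \<kappa> t \<tau> * h \<tau>) t = integral {c..c'} (\<lambda>\<tau>. \<kappa> t \<tau> * h \<tau> / sqrt (t - \<tau>)) +
      2 * sqrt (t - c') * integral {0..1} (\<lambda>\<theta>. \<kappa> t (?\<sigma> t \<theta>) * h (?\<sigma> t \<theta>))" if "t \<in> ?J" for t
  proof -
    have ct: "continuous_on {c..t} (\<lambda>\<tau>. \<kappa> t \<tau> * h \<tau>)"
      by (rule continuous_on_triangle_row[where t = t, OF abel_kernel_triangle[OF c smooth_kernel_continuous[OF \<kappa>] h(1)]]) simp
    have "integral {c..c'} (\<lambda>\<tau>. \<kappa> t \<tau> * h \<tau> / sqrt (t - \<tau>)) + abel c' (\<lambda>\<tau>. \<kappa> t \<tau> * h \<tau>) t = abel c (\<lambda>\<tau>. \<kappa> t \<tau> * h \<tau>) t"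
      unfolding abel_def
      by (rule Henstock_Kurzweil_Integration.integral_combine)
         (use c' that has_integral_integrable[OF abel_has_integral[OF _ ct]] in auto)
    moreover have "continuous_on {c'..t} (\<lambda>\<tau>. \<kappa> t \<tau> * h \<tau>)"
      by (rule continuous_on_subset[OF ct]) (use c' in auto)
    ultimately show ?thesis using abel_scaled[of c' t "\<lambda>\<tau>. \<kappa> t \<tau> * h \<tau>"] that by simp
  qed
  show "\<exists>J. open J \<and> t0 \<in> J \<and> Ck k J (\<lambda>t. abel c (\<lambda>\<tau>. \<kappa> t \<tau> * h \<tau>) t)"
    by (intro exI[of _ ?J] conjI J(1) Ck_cong[OF Ck_add[OF off on] J(1)])
       (use c' eq in auto)
qed simp

lemma abel_Ck:
  assumes "0 < c" "continuous_on {c..} h" "Ck k {c<..} h"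
  shows "Ck k {c<..} (abel c h)"
  using abel_kernel_Ck[OF assms(1) smooth_kernel_const[where a = 1] assms(2,3)] by simp

lemma abel_continuous_on:
  assumes "0 < c" "continuous_on {c..} h" shows "continuous_on {c..} (abel c h)"
  using abel_kernel_continuous[OF assms(1) _ assms(2), of "\<lambda>_ _. 1"] by simp

lemma indefinite_integral_derivative:
  fixes X :: "real \<Rightarrow> real"
  assumes X: "continuous_on {c..} X" and t: "c < t"
  shows "((\<lambda>t. integral {c..t} X) has_real_derivative X t) (at t)"
proof -
  have "((\<lambda>t. integral {c..t} X) has_real_derivative X t) (at t within {c..t + 1})"
    by (rule integral_has_real_derivative) (use t in \<open>auto intro: continuous_on_subset[OF X]\<close>)
  moreover have "at t within {c..t + 1} = at t" by (rule at_within_Icc_at) (use t in auto)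
  ultimately show ?thesis by (simp only:)
qed

lemma abel_gain_Ck:
  assumes c: "0 < c" and h: "continuous_on {c..} h" "Ck k {c<..} h"
    and diag: "\<And>\<tau>. 0 < \<tau> \<Longrightarrow> a \<tau> \<tau> = 0"
    and der: "\<And>r \<tau>. 0 < r \<Longrightarrow> 0 < \<tau> \<Longrightarrow> ((\<lambda>r. a r \<tau>) has_real_derivative \<alpha> r \<tau>) (at r)"
    and \<alpha>: "smooth_kernel TYPE(real \<times> real) k \<alpha>"
    and at: "\<And>t. 0 < t \<Longrightarrow> continuous_on {0<..} (a t)"
  shows "Ck (Suc k) {c<..} (\<lambda>t. abel c (\<lambda>\<tau>. a t \<tau> * h \<tau>) t)"
proof -
  let ?X = "\<lambda>r. abel c (\<lambda>\<tau>. gain_kernel \<alpha> r \<tau> * h \<tau>) r"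
  note g = smooth_kernel_gain[OF \<alpha>]
  have X: "Ck k {c<..} ?X" by (rule abel_kernel_Ck[OF c g h])
  have cX: "continuous_on {c..} ?X"
    by (rule abel_kernel_continuous[OF c smooth_kernel_continuous[OF g] h(1)])
  have "Ck (Suc k) {c<..} (\<lambda>t. integral {c..t} ?X)"
    by (rule Ck_SucI[OF indefinite_integral_derivative[OF cX] X]) simp
  then show ?thesis
  proof (rule Ck_cong)
    fix t assume "t \<in> {c<..}"
    then have t: "c \<le> t" "0 < t" using c by auto
    show "integral {c..t} ?X = abel c (\<lambda>\<tau>. a t \<tau> * h \<tau>) t"
      by (rule abel_gain[OF c t(1) _ diag der smooth_kernel_continuous[OF smooth_kernel_single[OF \<alpha>]]
            smooth_kernel_continuous[OF g], symmetric])
         (use c in \<open>auto intro: continuous_on_subset[OF h(1)] continuous_on_subset[OF at[OF t(2)]]\<close>)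
  qed simp
qed

section \<open>The heat equation on a moving domain and Green's identity\<close>

lemma derivative_along_path:
  fixes F :: "real \<Rightarrow> real \<Rightarrow> real"
  assumes e: "e > 0"
    and Fx: "((\<lambda>x. F x t) has_real_derivative Fx) (at (p t))"
    and Ft: "\<And>x r. x \<in> ball (p t) e \<Longrightarrow> r \<in> ball t e \<Longrightarrow> ((\<lambda>r. F x r) has_real_derivative Ft x r) (at r)"
    and cont: "continuous_on (ball (p t) e \<times> ball t e) (\<lambda>(x, r). Ft x r)"
    and p: "(p has_real_derivative p') (at t)"
  shows "((\<lambda>r. F (p r) r) has_real_derivative Fx * p' + Ft (p t) t) (at t)"
proof -
  let ?X = "ball (p t) e" and ?Y = "ball t e"
  have in0: "(p t, t) \<in> ?X \<times> ?Y" using e by simp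
  have op: "open (?X \<times> ?Y)" by (intro open_Times open_ball)
  have ct: "continuous (at (p t, t) within ?X \<times> ?Y) (\<lambda>z. Ft (fst z) (snd z))"
    using cont in0 unfolding continuous_on_eq_continuous_within by (simp only: case_prod_unfold)
  have "((\<lambda>(x, r). F x r) has_derivative (\<lambda>(dx, dr). (\<lambda>h. Fx * h) dx + blinfun_mult_right (Ft (p t) t) dr))
      (at (p t, t) within ?X \<times> ?Y)"
  proof (rule has_derivative_partialsI[where fy = "\<lambda>x r. blinfun_mult_right (Ft x r)"])
    show "((\<lambda>x. F x t) has_derivative (\<lambda>h. Fx * h)) (at (p t) within ?X)"
      using Fx by (auto simp: has_field_derivative_def intro: has_derivative_at_withinI)
    show "((\<lambda>r. F x r) has_derivative blinfun_mult_right (Ft x r)) (at r within ?Y)"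
      if "x \<in> ?X" "r \<in> ?Y" for x r
      using Ft[OF that] by (auto simp: has_field_derivative_def intro: has_derivative_at_withinI)
    have "continuous (at (p t, t) within ?X \<times> ?Y) (\<lambda>z. blinfun_mult_right (Ft (fst z) (snd z)))"
      by (rule bounded_linear.continuous[OF bounded_linear_blinfun_mult_right ct])
    then show "continuous (at (p t, t) within ?X \<times> ?Y) (\<lambda>(x, r). blinfun_mult_right (Ft x r))"
      by (simp only: case_prod_unfold)
  qed (use e in auto)
  then have "((\<lambda>(x, r). F x r) has_derivative (\<lambda>z. Fx * fst z + Ft (p t) t * snd z)) (at (p t, t))"
    using at_within_open[OF in0 op] by (simp add: case_prod_unfold)
  moreover have "((\<lambda>r. (p r, r)) has_derivative (\<lambda>h. (p' * h, h))) (at t)"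
    using p unfolding has_field_derivative_def by (intro has_derivative_Pair has_derivative_ident)
  ultimately have "((\<lambda>r. (\<lambda>(x, r). F x r) (p r, r)) has_derivative
      (\<lambda>h. Fx * fst (p' * h, h) + Ft (p t) t * snd (p' * h, h))) (at t)"
    by (rule has_derivative_compose[rotated])
  moreover have "(\<lambda>h. Fx * fst (p' * h, h) + Ft (p t) t * snd (p' * h, h)) = (*) (Fx * p' + Ft (p t) t)"
    by (auto simp: fun_eq_iff algebra_simps)
  ultimately show ?thesis unfolding has_field_derivative_def by simp
qed

lemma integral_rescale:
  fixes f :: "real \<Rightarrow> real"
  assumes L: "0 < L" and f: "continuous_on {0..L} f"
  shows "integral {0..L} f = integral {0..1} (\<lambda>y. L * f (y * L))"
proof -
  have "(f has_integral integral {0..L} f) {0..L}"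
    using integrable_continuous_real[OF f] by (rule integrable_integral)
  from has_integral_stretch_real[OF this, of L]
  have "((\<lambda>x. f (L * x)) has_integral (1 / L) * integral {0..L} f) {0..1}"
    using L by (simp add: image_divide_atLeastAtMost)
  from has_integral_mult_right[OF this, of L] show ?thesis
    using L by (intro integral_unique[symmetric]) (simp add: mult.commute)
qed

text \<open>
  A solution of the heat equation below a moving boundary with zero flux through that boundary. The
  behaviour at \<open>x = 0\<close> is left free, because both traces there are unknowns of the integral equations.
\<close>

locale heat_on_moving_domain =
  fixes s s' :: "real \<Rightarrow> real" and w wx wt wxx :: "real \<Rightarrow> real \<Rightarrow> real"
  assumes partials: "has_continuous_partials s w wx wt wxx"
    and s_deriv_half_line: "\<And>t. 0 \<le> t \<Longrightarrow> (s has_real_derivative s' t) (at t within {0..})"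
    and s'_continuous: "continuous_on {0..} s'"
    and s_pos: "\<And>t. 0 \<le> t \<Longrightarrow> 0 < s t"
    and heat_interior: "\<And>x t. 0 < t \<Longrightarrow> 0 < x \<Longrightarrow> x < s t \<Longrightarrow> wt x t = wxx x t"
    and neumann: "\<And>t. 0 < t \<Longrightarrow> wx (s t) t = 0"
begin

lemma s_deriv: "0 < t \<Longrightarrow> (s has_real_derivative s' t) (at t)"
  using s_deriv_half_line[of t] at_within_interior[of t "{0..}"] by (simp add: interior_real_atLeast)

lemma s_continuous: "continuous_on {0..} s"
  using s_deriv_half_line by (intro DERIV_continuous_on) auto

lemma continuous_on_domain:
  assumes "continuous_on (fb_domain s) (\<lambda>(x, t). F x t)"
    "continuous_on S X" "continuous_on S T" "\<And>z. z \<in> S \<Longrightarrow> 0 \<le> X z \<and> X z \<le> s (T z) \<and> 0 \<le> T z"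
  shows "continuous_on S (\<lambda>z. F (X z) (T z))"
proof -
  have "continuous_on S (\<lambda>z. (\<lambda>(x, t). F x t) (X z, T z))"
    by (rule continuous_on_compose2[OF assms(1) continuous_on_Pair[OF assms(2,3)]])
       (use assms(4) in \<open>auto simp: fb_domain_def\<close>)
  then show ?thesis by simp
qed

lemmas w_cont = continuous_on_domain[of w] and wx_cont = continuous_on_domain[of wx] and wt_cont = continuous_on_domain[of wt]
  and wxx_cont = continuous_on_domain[of wxx]

lemma partials_continuous:
  "continuous_on (fb_domain s) (\<lambda>(x, t). w x t)" "continuous_on (fb_domain s) (\<lambda>(x, t). wx x t)"
  "continuous_on (fb_domain s) (\<lambda>(x, t). wt x t)" "continuous_on (fb_domain s) (\<lambda>(x, t). wxx x t)"
  using partials unfolding has_continuous_partials_def by auto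

lemma section_x: "0 \<le> t \<Longrightarrow> {y. (y, t) \<in> fb_domain s} = {0..s t}"
  by (auto simp: fb_domain_def)

lemma w_deriv_x:
  assumes "0 \<le> t" "0 \<le> x" "x \<le> s t"
  shows "((\<lambda>y. w y t) has_real_derivative wx x t) (at x within {0..s t})"
    and "((\<lambda>y. wx y t) has_real_derivative wxx x t) (at x within {0..s t})"
  using partials assms section_x[OF assms(1)]
  unfolding has_continuous_partials_def by (force simp: fb_domain_def)+

lemma inner_neighbourhood:
  assumes "0 < t" "0 < x" "x < s t"
  obtains e where "e > 0" "\<And>y r. y \<in> ball x e \<Longrightarrow> r \<in> ball t e \<Longrightarrow> 0 < r \<and> 0 < y \<and> y < s r"
proof -
  define d where "d = (s t - x) / 2"
  have "0 < d" using assms by (simp add: d_def)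
  have "isCont s t" using s_deriv[OF assms(1)] by (rule DERIV_isCont)
  then obtain e1 where e1: "e1 > 0" "\<And>r. dist r t < e1 \<Longrightarrow> dist (s r) (s t) < d"
    using assms unfolding continuous_at_eps_delta d_def by (metis diff_gt_0_iff_gt half_gt_zero)
  define e where "e = Min {e1, d, t, x}"
  have "e > 0" "e \<le> e1" "e \<le> d" "e \<le> t" "e \<le> x" using e1 assms \<open>0 < d\<close> by (auto simp: e_def)
  moreover have "0 < r \<and> 0 < y \<and> y < s r" if "y \<in> ball x e" "r \<in> ball t e" for y r
  proof -
    have "dist (s r) (s t) < d" using e1(2)[of r] that \<open>e \<le> e1\<close> by (simp add: dist_commute)
    then have "s t - d < s r" by (auto simp: dist_real_def)
    moreover have "y < x + d" using that \<open>e \<le> d\<close> by (auto simp: dist_real_def)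
    moreover have "s t - d = x + d" by (simp add: d_def field_simps)
    ultimately show ?thesis using that \<open>e \<le> t\<close> \<open>e \<le> x\<close> by (auto simp: dist_real_def)
  qed
  ultimately show thesis using that by blast
qed

lemma w_deriv_t:
  assumes "0 < t" "0 < x" "x < s t"
  shows "((\<lambda>r. w x r) has_real_derivative wt x t) (at t)"
proof -
  obtain e where e: "e > 0" "\<And>y r. y \<in> ball x e \<Longrightarrow> r \<in> ball t e \<Longrightarrow> 0 < r \<and> 0 < y \<and> y < s r"
    using inner_neighbourhood[OF assms] by blast
  have "((\<lambda>r. w x r) has_real_derivative wt x t) (at t within {r. (x, r) \<in> fb_domain s})"
    using partials assms unfolding has_continuous_partials_def by (force simp: fb_domain_def)
  moreover have "ball t e \<subseteq> {r. (x, r) \<in> fb_domain s}"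
    using e(2)[of x] e(1) by (force simp: fb_domain_def)
  ultimately have "((\<lambda>r. w x r) has_real_derivative wt x t) (at t within ball t e)"
    by (rule has_field_derivative_subset)
  then show ?thesis using at_within_open[of t "ball t e"] e(1) by simp
qed

lemma heat_closed:
  assumes "0 < t" "0 \<le> x" "x \<le> s t"
  shows "wt x t = wxx x t"
proof -
  have cl: "closure {0<..<s t} = {0..s t}" using s_pos[of t] assms by simp
  have "wt x t - wxx x t = 0"
  proof (rule continuous_constant_on_closure[of "{0<..<s t}" "\<lambda>x. wt x t - wxx x t"])
    show "continuous_on (closure {0<..<s t}) (\<lambda>x. wt x t - wxx x t)"
      unfolding cl using assms(1) by (intro continuous_on_diff wt_cont wxx_cont partials_continuous continuous_intros) auto
  qed (use assms heat_interior cl in auto)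
  then show ?thesis by simp
qed

lemma strip_range: "0 \<le> y \<Longrightarrow> y \<le> 1 \<Longrightarrow> 0 \<le> t \<Longrightarrow> 0 \<le> y * s t \<and> y * s t \<le> s t"
  using s_pos[of t] mult_left_le_one_le[of "s t" y] by auto

text \<open>
  The map \<open>(y, t) \<mapsto> (y * s t, t)\<close> straightens the domain to a strip. This circumvents the
  \<open>t\<close>-sections of the original domain, which can be irregular sets near the moving boundary.
\<close>

lemma stretched_continuous:
  assumes F: "continuous_on (fb_domain s) (\<lambda>(x, t). F x t)" and U: "U \<subseteq> {0..}"
  shows "continuous_on (U \<times> {0..1}) (\<lambda>z. F (snd z * s (fst z)) (fst z))"
  by (rule continuous_on_domain[OF F])
     (use U strip_range in \<open>auto intro!: continuous_intros continuous_on_compose2[OF s_continuous]\<close>)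

lemma stretched_deriv_inner:
  assumes "0 < t" "0 < y" "y < 1"
  shows "((\<lambda>r. w (y * s r) r) has_real_derivative wx (y * s t) t * (y * s' t) + wt (y * s t) t) (at t)"
proof -
  have x: "0 < y * s t" "y * s t < s t" using s_pos[of t] assms by auto
  obtain e where e: "e > 0" "\<And>z r. z \<in> ball (y * s t) e \<Longrightarrow> r \<in> ball t e \<Longrightarrow> 0 < r \<and> 0 < z \<and> z < s r"
    using inner_neighbourhood[OF assms(1) x] by blast
  show ?thesis
  proof (rule derivative_along_path[where F = w and p = "\<lambda>r. y * s r" and Ft = wt, OF e(1)])
    have "at (y * s t) within {0..s t} = at (y * s t)" by (rule at_within_Icc_at) (use x in auto)
    then show "((\<lambda>x. w x t) has_real_derivative wx (y * s t) t) (at (y * s t))"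
      using w_deriv_x(1)[of t "y * s t"] x assms by simp
    show "((\<lambda>r. w z r) has_real_derivative wt z r) (at r)" if "z \<in> ball (y * s t) e" "r \<in> ball t e" for z r
      using w_deriv_t e(2)[OF that] by blast
    show "continuous_on (ball (y * s t) e \<times> ball t e) (\<lambda>(z, r). wt z r)"
      by (rule continuous_on_subset[OF partials_continuous(3)]) (use e(2) in \<open>force simp: fb_domain_def\<close>)
    show "((\<lambda>r. y * s r) has_real_derivative y * s' t) (at t)"
      by (rule DERIV_cmult[OF s_deriv[OF assms(1)]])
  qed
qed

text \<open>
  In the interior this is the chain rule. At \<open>y = 1\<close> the one-sided derivatives of the solution are too
  weak for it; there the integrated identity is extended by continuity in \<open>y\<close> and then
  differentiated again.
\<close>

lemma stretched_deriv:
  assumes "0 < t" "0 \<le> y" "y \<le> 1"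
  shows "((\<lambda>r. w (y * s r) r) has_real_derivative wx (y * s t) t * (y * s' t) + wt (y * s t) t) (at t)"
proof -
  define V where "V y r = wx (y * s r) r * (y * s' r) + wt (y * s r) r" for y r
  have U: "{0<..} \<subseteq> {0::real..}" by auto
  have V: "continuous_on ({0<..} \<times> {0..1}) (\<lambda>z. V (snd z) (fst z))"
    unfolding V_def
    by (intro continuous_intros stretched_continuous[OF partials_continuous(2) U] stretched_continuous[OF partials_continuous(3) U]
        continuous_on_compose2[OF s'_continuous]) auto
  \<comment> \<open>Any base time strictly between 0 and \<open>t\<close> serves for the integrated identity.\<close>
  define a where "a = t / 2"
  have a: "0 < a" "a < t" using assms(1) by (auto simp: a_def)
  have row: "continuous_on {a..b} (V y)" if "y \<in> {0..1}" for y b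
  proof -
    have "continuous_on {a..b} (\<lambda>r. (\<lambda>z. V (snd z) (fst z)) (r, y))"
      by (rule continuous_on_compose2[OF V]) (use that a in \<open>auto intro!: continuous_on_Pair\<close>)
    then show ?thesis by simp
  qed
  have ftc: "w (y * s b) b - w (y * s a) a - integral {a..b} (V y) = 0" if b: "a \<le> b" for b
  proof (rule continuous_constant_on_closure[of "{0<..<1}" "\<lambda>y. w (y * s b) b - w (y * s a) a - integral {a..b} (V y)"])
    have cl: "closure {0<..<1::real} = {0..1}" by simp
    have wb: "continuous_on {0..1} (\<lambda>y. w (y * s b) b)" if "0 < b" for b
      by (rule w_cont[OF partials_continuous(1)]) (use that strip_range in \<open>auto intro!: continuous_intros\<close>)
    have "continuous_on ({0..1} \<times> cbox a b) (\<lambda>z. (\<lambda>z. V (snd z) (fst z)) (snd z, fst z))"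
      by (rule continuous_on_compose2[OF V]) (use a in \<open>auto intro!: continuous_intros\<close>)
    then have "continuous_on ({0..1} \<times> cbox a b) (\<lambda>(y, r). V y r)"
      by (simp add: case_prod_unfold)
    from integral_continuous_on_param[OF this]
    have "continuous_on {0..1} (\<lambda>y. integral {a..b} (V y))" by simp
    then show "continuous_on (closure {0<..<1}) (\<lambda>y. w (y * s b) b - w (y * s a) a - integral {a..b} (V y))"
      unfolding cl using a b by (intro continuous_on_diff wb) auto
    show "y \<in> closure {0<..<1}" unfolding cl using assms by simp
  next
    fix y :: real assume y: "y \<in> {0<..<1}"
    have "(V y has_integral w (y * s b) b - w (y * s a) a) {a..b}"
    proof (rule fundamental_theorem_of_calculus[OF b])
      fix r assume "r \<in> {a..b}"
      then show "((\<lambda>b. w (y * s b) b) has_vector_derivative V y r) (at r within {a..b})"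
        using stretched_deriv_inner[of r y] y a
        by (auto simp: V_def has_real_derivative_iff_has_vector_derivative[symmetric] intro: has_field_derivative_at_within)
    qed
    then show "w (y * s b) b - w (y * s a) a - integral {a..b} (V y) = 0" by (simp add: integral_unique)
  qed
  have "((\<lambda>b. integral {a..b} (V y)) has_real_derivative V y t) (at t within {a..t + 1})"
    by (rule integral_has_real_derivative[OF row]) (use a assms in auto)
  moreover have "at t within {a..t + 1} = at t" by (rule at_within_Icc_at) (use a in auto)
  ultimately have "((\<lambda>b. integral {a..b} (V y)) has_real_derivative V y t) (at t)" by (simp only:)
  from DERIV_add[OF DERIV_const[of "w (y * s a) a"] this]
  have "((\<lambda>b. w (y * s a) a + integral {a..b} (V y)) has_real_derivative V y t) (at t)" by simp
  then have "((\<lambda>r. w (y * s r) r) has_real_derivative V y t) (at t)"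
  proof (rule has_field_derivative_transform_within_open[of _ _ _ "{a<..}"])
    fix r assume "r \<in> {a<..}"
    then show "w (y * s a) a + integral {a..r} (V y) = w (y * s r) r"
      using ftc[of r] by simp
  qed (use a in auto)
  then show ?thesis by (simp add: V_def)
qed

text \<open>
  The test function \<open>G\<close> solves the backward heat equation: its time derivative is \<open>- Gxx\<close>, which is
  built into the hypothesis on paths. In straightened coordinates the time derivative of the integrand
  is an exact derivative in \<open>y\<close>, which leaves boundary terms only.
\<close>

lemma green_identity:
  assumes t: "0 < t" "t < T"
    and path: "\<And>p p' r. 0 < r \<Longrightarrow> r < T \<Longrightarrow> (p has_real_derivative p') (at r) \<Longrightarrow>
      ((\<lambda>r. G (p r) r) has_real_derivative Gx (p r) r * p' - Gxx (p r) r) (at r)"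
    and Gx: "\<And>x r. 0 < r \<Longrightarrow> r < T \<Longrightarrow> ((\<lambda>x. G x r) has_real_derivative Gx x r) (at x)"
    and Gxx: "\<And>x r. 0 < r \<Longrightarrow> r < T \<Longrightarrow> ((\<lambda>x. Gx x r) has_real_derivative Gxx x r) (at x)"
    and cG: "continuous_on (UNIV \<times> {0<..<T}) (\<lambda>(x, r). G x r)"
    and cGx: "continuous_on (UNIV \<times> {0<..<T}) (\<lambda>(x, r). Gx x r)"
    and cGxx: "continuous_on (UNIV \<times> {0<..<T}) (\<lambda>(x, r). Gxx x r)"
  shows "((\<lambda>r. integral {0..s r} (\<lambda>x. G x r * w x r)) has_real_derivative
     (s' t * G (s t) t - Gx (s t) t) * w (s t) t - (G 0 t * wx 0 t - Gx 0 t * w 0 t)) (at t)"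
proof -
  define f where "f r y = s r * (G (y * s r) r * w (y * s r) r)" for r y
  define f' where "f' r y = s' r * (G (y * s r) r * w (y * s r) r) + s r *
     ((Gx (y * s r) r * (y * s' r) - Gxx (y * s r) r) * w (y * s r) r
      + G (y * s r) r * (wx (y * s r) r * (y * s' r) + wxx (y * s r) r))" for r y
  let ?U = "{0<..<T}"
  have U: "?U \<subseteq> {0..}" by auto
  have comp: "continuous_on (?U \<times> {0..1}) (\<lambda>z. H (snd z * s (fst z)) (fst z))"
    if "continuous_on (UNIV \<times> ?U) (\<lambda>(x, r). H x r)" for H :: "real \<Rightarrow> real \<Rightarrow> real"
  proof -
    have "continuous_on (?U \<times> {0..1}) (\<lambda>z. (\<lambda>(x, r). H x r) (snd z * s (fst z), fst z))"
      by (rule continuous_on_compose2[OF that])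
         (auto intro!: continuous_intros continuous_on_compose2[OF s_continuous])
    then show ?thesis by simp
  qed
  note ww = stretched_continuous[OF partials_continuous(1) U] stretched_continuous[OF partials_continuous(2) U] stretched_continuous[OF partials_continuous(4) U]
  have ss: "continuous_on (?U \<times> {0..1::real}) (\<lambda>z. s (fst z))" "continuous_on (?U \<times> {0..1::real}) (\<lambda>z. s' (fst z))"
    by (auto intro!: continuous_on_compose2[OF s_continuous] continuous_on_compose2[OF s'_continuous] continuous_intros)
  have cf: "continuous_on (?U \<times> {0..1}) (\<lambda>z. f (fst z) (snd z))"
    unfolding f_def by (intro continuous_intros ss ww comp[OF cG])
  have cf': "continuous_on (?U \<times> {0..1}) (\<lambda>z. f' (fst z) (snd z))"
    unfolding f'_def by (intro continuous_intros ss ww comp[OF cG] comp[OF cGx] comp[OF cGxx])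
  have row: "continuous_on {0..1} (f r)" if "r \<in> ?U" for r
  proof -
    have "continuous_on {0..1} (\<lambda>y. (\<lambda>z. f (fst z) (snd z)) (r, y))"
      by (rule continuous_on_compose2[OF cf]) (use that in \<open>auto intro!: continuous_intros\<close>)
    then show ?thesis by simp
  qed
  have resc: "integral {0..s r} (\<lambda>x. G x r * w x r) = integral {0..1} (f r)" if "r \<in> ?U" for r
    unfolding f_def
  proof (rule integral_rescale)
    have "continuous_on {0..s r} (\<lambda>x. (\<lambda>(x, r). G x r) (x, r))"
      by (rule continuous_on_compose2[OF cG]) (use that in \<open>auto intro!: continuous_intros\<close>)
    moreover have "continuous_on {0..s r} (\<lambda>x. w x r)"
      by (rule w_cont[OF partials_continuous(1)]) (use that in \<open>auto intro!: continuous_intros\<close>)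
    ultimately show "continuous_on {0..s r} (\<lambda>x. G x r * w x r)" by (auto intro: continuous_on_mult)
  qed (use s_pos that in auto)
  have fder: "((\<lambda>r. f r y) has_real_derivative f' r y) (at r)" if "r \<in> ?U" "y \<in> {0..1}" for r y
  proof -
    have r: "0 < r" "r < T" using that by auto
    have yr: "0 \<le> y * s r" "y * s r \<le> s r" using strip_range[of y r] that by auto
    have W: "((\<lambda>r. w (y * s r) r) has_real_derivative wx (y * s r) r * (y * s' r) + wxx (y * s r) r) (at r)"
      using stretched_deriv[of r y] heat_closed[OF r(1) yr] that by simp
    have Gp: "((\<lambda>r. G (y * s r) r) has_real_derivative Gx (y * s r) r * (y * s' r) - Gxx (y * s r) r) (at r)"
      by (rule path[OF r]) (rule DERIV_cmult[OF s_deriv[OF r(1)]])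
    show ?thesis unfolding f_def f'_def
      using DERIV_mult[OF s_deriv[OF r(1)] DERIV_mult[OF Gp W]] by (simp add: algebra_simps)
  qed
  have leib: "((\<lambda>r. integral (cbox 0 1) (f r)) has_real_derivative integral (cbox 0 1) (f' t)) (at t within ?U)"
  proof (rule leibniz_rule_field_derivative[where fx = f'])
    show "((\<lambda>r. f r y) has_real_derivative f' r y) (at r within ?U)" if "r \<in> ?U" "y \<in> cbox 0 1" for r y
      using fder[of r y] that by (auto intro: has_field_derivative_at_within)
    show "f r integrable_on cbox 0 1" if "r \<in> ?U" for r
      using row[OF that] by (auto intro: integrable_continuous_real)
    show "continuous_on (?U \<times> cbox 0 1) (\<lambda>(r, y). f' r y)"
      using cf' by (simp add: case_prod_unfold)
  qed (use t in auto)
  have "(f' t has_integral (\<lambda>y. y * s' t * (G (y * s t) t * w (y * s t) t) + (G (y * s t) t * wx (y * s t) t - Gx (y * s t) t * w (y * s t) t)) 1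
      - (\<lambda>y. y * s' t * (G (y * s t) t * w (y * s t) t) + (G (y * s t) t * wx (y * s t) t - Gx (y * s t) t * w (y * s t) t)) 0) {0..1}"
  proof (rule fundamental_theorem_of_calculus)
    fix y :: real assume y: "y \<in> {0..1}"
    have yr: "0 \<le> y * s t" "y * s t \<le> s t" using strip_range[of y t] y t by auto
    have yd: "((\<lambda>y. y * s t) has_real_derivative s t) (at y within {0..1})"
      by (auto intro!: derivative_eq_intros)
    have img: "(\<lambda>y. y * s t) ` {0..1} \<subseteq> {0..s t}" using strip_range[of _ t] t by auto
    have Wy: "((\<lambda>y. w (y * s t) t) has_real_derivative wx (y * s t) t * s t) (at y within {0..1})"
      using DERIV_image_chain[OF has_field_derivative_subset[OF w_deriv_x(1)[OF less_imp_le[OF t(1)] yr] img] yd]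
      by (simp add: o_def)
    have Wxy: "((\<lambda>y. wx (y * s t) t) has_real_derivative wxx (y * s t) t * s t) (at y within {0..1})"
      using DERIV_image_chain[OF has_field_derivative_subset[OF w_deriv_x(2)[OF less_imp_le[OF t(1)] yr] img] yd]
      by (simp add: o_def)
    have Gy: "((\<lambda>y. G (y * s t) t) has_real_derivative Gx (y * s t) t * s t) (at y within {0..1})"
      by (rule DERIV_chain2[OF Gx[OF t] yd])
    have Gxy: "((\<lambda>y. Gx (y * s t) t) has_real_derivative Gxx (y * s t) t * s t) (at y within {0..1})"
      by (rule DERIV_chain2[OF Gxx[OF t] yd])
    have "((\<lambda>y. y * s' t) has_real_derivative s' t) (at y within {0..1})"
      by (auto intro!: derivative_eq_intros)
    note * = DERIV_add[OF DERIV_mult[OF this DERIV_mult[OF Gy Wy]]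
        DERIV_diff[OF DERIV_mult[OF Gy Wxy] DERIV_mult[OF Gxy Wy]]]
    show "((\<lambda>y. y * s' t * (G (y * s t) t * w (y * s t) t) + (G (y * s t) t * wx (y * s t) t - Gx (y * s t) t * w (y * s t) t))
        has_vector_derivative f' t y) (at y within {0..1})"
      unfolding has_real_derivative_iff_has_vector_derivative[symmetric]
      by (rule DERIV_cong[OF *]) (simp add: f'_def algebra_simps)
  qed simp
  then have "integral {0..1} (f' t) = (s' t * G (s t) t - Gx (s t) t) * w (s t) t - (G 0 t * wx 0 t - Gx 0 t * w 0 t)"
    using neumann[OF t(1)] by (simp add: integral_unique algebra_simps)
  then have "((\<lambda>r. integral {0..1} (f r)) has_real_derivative
      (s' t * G (s t) t - Gx (s t) t) * w (s t) t - (G 0 t * wx 0 t - Gx 0 t * w 0 t)) (at t)"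
    using leib at_within_open[of t ?U] t by simp
  then show ?thesis
    by (rule has_field_derivative_transform_within_open[of _ _ _ ?U]) (use t resc in auto)
qed

end

section \<open>The heat kernel and the boundary representation\<close>

definition heat_kernel :: "real \<Rightarrow> real \<Rightarrow> real" where
  "heat_kernel z \<rho> = exp (- (z\<^sup>2 / (4 * \<rho>))) / sqrt (4 * pi * \<rho>)"

lemma heat_kernel_minus: "heat_kernel (- z) \<rho> = heat_kernel z \<rho>"
  by (simp add: heat_kernel_def)

lemma heat_kernel_deriv:
  assumes z: "(z has_real_derivative z') (at r within S)" and \<rho>: "(\<rho> has_real_derivative \<rho>') (at r within S)"
    and pos: "0 < \<rho> r"
  shows "((\<lambda>r. heat_kernel (z r) (\<rho> r)) has_real_derivative
    heat_kernel (z r) (\<rho> r) * (- (z r * z' / (2 * \<rho> r)) + \<rho>' * ((z r)\<^sup>2 / (4 * (\<rho> r)\<^sup>2) - 1 / (2 * \<rho> r)))) (at r within S)"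
proof -
  define R where "R = sqrt (4 * pi * \<rho> r)"
  have R: "R > 0" "R * R = 4 * pi * \<rho> r" using pos by (auto simp: R_def)
  have "((\<lambda>r. - ((z r)\<^sup>2 / (4 * \<rho> r))) has_real_derivative
     - ((2 * z r * z' * (4 * \<rho> r) - (z r)\<^sup>2 * (4 * \<rho>')) / (4 * \<rho> r * (4 * \<rho> r)))) (at r within S)"
    using pos by (auto intro!: derivative_eq_intros z \<rho>)
  from DERIV_chain2[OF DERIV_exp this]
  have E: "((\<lambda>r. exp (- ((z r)\<^sup>2 / (4 * \<rho> r)))) has_real_derivative exp (- ((z r)\<^sup>2 / (4 * \<rho> r))) *
     - ((2 * z r * z' * (4 * \<rho> r) - (z r)\<^sup>2 * (4 * \<rho>')) / (4 * \<rho> r * (4 * \<rho> r)))) (at r within S)" .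
  have "((\<lambda>r. 4 * pi * \<rho> r) has_real_derivative 4 * pi * \<rho>') (at r within S)"
    by (rule DERIV_cmult[OF \<rho>])
  from DERIV_chain2[OF DERIV_real_sqrt this] pos
  have Q: "((\<lambda>r. sqrt (4 * pi * \<rho> r)) has_real_derivative inverse R / 2 * (4 * pi * \<rho>')) (at r within S)"
    by (simp add: R_def)
  define e where "e = exp (- ((z r)\<^sup>2 / (4 * \<rho> r)))"
  have "((\<lambda>r. heat_kernel (z r) (\<rho> r)) has_real_derivative
    (e * - ((2 * z r * z' * (4 * \<rho> r) - (z r)\<^sup>2 * (4 * \<rho>')) / (4 * \<rho> r * (4 * \<rho> r))) * R
     - e * (inverse R / 2 * (4 * pi * \<rho>'))) / (R * R)) (at r within S)"
    unfolding heat_kernel_def e_def R_def using pos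
    by (intro DERIV_divide[OF E Q[unfolded R_def]]) simp
  moreover have "(e * - ((2 * z r * z' * (4 * \<rho> r) - (z r)\<^sup>2 * (4 * \<rho>')) / (4 * \<rho> r * (4 * \<rho> r))) * R
     - e * (inverse R / 2 * (4 * pi * \<rho>'))) / (R * R)
     = e / R * (- (z r * z' / (2 * \<rho> r)) + \<rho>' * ((z r)\<^sup>2 / (4 * (\<rho> r)\<^sup>2) - 1 / (2 * \<rho> r)))"
  proof -
    have "- ((2 * z r * z' * (4 * \<rho> r) - (z r)\<^sup>2 * (4 * \<rho>')) / (4 * \<rho> r * (4 * \<rho> r)))
        = - (z r * z' / (2 * \<rho> r)) + \<rho>' * ((z r)\<^sup>2 / (4 * (\<rho> r)\<^sup>2))"
      using pos by (simp add: field_simps power2_eq_square)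
    moreover have "inverse R / 2 * (4 * pi * \<rho>') = R * (\<rho>' / (2 * \<rho> r))"
    proof -
      have "inverse R = R / (4 * pi * \<rho> r)" using R pos by (simp add: field_simps)
      then show ?thesis using pos by simp
    qed
    ultimately show ?thesis using R(1) by (simp add: field_simps)
  qed
  moreover have "e / R = heat_kernel (z r) (\<rho> r)" by (simp add: e_def R_def heat_kernel_def)
  ultimately show ?thesis by simp
qed

lemma heat_kernel_continuous:
  assumes "continuous_on S z" "continuous_on S \<rho>" "\<And>x. x \<in> S \<Longrightarrow> 0 < \<rho> x"
  shows "continuous_on S (\<lambda>x. heat_kernel (z x) (\<rho> x))"
  unfolding heat_kernel_def by (intro continuous_intros assms) (use assms(3) in force)+

lemma gaussian_half_line:
  "has_bochner_integral lborel (\<lambda>z. indicator {0..} z * heat_kernel z 1) (1 / 2)"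
proof -
  have "has_bochner_integral lborel (\<lambda>z. indicator {0..} (0 + (1/2) * z) *\<^sub>R exp (- (0 + (1/2) * z)\<^sup>2)) ((sqrt pi / 2) /\<^sub>R \<bar>1/2\<bar>)"
    by (rule lborel_has_bochner_integral_real_affine_iff[THEN iffD1, OF _ gaussian_moment_0]) simp
  then have "has_bochner_integral lborel (\<lambda>z. indicator {0..} (z / 2) * exp (- (z / 2)\<^sup>2) / sqrt (4 * pi)) (sqrt pi / sqrt (4 * pi))"
    by (intro has_bochner_integral_divide_zero) simp
  moreover have "indicator {0..} (z / 2) * exp (- (z / 2)\<^sup>2) / sqrt (4 * pi) = indicator {0..} z * heat_kernel z 1" for z :: real
    by (auto simp: indicator_def heat_kernel_def power2_eq_square)
  moreover have "sqrt pi / sqrt (4 * pi) = 1 / 2" by (simp add: real_sqrt_mult)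
  ultimately show ?thesis by simp
qed

lemma gaussian_integrable: "integrable lborel (\<lambda>z. heat_kernel z 1)"
proof -
  have "(\<lambda>z. heat_kernel z 1) = normal_density 0 (sqrt 2)"
    by (auto simp: fun_eq_iff heat_kernel_def normal_density_def)
  then show ?thesis using integrable_normal_density[of "sqrt 2" 0] by simp
qed

text \<open>
  Half of the mass of the heat kernel lies on either side of its centre, so that at a boundary
  point the concentrating kernel recovers half of the boundary value. After the parabolic substitution
  \<open>x = \<xi> - \<sigma> * sqrt \<rho> * z\<close> this is dominated convergence with a fixed Gaussian; \<open>\<sigma>\<close> tells on which side
  of \<open>\<xi>\<close> the domain lies.
\<close>

lemma heat_kernel_half_mass:
  fixes W :: "nat \<Rightarrow> real \<Rightarrow> real" and \<rho> a b :: "nat \<Rightarrow> real"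
  assumes \<rho>: "\<And>n. 0 < \<rho> n" and \<sigma>: "\<sigma> = 1 \<or> \<sigma> = (- 1 :: real)"
    and W: "\<And>n. continuous_on {a n..b n} (W n)"
    and M: "\<And>n x. x \<in> {a n..b n} \<Longrightarrow> \<bar>W n x\<bar> \<le> M"
    and lim: "\<And>z. 0 < z \<Longrightarrow>
      (\<lambda>n. indicator {a n..b n} (\<xi> - \<sigma> * sqrt (\<rho> n) * z) * W n (\<xi> - \<sigma> * sqrt (\<rho> n) * z)) \<longlonglongrightarrow> L"
    and lim0: "\<And>z. z < 0 \<Longrightarrow>
      (\<lambda>n. indicator {a n..b n} (\<xi> - \<sigma> * sqrt (\<rho> n) * z) * W n (\<xi> - \<sigma> * sqrt (\<rho> n) * z)) \<longlonglongrightarrow> 0"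
  shows "(\<lambda>n. integral {a n..b n} (\<lambda>x. heat_kernel (\<xi> - x) (\<rho> n) * W n x)) \<longlonglongrightarrow> L / 2"
proof -
  define q where "q n z = \<xi> - \<sigma> * sqrt (\<rho> n) * z" for n z
  define V where "V n x = indicator {a n..b n} x * W n x" for n x
  have Vm: "V n \<in> borel_measurable borel" for n
  proof -
    have "(\<lambda>x. indicator {a n..b n} x *\<^sub>R W n x) \<in> borel_measurable borel"
      by (rule borel_measurable_continuous_on_indicator[OF _ W]) simp
    then show ?thesis by (simp add: V_def[abs_def])
  qed
  have "0 \<le> M" if "{a n..b n} \<noteq> {}" for n using M[of _ n] that by force
  then have VM: "\<bar>V n x\<bar> \<le> \<bar>M\<bar>" for n x using M[of x n] by (auto simp: V_def indicator_def)
  have km: "(\<lambda>x. heat_kernel (\<xi> - x) \<rho>) \<in> borel_measurable borel" for \<rho>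
    unfolding heat_kernel_def by measurable
  have km1: "(\<lambda>z. heat_kernel z 1) \<in> borel_measurable borel"
    unfolding heat_kernel_def by measurable
  have qm: "q n \<in> borel_measurable borel" for n unfolding q_def by measurable
  have eq: "integral {a n..b n} (\<lambda>x. heat_kernel (\<xi> - x) (\<rho> n) * W n x) = (LINT z|lborel. heat_kernel z 1 * V n (q n z))" for n
  proof -
    have c: "continuous_on {a n..b n} (\<lambda>x. heat_kernel (\<xi> - x) (\<rho> n) * W n x)"
      by (intro continuous_intros heat_kernel_continuous W) (use \<rho> in auto)
    have "integral {a n..b n} (\<lambda>x. heat_kernel (\<xi> - x) (\<rho> n) * W n x)
        = (LINT x:{a n..b n}|lborel. heat_kernel (\<xi> - x) (\<rho> n) * W n x)"
      by (rule set_borel_integral_eq_integral(2)[symmetric]) (rule borel_integrable_atLeastAtMost'[OF c])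
    also have "\<dots> = (LINT x|lborel. heat_kernel (\<xi> - x) (\<rho> n) * V n x)"
      unfolding set_lebesgue_integral_def by (rule Bochner_Integration.integral_cong) (auto simp: V_def)
    also have "\<dots> = \<bar>- \<sigma> * sqrt (\<rho> n)\<bar> *\<^sub>R (LINT z|lborel. heat_kernel (\<xi> - (\<xi> + (- \<sigma> * sqrt (\<rho> n)) * z)) (\<rho> n) * V n (\<xi> + (- \<sigma> * sqrt (\<rho> n)) * z))"
      by (rule lborel_integral_real_affine) (use \<sigma> \<rho>[of n] in auto)
    also have "\<dots> = (LINT z|lborel. \<bar>- \<sigma> * sqrt (\<rho> n)\<bar> *\<^sub>R (heat_kernel (\<xi> - (\<xi> + (- \<sigma> * sqrt (\<rho> n)) * z)) (\<rho> n) * V n (\<xi> + (- \<sigma> * sqrt (\<rho> n)) * z)))"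
      by (rule integral_scaleR_right[symmetric])
    also have "\<dots> = (LINT z|lborel. heat_kernel z 1 * V n (q n z))"
    proof (rule Bochner_Integration.integral_cong)
      fix z
      have "sqrt (\<rho> n) * heat_kernel (\<sigma> * sqrt (\<rho> n) * z) (\<rho> n) = heat_kernel z 1"
        using \<rho>[of n] \<sigma> by (auto simp: heat_kernel_def power_mult_distrib real_sqrt_mult)
      moreover have "\<bar>- \<sigma> * sqrt (\<rho> n)\<bar> = sqrt (\<rho> n)" using \<sigma> \<rho>[of n] by auto
      ultimately show "\<bar>- \<sigma> * sqrt (\<rho> n)\<bar> *\<^sub>R (heat_kernel (\<xi> - (\<xi> + (- \<sigma> * sqrt (\<rho> n)) * z)) (\<rho> n) * V n (\<xi> + (- \<sigma> * sqrt (\<rho> n)) * z))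
          = heat_kernel z 1 * V n (q n z)"
        by (simp add: q_def mult.assoc[symmetric])
    qed simp
    finally show ?thesis .
  qed
  have "(\<lambda>n. LINT z|lborel. heat_kernel z 1 * V n (q n z)) \<longlonglongrightarrow> (LINT z|lborel. indicator {0..} z * heat_kernel z 1 * L)"
  proof (rule integral_dominated_convergence[where w = "\<lambda>z. heat_kernel z 1 * \<bar>M\<bar>"])
    show "integrable lborel (\<lambda>z. heat_kernel z 1 * \<bar>M\<bar>)"
      by (intro integrable_mult_left gaussian_integrable)
    have "AE z in lborel. z \<noteq> (0::real)" by (rule AE_lborel_singleton)
    then show "AE z in lborel. (\<lambda>n. heat_kernel z 1 * V n (q n z)) \<longlonglongrightarrow> indicator {0..} z * heat_kernel z 1 * L"
    proof eventually_elim
      case (elim z)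
      show ?case
      proof (cases "0 < z")
        case True
        have "(\<lambda>n. heat_kernel z 1 * V n (q n z)) \<longlonglongrightarrow> heat_kernel z 1 * L"
          unfolding V_def q_def by (rule tendsto_mult[OF tendsto_const lim[OF True]])
        then show ?thesis using True by simp
      next
        case False
        with elim have z: "z < 0" by simp
        have "(\<lambda>n. heat_kernel z 1 * V n (q n z)) \<longlonglongrightarrow> heat_kernel z 1 * 0"
          unfolding V_def q_def by (rule tendsto_mult[OF tendsto_const lim0[OF z]])
        then show ?thesis using z by simp
      qed
    qed
    fix n
    show "AE z in lborel. norm (heat_kernel z 1 * V n (q n z)) \<le> heat_kernel z 1 * \<bar>M\<bar>"
      using VM by (auto simp: abs_mult heat_kernel_def intro!: divide_right_mono mult_left_mono)
    show "(\<lambda>z. heat_kernel z 1 * V n (q n z)) \<in> borel_measurable lborel"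
      using measurable_compose[OF qm Vm] km1 by simp
  qed (use km1 in simp)
  moreover have "(LINT z|lborel. indicator {0..} z * heat_kernel z 1 * L) = L / 2"
    unfolding integral_mult_left_zero has_bochner_integral_integral_eq[OF gaussian_half_line] by simp
  ultimately show ?thesis unfolding eq by (simp only:)
qed

context heat_on_moving_domain
begin

text \<open>
  As \<open>\<tau>\<close> tends to \<open>t\<close> the kernel concentrates at \<open>\<xi>\<close>, so that for a boundary point \<open>\<xi>\<close> the average
  tends to half of the boundary value.
\<close>

definition heat_average :: "real \<Rightarrow> real \<Rightarrow> real \<Rightarrow> real" where
  "heat_average \<xi> t \<tau> = integral {0..s \<tau>} (\<lambda>x. heat_kernel (\<xi> - x) (t - \<tau>) * w x \<tau>)"

definition boundary_flux :: "real \<Rightarrow> real \<Rightarrow> real \<Rightarrow> real" where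
  "boundary_flux \<xi> t \<tau> =
     heat_kernel (\<xi> - s \<tau>) (t - \<tau>) * (s' \<tau> - (\<xi> - s \<tau>) / (2 * (t - \<tau>))) * w (s \<tau>) \<tau>
     - heat_kernel \<xi> (t - \<tau>) * (wx 0 \<tau> - \<xi> / (2 * (t - \<tau>)) * w 0 \<tau>)"

lemma heat_average_deriv:
  assumes "0 < \<tau>" "\<tau> < t"
  shows "(heat_average \<xi> t has_real_derivative boundary_flux \<xi> t \<tau>) (at \<tau>)"
proof -
  let ?K = "\<lambda>x r. heat_kernel (\<xi> - x) (t - r)"
  let ?Kx = "\<lambda>x r. heat_kernel (\<xi> - x) (t - r) * ((\<xi> - x) / (2 * (t - r)))"
  let ?Kxx = "\<lambda>x r. heat_kernel (\<xi> - x) (t - r) * ((\<xi> - x)\<^sup>2 / (4 * (t - r)\<^sup>2) - 1 / (2 * (t - r)))"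
  let ?S = "(UNIV :: real set) \<times> {0<..<t}"
  have d1: "((\<lambda>x. ?K x r) has_real_derivative ?Kx x r) (at x)" if "r < t" for x r
  proof -
    have "((\<lambda>x. \<xi> - x) has_real_derivative - 1) (at x)" "((\<lambda>x. t - r) has_real_derivative 0) (at x)"
      by (auto intro!: derivative_eq_intros)
    from heat_kernel_deriv[OF this] that
    have "((\<lambda>x. ?K x r) has_real_derivative heat_kernel (\<xi> - x) (t - r) * - ((\<xi> - x) * - 1 / (2 * (t - r)))) (at x)"
      by (simp del: mult_minus_right mult_minus1_right minus_divide_left)
    moreover have "- ((\<xi> - x) * - 1 / (2 * (t - r))) = (\<xi> - x) / (2 * (t - r))"
      by (simp only: mult_minus_right mult_1_right minus_divide_left[symmetric] minus_minus)
    ultimately show ?thesis by (simp only:)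
  qed
  have cK: "continuous_on ?S (\<lambda>z. heat_kernel (\<xi> - fst z) (t - snd z))"
    by (rule heat_kernel_continuous) (auto intro!: continuous_intros)
  have "((\<lambda>r. integral {0..s r} (\<lambda>x. ?K x r * w x r)) has_real_derivative
     (s' \<tau> * ?K (s \<tau>) \<tau> - ?Kx (s \<tau>) \<tau>) * w (s \<tau>) \<tau> - (?K 0 \<tau> * wx 0 \<tau> - ?Kx 0 \<tau> * w 0 \<tau>)) (at \<tau>)"
  proof (rule green_identity[OF assms, where Gxx = ?Kxx])
    fix p p' r assume r: "0 < r" "r < t" and p: "(p has_real_derivative p') (at r)"
    have "((\<lambda>r. \<xi> - p r) has_real_derivative - p') (at r)" "((\<lambda>r. t - r) has_real_derivative - 1) (at r)"
      by (auto intro!: derivative_eq_intros p)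
    note * = heat_kernel_deriv[OF this]
    have alg: "K * (- (z * - p' / d) + - 1 * A) = K * (z / d) * p' - K * A" for K z d A :: real
      by (simp add: algebra_simps)
    show "((\<lambda>r. ?K (p r) r) has_real_derivative ?Kx (p r) r * p' - ?Kxx (p r) r) (at r)"
      by (rule DERIV_cong[OF * alg]) (use r in simp)
  next
    fix x r assume r: "0 < r" "r < t"
    show "((\<lambda>x. ?K x r) has_real_derivative ?Kx x r) (at x)" by (rule d1[OF r(2)])
    have "((\<lambda>x. (\<xi> - x) / (2 * (t - r))) has_real_derivative - 1 / (2 * (t - r))) (at x)"
      by (rule DERIV_cdivide) (auto intro!: derivative_eq_intros)
    from DERIV_mult[OF d1[OF r(2)] this]
    show "((\<lambda>x. ?Kx x r) has_real_derivative ?Kxx x r) (at x)"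
    proof (rule DERIV_cong)
      have alg: "K * (z / (2 * d)) * (z / (2 * d)) + - 1 / (2 * d) * K = K * (z\<^sup>2 / (4 * d\<^sup>2) - 1 / (2 * d))"
        for K z d :: real
        by (simp add: algebra_simps power2_eq_square)
      show "?Kx x r * ((\<xi> - x) / (2 * (t - r))) + - 1 / (2 * (t - r)) * ?K x r = ?Kxx x r"
        by (rule alg)
    qed
  next
    show "continuous_on ?S (\<lambda>(x, r). ?K x r)" using cK by (simp add: case_prod_unfold)
    show "continuous_on ?S (\<lambda>(x, r). ?Kx x r)"
      unfolding case_prod_unfold by (intro continuous_intros cK) auto
    show "continuous_on ?S (\<lambda>(x, r). ?Kxx x r)"
      unfolding case_prod_unfold by (intro continuous_intros cK) auto
  qed
  moreover have "(s' \<tau> * ?K (s \<tau>) \<tau> - ?Kx (s \<tau>) \<tau>) * w (s \<tau>) \<tau> - (?K 0 \<tau> * wx 0 \<tau> - ?Kx 0 \<tau> * w 0 \<tau>) = boundary_flux \<xi> t \<tau>"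
    by (simp add: boundary_flux_def algebra_simps)
  moreover have "heat_average \<xi> t = (\<lambda>r. integral {0..s r} (\<lambda>x. ?K x r * w x r))"
    by (simp add: heat_average_def fun_eq_iff)
  ultimately show ?thesis by simp
qed

lemma w_bounded:
  assumes "0 \<le> c"
  obtains M where "\<And>x \<tau>. c \<le> \<tau> \<Longrightarrow> \<tau> \<le> t \<Longrightarrow> 0 \<le> x \<Longrightarrow> x \<le> s \<tau> \<Longrightarrow> \<bar>w x \<tau>\<bar> \<le> M"
proof -
  have "continuous_on ({c..t} \<times> {0..1}) (\<lambda>z. w (snd z * s (fst z)) (fst z))"
    by (rule stretched_continuous[OF partials_continuous(1)]) (use assms in auto)
  then have "bounded ((\<lambda>z. w (snd z * s (fst z)) (fst z)) ` ({c..t} \<times> {0..1}))"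
    by (intro compact_imp_bounded compact_continuous_image compact_Times) auto
  then obtain M where M: "\<And>z. z \<in> {c..t} \<times> {0..1} \<Longrightarrow> \<bar>w (snd z * s (fst z)) (fst z)\<bar> \<le> M"
    unfolding bounded_iff by (metis (no_types, lifting) image_eqI real_norm_def)
  show thesis
  proof (rule that)
    fix x \<tau> assume *: "c \<le> \<tau>" "\<tau> \<le> t" "0 \<le> x" "x \<le> s \<tau>"
    then have "0 < s \<tau>" using s_pos[of \<tau>] assms by simp
    then show "\<bar>w x \<tau>\<bar> \<le> M" using M[of "(\<tau>, x / s \<tau>)"] * by simp
  qed
qed

text \<open>
  Integrate the derivative of the heat average from \<open>c\<close> up to times \<open>\<tau> n\<close> increasing to \<open>t\<close>. For
  \<open>\<xi> = s t\<close> the end point of the domain moves, but by differentiability of \<open>s\<close> its distance from \<open>\<xi>\<close>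
  is of smaller order than \<open>sqrt (t - \<tau>)\<close>, the width of the kernel.
\<close>

lemma boundary_representation:
  assumes c: "0 < c" "c < t" and \<xi>: "\<xi> = 0 \<or> \<xi> = s t"
    and X: "(boundary_flux \<xi> t has_integral X) {c..t}"
  shows "w \<xi> t / 2 = heat_average \<xi> t c + X"
proof -
  define \<rho> where "\<rho> n = (t - c) / (real n + 1)" for n
  define \<tau> where "\<tau> n = t - \<rho> n" for n
  have \<rho>: "0 < \<rho> n" "\<rho> n \<le> t - c" for n
  proof -
    show "0 < \<rho> n" using c by (simp add: \<rho>_def)
    have "(t - c) / (real n + 1) \<le> (t - c) / 1" using c by (intro divide_left_mono) auto
    then show "\<rho> n \<le> t - c" by (simp add: \<rho>_def)
  qed
  have \<rho>0: "\<rho> \<longlonglongrightarrow> 0" unfolding \<rho>_def by real_asymp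
  have \<tau>: "c \<le> \<tau> n" "\<tau> n < t" for n using \<rho>[of n] by (auto simp: \<tau>_def)
  have \<tau>t: "\<tau> \<longlonglongrightarrow> t" unfolding \<tau>_def using tendsto_diff[OF tendsto_const \<rho>0, of t] by simp
  have sq0: "(\<lambda>n. sqrt (\<rho> n)) \<longlonglongrightarrow> 0" using tendsto_real_sqrt[OF \<rho>0] by simp
  have s\<tau>: "(\<lambda>n. s (\<tau> n)) \<longlonglongrightarrow> s t"
    using DERIV_isCont[OF s_deriv, of t] c \<tau>t by (auto intro: isCont_tendsto_compose)
  have t0: "0 < t" using c by simp
  obtain M where M: "\<And>x \<tau>. c \<le> \<tau> \<Longrightarrow> \<tau> \<le> t \<Longrightarrow> 0 \<le> x \<Longrightarrow> x \<le> s \<tau> \<Longrightarrow> \<bar>w x \<tau>\<bar> \<le> M"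
    using w_bounded[of c t] c by auto
  define \<sigma> where "\<sigma> = (if \<xi> = 0 then - 1 else 1 :: real)"
  have \<sigma>: "\<sigma> = 1 \<or> \<sigma> = - 1" by (simp add: \<sigma>_def)
  define q where "q n z = \<xi> - \<sigma> * sqrt (\<rho> n) * z" for n z
  have st: "0 < s t" using s_pos c by simp
  have q: "(\<lambda>n. q n z) \<longlonglongrightarrow> \<xi>" for z
    unfolding q_def using tendsto_diff[OF tendsto_const tendsto_mult[OF tendsto_mult[OF tendsto_const sq0] tendsto_const], of \<xi> \<sigma> z]
    by simp
  \<comment> \<open>In the scaled variable \<open>z\<close> the moving end point sits at this quotient, the origin in the limit.\<close>
  have gap: "(\<lambda>n. (s t - s (\<tau> n)) / sqrt (\<rho> n)) \<longlonglongrightarrow> 0"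
  proof -
    have "((\<lambda>y. (s y - s t) / (y - t)) \<longlongrightarrow> s' t) (at t)"
      using s_deriv[OF t0] by (simp add: has_field_derivative_iff)
    moreover have "filterlim \<tau> (at t) sequentially"
      using \<tau>t \<tau> by (auto simp: filterlim_at less_imp_neq)
    ultimately have "(\<lambda>n. (s (\<tau> n) - s t) / (\<tau> n - t)) \<longlonglongrightarrow> s' t" by (rule filterlim_compose)
    from tendsto_mult[OF this sq0]
    have "(\<lambda>n. (s (\<tau> n) - s t) / (\<tau> n - t) * sqrt (\<rho> n)) \<longlonglongrightarrow> 0" by simp
    moreover have "(s (\<tau> n) - s t) / (\<tau> n - t) * sqrt (\<rho> n) = (s t - s (\<tau> n)) / sqrt (\<rho> n)" for n
    proof -
      have alg: "(x - y) / - (R * R) * R = (y - x) / R" if "0 < R" for x y R :: real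
        using that by (simp add: divide_simps)
      have "\<tau> n - t = - (sqrt (\<rho> n) * sqrt (\<rho> n))" using \<rho>(1)[of n] by (simp add: \<tau>_def)
      then show ?thesis using alg[of "sqrt (\<rho> n)"] \<rho>(1)[of n] by (simp only: real_sqrt_gt_0_iff)
    qed
    ultimately show ?thesis by simp
  qed
  have inside: "eventually (\<lambda>n. 0 \<le> q n z \<and> q n z \<le> s (\<tau> n)) sequentially" if z: "0 < z" for z
  proof (cases "\<xi> = 0")
    case True
    have "(\<lambda>n. s (\<tau> n) - q n z) \<longlonglongrightarrow> s t - 0" using tendsto_diff[OF s\<tau> q[of z]] True by simp
    then have "eventually (\<lambda>n. 0 < s (\<tau> n) - q n z) sequentially"
      by (rule order_tendstoD(1)) (use st in simp)
    then show ?thesis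
      by eventually_elim (use z \<rho>(1) True in \<open>auto simp: q_def \<sigma>_def less_imp_le\<close>)
  next
    case False
    have "eventually (\<lambda>n. 0 < q n z) sequentially"
      by (rule order_tendstoD(1)[OF q]) (use \<xi> False st in auto)
    moreover have "eventually (\<lambda>n. (s t - s (\<tau> n)) / sqrt (\<rho> n) < z) sequentially"
      by (rule order_tendstoD(2)[OF gap z])
    ultimately show ?thesis
    proof eventually_elim
      case (elim n)
      have "s t - s (\<tau> n) < z * sqrt (\<rho> n)" using elim(2) \<rho>(1)[of n] by (simp add: pos_divide_less_eq)
      then have "q n z \<le> s (\<tau> n)" using \<xi> False by (simp add: q_def \<sigma>_def mult.commute)
      then show ?case using elim(1) by simp
    qed
  qed
  have outside: "eventually (\<lambda>n. \<not> (0 \<le> q n z \<and> q n z \<le> s (\<tau> n))) sequentially" if z: "z < 0" for z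
  proof (cases "\<xi> = 0")
    case True
    have "q n z < 0" for n using True z \<rho>(1)[of n] by (simp add: q_def \<sigma>_def mult_pos_neg)
    then show ?thesis by (simp add: not_le)
  next
    case False
    have "eventually (\<lambda>n. z < (s t - s (\<tau> n)) / sqrt (\<rho> n)) sequentially"
      by (rule order_tendstoD(1)[OF gap z])
    then show ?thesis
    proof eventually_elim
      case (elim n)
      have "z * sqrt (\<rho> n) < s t - s (\<tau> n)" using elim \<rho>(1)[of n] by (simp add: pos_less_divide_eq)
      then have "s (\<tau> n) < q n z" using \<xi> False by (simp add: q_def \<sigma>_def mult.commute)
      then show ?case by simp
    qed
  qed
  have half: "(\<lambda>n. integral {0..s (\<tau> n)} (\<lambda>x. heat_kernel (\<xi> - x) (\<rho> n) * w x (\<tau> n))) \<longlonglongrightarrow> w \<xi> t / 2"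
  proof (rule heat_kernel_half_mass[OF \<rho>(1) \<sigma>])
    show "continuous_on {0..s (\<tau> n)} (\<lambda>x. w x (\<tau> n))" for n
      by (rule w_cont[OF partials_continuous(1)]) (use \<tau>[of n] c in \<open>auto intro!: continuous_intros\<close>)
    show "\<bar>w x (\<tau> n)\<bar> \<le> M" if "x \<in> {0..s (\<tau> n)}" for n x
      using M[of "\<tau> n" x] \<tau>[of n] that by auto
  next
    fix z :: real assume z: "0 < z"
    have "(\<lambda>n. (\<lambda>(x, t). w x t) (q n z, \<tau> n)) \<longlonglongrightarrow> (\<lambda>(x, t). w x t) (\<xi>, t)"
    proof (rule continuous_on_tendsto_compose[OF partials_continuous(1) tendsto_Pair[OF q \<tau>t]])
      show "(\<xi>, t) \<in> fb_domain s" using \<xi> st t0 by (auto simp: fb_domain_def)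
      show "\<forall>\<^sub>F n in sequentially. (q n z, \<tau> n) \<in> fb_domain s"
        using inside[OF z] by eventually_elim (use \<tau>(1) c in \<open>auto simp: fb_domain_def intro: order_trans less_imp_le\<close>)
    qed
    then have "(\<lambda>n. w (q n z) (\<tau> n)) \<longlonglongrightarrow> w \<xi> t" by simp
    then show "(\<lambda>n. indicator {0..s (\<tau> n)} (\<xi> - \<sigma> * sqrt (\<rho> n) * z) * w (\<xi> - \<sigma> * sqrt (\<rho> n) * z) (\<tau> n)) \<longlonglongrightarrow> w \<xi> t"
      unfolding q_def[symmetric]
      by (rule Lim_transform_eventually) (use inside[OF z] in \<open>eventually_elim, auto\<close>)
  next
    fix z :: real assume z: "z < 0"
    show "(\<lambda>n. indicator {0..s (\<tau> n)} (\<xi> - \<sigma> * sqrt (\<rho> n) * z) * w (\<xi> - \<sigma> * sqrt (\<rho> n) * z) (\<tau> n)) \<longlonglongrightarrow> 0"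
      unfolding q_def[symmetric]
      by (rule Lim_transform_eventually[OF tendsto_const]) (use outside[OF z] in \<open>eventually_elim, auto simp: indicator_def\<close>)
  qed
  have avg: "heat_average \<xi> t (\<tau> n) = integral {0..s (\<tau> n)} (\<lambda>x. heat_kernel (\<xi> - x) (\<rho> n) * w x (\<tau> n))" for n
    by (simp add: heat_average_def \<tau>_def)
  have ftc: "integral {c..\<tau> n} (boundary_flux \<xi> t) = heat_average \<xi> t (\<tau> n) - heat_average \<xi> t c" for n
  proof (rule integral_unique, rule fundamental_theorem_of_calculus[OF \<tau>(1)])
    fix r assume "r \<in> {c..\<tau> n}"
    then show "(heat_average \<xi> t has_vector_derivative boundary_flux \<xi> t r) (at r within {c..\<tau> n})"
      using heat_average_deriv[of r t \<xi>] c \<tau>(2)[of n]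
      by (auto simp: has_real_derivative_iff_has_vector_derivative[symmetric] intro: has_field_derivative_at_within)
  qed
  have "continuous_on {c..t} (\<lambda>r. integral {c..r} (boundary_flux \<xi> t))"
    by (rule indefinite_integral_continuous_1[OF has_integral_integrable[OF X]])
  then have "(\<lambda>n. integral {c..\<tau> n} (boundary_flux \<xi> t)) \<longlonglongrightarrow> integral {c..t} (boundary_flux \<xi> t)"
    by (rule continuous_on_tendsto_compose[OF _ \<tau>t]) (use c \<tau> in \<open>auto simp: less_imp_le\<close>)
  then have "(\<lambda>n. heat_average \<xi> t (\<tau> n) - heat_average \<xi> t c) \<longlonglongrightarrow> X"
    unfolding ftc integral_unique[OF X] .
  moreover have "(\<lambda>n. heat_average \<xi> t (\<tau> n) - heat_average \<xi> t c) \<longlonglongrightarrow> w \<xi> t / 2 - heat_average \<xi> t c"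
    unfolding avg by (intro tendsto_diff half tendsto_const)
  ultimately have "X = w \<xi> t / 2 - heat_average \<xi> t c" by (rule LIMSEQ_unique)
  then show ?thesis by simp
qed

end

section \<open>Layer kernels\<close>

text \<open>
  The family is closed under differentiation, and all its members are flat at \<open>0\<close>. This is the reason
  why the heat kernel evaluated at a positive distance from the singularity is smooth across
  \<open>\<rho> = 0\<close>.
\<close>

definition flat_exp :: "real \<Rightarrow> real \<Rightarrow> real" where
  "flat_exp p y = (if y \<le> 0 then 0 else y powr (-p) * exp (- 1 / (4 * y)))"

lemma flat_exp_tendsto_0: "(flat_exp p \<longlongrightarrow> 0) (at 0)"
proof -
  have "((\<lambda>y. y powr (-p) * exp (- 1 / (4 * y))) \<longlongrightarrow> 0) (at_right 0)" for p :: real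
    by real_asymp
  then have r: "(flat_exp p \<longlongrightarrow> 0) (at_right 0)"
    by (rule Lim_transform_eventually)
       (auto simp: flat_exp_def eventually_at_right_field intro!: exI[of _ 1])
  have l: "(flat_exp p \<longlongrightarrow> 0) (at_left 0)"
    by (rule Lim_transform_eventually[OF tendsto_const]) (auto simp: flat_exp_def eventually_at_left_field intro!: exI[of _ "-1"])
  from l r show ?thesis by (rule filterlim_split_at)
qed

lemma flat_exp_derivative:
  "(flat_exp p has_real_derivative (- p * flat_exp (p + 1) y + flat_exp (p + 2) y / 4)) (at y)"
proof -
  consider "y < 0" | "y = 0" | "y > 0" by linarith
  then show ?thesis
  proof cases
    case 1
    have "((\<lambda>_. 0) has_real_derivative 0) (at y)" by simp
    then have "(flat_exp p has_real_derivative 0) (at y)"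
      by (rule has_field_derivative_transform_within_open[of _ _ _ "{..<0}"]) (use 1 in \<open>auto simp: flat_exp_def\<close>)
    then show ?thesis using 1 by (simp add: flat_exp_def)
  next
    case 2
    \<comment> \<open>The difference quotient at 0 is again a member of the family.\<close>
    have "(\<lambda>h. (flat_exp p (0 + h) - flat_exp p 0) / h) = flat_exp (p + 1)"
    proof (rule ext)
      fix h :: real
      show "(flat_exp p (0 + h) - flat_exp p 0) / h = flat_exp (p + 1) h"
      proof (cases "h \<le> 0")
        case False
        have e: "h powr (-p) / h = h powr (-(p+1))"
          using False by (simp add: powr_diff)
        have "(flat_exp p (0 + h) - flat_exp p 0) / h = (h powr (-p) / h) * exp (- 1 / (4 * h))"
          using False by (simp add: flat_exp_def)
        then show ?thesis unfolding e using False by (simp add: flat_exp_def)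
      qed (simp add: flat_exp_def)
    qed
    then have "(flat_exp p has_real_derivative 0) (at 0)"
      using flat_exp_tendsto_0[of "p+1"] by (simp add: DERIV_def)
    then show ?thesis using 2 by (simp add: flat_exp_def)
  next
    case 3
    have "((\<lambda>y. y powr (-p) * exp (- 1 / (4 * y))) has_real_derivative
       (- p * (y powr (-(p + 1)) * exp (- 1 / (4 * y))) + (y powr (-(p + 2)) * exp (- 1 / (4 * y))) / 4)) (at y)"
    proof -
      have e: "y powr (-(p+2)) = y powr (-p) / y^2" "y powr (-(p+1)) = y powr (-p) / y" "y powr (-p-1) = y powr (-p) / y"
        using 3 by (simp_all add: powr_diff powr_add powr_minus field_simps powr_numeral)
      show ?thesis unfolding e
        using 3 by (auto intro!: derivative_eq_intros simp: field_simps power2_eq_square e)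
    qed
    then have "(flat_exp p has_real_derivative
       (- p * (y powr (-(p + 1)) * exp (- 1 / (4 * y))) + (y powr (-(p + 2)) * exp (- 1 / (4 * y))) / 4)) (at y)"
      by (rule has_field_derivative_transform_within_open[of _ _ _ "{0<..}"]) (use 3 in \<open>auto simp: flat_exp_def\<close>)
    then show ?thesis using 3 by (simp add: flat_exp_def)
  qed
qed

lemma Ck_flat_exp: "Ck k UNIV (flat_exp p)"
proof (induction k arbitrary: p)
  case 0
  show ?case unfolding Ck_0
    using DERIV_isCont[OF flat_exp_derivative] by (auto intro: continuous_at_imp_continuous_on)
next
  case (Suc k)
  have "Ck k UNIV (\<lambda>y. - p * flat_exp (p + 1) y + 1/4 * flat_exp (p + 2) y)"
    by (intro Ck_add Ck_mult Ck_real Suc)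
  then show ?case by (intro Ck_SucI[OF flat_exp_derivative]) simp
qed
lemma Ck_param_heat_kernel:
  assumes "Ck_param k I P z" "Ck_param k I P \<rho>" "\<And>t p. t \<in> I \<Longrightarrow> p \<in> P \<Longrightarrow> 0 < \<rho> t p"
  shows "Ck_param k I P (\<lambda>t p. heat_kernel (z t p) (\<rho> t p))"
  unfolding heat_kernel_def
  by (intro Ck_param_divide Ck_param_exp Ck_param_minus Ck_param_sqrt Ck_param_mult Ck_param_power Ck_param_real assms) (use assms(3) in auto)

definition gauss_const :: real where "gauss_const = 1 / sqrt (4 * pi)"

text \<open>
  The heat kernel at distance \<open>\<zeta> > 0\<close>, extended by \<open>0\<close> to times \<open>\<rho> \<le> 0\<close>. Parabolic scaling reduces it to
  the smooth function \<open>flat_exp\<close> of \<open>\<rho> / \<zeta>^2\<close>. The double layer is the extension of the negative of the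
  derivative in \<open>\<zeta>\<close>.
\<close>

definition single_layer :: "real \<Rightarrow> real \<Rightarrow> real" where
  "single_layer \<zeta> \<rho> = gauss_const / \<zeta> * flat_exp (1 / 2) (\<rho> / \<zeta>\<^sup>2)"

definition double_layer :: "real \<Rightarrow> real \<Rightarrow> real" where
  "double_layer \<zeta> \<rho> = gauss_const / (2 * \<zeta>\<^sup>2) * flat_exp (3 / 2) (\<rho> / \<zeta>\<^sup>2)"

lemma layers_of_heat_kernel:
  assumes "0 < \<zeta>" "0 < \<rho>"
  shows "single_layer \<zeta> \<rho> = heat_kernel \<zeta> \<rho>" "double_layer \<zeta> \<rho> = heat_kernel \<zeta> \<rho> * (\<zeta> / (2 * \<rho>))"
proof -
  define R where "R = sqrt \<rho>"
  have R: "0 < R" "\<rho> = R * R" using assms by (auto simp: R_def)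
  have half: "(\<rho> / \<zeta>\<^sup>2) powr (- (1 / 2)) = \<zeta> / R"
    using assms by (simp add: powr_minus powr_half_sqrt real_sqrt_divide R_def)
  have "(\<rho> / \<zeta>\<^sup>2) powr (- (3 / 2)) = (\<rho> / \<zeta>\<^sup>2) powr (- (1 / 2)) * (\<rho> / \<zeta>\<^sup>2) powr (- 1)"
  proof -
    have "- (3 / 2) = - (1 / 2) + (- 1 :: real)" by simp
    then show ?thesis by (simp only: powr_add)
  qed
  also have "\<dots> = \<zeta> / R * (\<zeta>\<^sup>2 / \<rho>)" unfolding half using assms by (simp add: powr_minus_divide)
  finally have three_half: "(\<rho> / \<zeta>\<^sup>2) powr (- (3 / 2)) = \<zeta> / R * (\<zeta>\<^sup>2 / \<rho>)" .
  define e where "e = exp (- (\<zeta>\<^sup>2 / (4 * \<rho>)))"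
  have np: "(\<rho> / \<zeta>\<^sup>2 \<le> 0) = False" using assms by (simp add: not_le)
  have e: "exp (- 1 / (4 * (\<rho> / \<zeta>\<^sup>2))) = e" by (simp add: e_def)
  have K: "heat_kernel \<zeta> \<rho> = gauss_const * e / R"
    by (simp add: heat_kernel_def e_def gauss_const_def R_def real_sqrt_mult)
  show "single_layer \<zeta> \<rho> = heat_kernel \<zeta> \<rho>"
    unfolding single_layer_def flat_exp_def K half e np if_False using assms R(1) by simp
  show "double_layer \<zeta> \<rho> = heat_kernel \<zeta> \<rho> * (\<zeta> / (2 * \<rho>))"
    unfolding double_layer_def flat_exp_def K three_half e np if_False using assms R(1)
    by (simp add: field_simps)
qed

lemma Ck_param_layer:
  assumes z: "Ck_param k I P z" and r: "Ck_param k I P r" and pos: "\<And>t p. t \<in> I \<Longrightarrow> p \<in> P \<Longrightarrow> 0 < z t p"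
  shows "Ck_param k I P (\<lambda>t p. single_layer (z t p) (r t p))" "Ck_param k I P (\<lambda>t p. double_layer (z t p) (r t p))"
proof -
  have ne: "z t p \<noteq> 0" if "t \<in> I" "p \<in> P" for t p using pos[OF that] by simp
  have f: "Ck_param k I P (\<lambda>t p. flat_exp a (r t p / (z t p)\<^sup>2))" for a
    by (rule Ck_param_compose[OF Ck_flat_exp Ck_param_divide[OF r Ck_param_power[OF z]]]) (simp_all add: ne)
  show "Ck_param k I P (\<lambda>t p. single_layer (z t p) (r t p))"
    unfolding single_layer_def by (intro Ck_param_mult Ck_param_divide Ck_param_real z f) (use pos in auto)
  show "Ck_param k I P (\<lambda>t p. double_layer (z t p) (r t p))"
    unfolding double_layer_def
    by (intro Ck_param_mult Ck_param_divide Ck_param_real Ck_param_power z f) (simp_all add: ne)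
qed

lemma layer_zero: "\<rho> \<le> 0 \<Longrightarrow> single_layer \<zeta> \<rho> = 0" "\<rho> \<le> 0 \<Longrightarrow> double_layer \<zeta> \<rho> = 0"
proof -
  assume "\<rho> \<le> 0"
  then have "\<rho> / \<zeta>\<^sup>2 \<le> 0" by (simp add: divide_nonpos_nonneg)
  then show "single_layer \<zeta> \<rho> = 0" "double_layer \<zeta> \<rho> = 0"
    by (simp_all add: single_layer_def double_layer_def flat_exp_def)
qed

lemma layer_continuous:
  assumes "continuous_on S z" "continuous_on S r" "\<And>x. x \<in> S \<Longrightarrow> 0 < z x"
  shows "continuous_on S (\<lambda>x. single_layer (z x) (r x))" "continuous_on S (\<lambda>x. double_layer (z x) (r x))"
proof -
  have ne: "z x \<noteq> 0" if "x \<in> S" for x using assms(3)[OF that] by simp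
  have "continuous_on S (\<lambda>x. r x / (z x)\<^sup>2)"
    by (intro continuous_intros assms(1,2)) (simp add: ne)
  then have f: "continuous_on S (\<lambda>x. flat_exp a (r x / (z x)\<^sup>2))" for a
    by (rule continuous_on_compose2[OF Ck_continuous[OF Ck_flat_exp[of 0 a]]]) simp
  show "continuous_on S (\<lambda>x. single_layer (z x) (r x))"
    unfolding single_layer_def by (intro continuous_intros f assms(1,2)) (simp add: ne)
  show "continuous_on S (\<lambda>x. double_layer (z x) (r x))"
    unfolding double_layer_def by (intro continuous_intros f assms(1,2)) (simp add: ne)
qed

text \<open>
  Since the kernel vanishes for \<open>\<tau> \<ge> t\<close>, the upper limit \<open>t\<close> may be replaced by a fixed time, and one can
  differentiate under the integral sign.
\<close>

lemma Ck_causal_integral: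
  fixes F :: "real \<Rightarrow> real \<Rightarrow> real"
  assumes F: "\<And>T. Ck_param k {c<..<T} {c..T} F"
    and causal: "\<And>t \<tau>. c < t \<Longrightarrow> t \<le> \<tau> \<Longrightarrow> F t \<tau> = 0"
  shows "Ck k {c<..} (\<lambda>t. integral {c..t} (F t))"
proof (rule Ck_local)
  fix t0 assume t0: "t0 \<in> {c<..}"
  let ?T = "t0 + 1"
  have J: "open {c<..<?T}" "convex {c<..<?T}" by (auto intro: convex_real_interval)
  have "Ck k {c<..<?T} (\<lambda>t. integral {c..?T} (F t))"
    by (rule Ck_integral[OF J F])
  then have "Ck k {c<..<?T} (\<lambda>t. integral {c..t} (F t))"
  proof (rule Ck_cong[OF _ J(1)])
    fix t assume t: "t \<in> {c<..<?T}"
    have "continuous_on {c..?T} (\<lambda>\<tau>. (\<lambda>(t, \<tau>). F t \<tau>) (t, \<tau>))"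
      by (rule continuous_on_compose2[OF Ck_param_continuous[OF F[of ?T]]]) (use t in \<open>auto intro!: continuous_intros\<close>)
    then have "F t integrable_on {c..?T}" by (intro integrable_continuous_real) simp
    then have "integral {c..t} (F t) + integral {t..?T} (F t) = integral {c..?T} (F t)"
      using t by (intro Henstock_Kurzweil_Integration.integral_combine) auto
    moreover have "integral {t..?T} (F t) = integral {t..?T} (\<lambda>_. 0)"
      by (rule integral_cong) (use causal t in auto)
    ultimately show "integral {c..?T} (F t) = integral {c..t} (F t)" by simp
  qed
  then show "\<exists>J. open J \<and> t0 \<in> J \<and> Ck k J (\<lambda>t. integral {c..t} (F t))"
    using J(1) t0 by (intro exI[of _ "{c<..<?T}"]) auto
qed simp

section \<open>Integral equations for the boundary traces and their regularity\<close>

context heat_on_moving_domain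
begin

abbreviation dirichlet_trace :: "real \<Rightarrow> real" where "dirichlet_trace \<equiv> w 0"
abbreviation neumann_trace :: "real \<Rightarrow> real" where "neumann_trace \<equiv> wx 0"
definition free_trace :: "real \<Rightarrow> real" where "free_trace t = w (s t) t"

lemma dirichlet_trace_continuous: "continuous_on {0..} dirichlet_trace"
  by (rule w_cont[OF partials_continuous(1)]) (use s_pos in \<open>auto intro: less_imp_le\<close>)

lemma neumann_trace_continuous: "continuous_on {0..} neumann_trace"
  by (rule wx_cont[OF partials_continuous(2)]) (use s_pos in \<open>auto intro: less_imp_le\<close>)

lemma free_trace_continuous: "continuous_on {0..} free_trace"
  unfolding free_trace_def
  by (rule w_cont[OF partials_continuous(1)]) (use s_pos s_continuous in \<open>auto intro: less_imp_le\<close>)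

definition slope :: "real \<Rightarrow> real \<Rightarrow> real" where "slope = weighted_mean (\<lambda>_. 1) s'"

text \<open>
  With \<open>m = slope t \<tau>\<close>, the difference quotient of \<open>s\<close>, the heat kernel evaluated between two points of
  the free boundary is \<open>gauss_const * exp (- (t - \<tau>) * m^2 / 4) / sqrt (t - \<tau>)\<close>. The factor
  \<open>2 * s' \<tau> - m\<close> collects the motion of the boundary and the normal derivative of the kernel, doubled
  because only half of the boundary value is represented.
\<close>

definition trace_kernel :: "real \<Rightarrow> real \<Rightarrow> real" where
  "trace_kernel t \<tau> = gauss_const * exp ((\<tau> - t) * (slope t \<tau> * slope t \<tau> * (1 / 4))) * (2 * s' \<tau> - slope t \<tau>)"

lemma slope_eq: "0 < t \<Longrightarrow> 0 < \<tau> \<Longrightarrow> s t - s \<tau> = (t - \<tau>) * slope t \<tau>"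
  unfolding slope_def by (rule mean_value_integral[OF s_deriv])

lemma smooth_kernel_slope: "Ck k {0<..} s' \<Longrightarrow> smooth_kernel TYPE('p::topological_space) k slope"
  unfolding slope_def by (rule smooth_kernel_weighted_mean) auto

lemma smooth_kernel_trace_kernel:
  assumes "Ck k {0<..} s'" shows "smooth_kernel TYPE('p::topological_space) k trace_kernel"
  unfolding trace_kernel_def[abs_def]
  by (intro smooth_kernel_mult smooth_kernel_exp smooth_kernel_diff smooth_kernel_const smooth_kernel_slope
      smooth_kernel_right smooth_kernel_left Ck_id assms)

lemma s'_continuous_Ck: "Ck 0 {0<..} s'"
  unfolding Ck_0 by (rule continuous_on_subset[OF s'_continuous]) auto

lemma trace_kernel_row_continuous: "0 < t \<Longrightarrow> continuous_on {0<..} (trace_kernel t)"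
proof -
  assume t: "0 < t"
  have "continuous_on {0<..} (\<lambda>\<tau>. (\<lambda>(t, \<tau>). trace_kernel t \<tau>) (t, \<tau>))"
    by (rule continuous_on_compose2[OF smooth_kernel_continuous[OF smooth_kernel_trace_kernel[OF s'_continuous_Ck]]])
       (use t in \<open>auto intro!: continuous_intros\<close>)
  then show ?thesis by simp
qed

definition trace_rest :: "real \<Rightarrow> real \<Rightarrow> real" where
  "trace_rest c t = 2 * heat_average (s t) t c
     + 2 * integral {c..t} (\<lambda>\<tau>. double_layer (s t) (t - \<tau>) * dirichlet_trace \<tau> - single_layer (s t) (t - \<tau>) * neumann_trace \<tau>)"

text \<open>
  The Neumann condition removes the unknown flux at the free boundary, so this is a Volterra equation of
  the second kind for the trace alone; the contributions of the fixed boundary are separated from it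
  by the positive distance \<open>s t\<close>.
\<close>

lemma trace_equation:
  assumes c: "0 < c" "c < t"
  shows "free_trace t = trace_rest c t + abel c (\<lambda>\<tau>. trace_kernel t \<tau> * free_trace \<tau>) t"
proof -
  let ?reg = "\<lambda>\<tau>. double_layer (s t) (t - \<tau>) * dirichlet_trace \<tau> - single_layer (s t) (t - \<tau>) * neumann_trace \<tau>"
  let ?\<Phi> = "\<lambda>\<tau>. 1 / 2 * (trace_kernel t \<tau> * free_trace \<tau>)"
  have t: "0 < t" and st: "0 < s t" using c s_pos by auto
  have sub: "{c..t} \<subseteq> {0<..}" "{c..t} \<subseteq> {0..}" using c by auto
  note tr = continuous_on_subset[OF trace_kernel_row_continuous[OF t] sub(1)]
    continuous_on_subset[OF free_trace_continuous sub(2)] continuous_on_subset[OF dirichlet_trace_continuous sub(2)]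
    continuous_on_subset[OF neumann_trace_continuous sub(2)]
  have creg: "continuous_on {c..t} ?reg"
    by (intro continuous_intros layer_continuous tr st)
  have c\<Phi>: "continuous_on {c..t} ?\<Phi>" by (intro continuous_intros tr)
  have "((\<lambda>\<tau>. ?\<Phi> \<tau> / sqrt (t - \<tau>) + ?reg \<tau>) has_integral (abel c ?\<Phi> t + integral {c..t} ?reg)) {c..t}"
    by (intro has_integral_add abel_has_integral c\<Phi> integrable_integral integrable_continuous_real creg) (use c in simp)
  then have "(boundary_flux (s t) t has_integral (abel c ?\<Phi> t + integral {c..t} ?reg)) {c..t}"
  proof (rule has_integral_spike[OF negligible_sing[of t], rotated])
    fix \<tau> assume "\<tau> \<in> {c..t} - {t}"
    then have \<tau>: "0 < \<tau>" "\<tau> < t" using c by auto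
    define \<rho> where "\<rho> = t - \<tau>"
    define m where "m = slope t \<tau>"
    have \<rho>: "0 < \<rho>" using \<tau> by (simp add: \<rho>_def)
    have z: "s t - s \<tau> = \<rho> * m" using slope_eq[OF t \<tau>(1)] by (simp add: \<rho>_def m_def)
    have "heat_kernel (\<rho> * m) \<rho> = gauss_const * exp ((\<tau> - t) * (m * m * (1 / 4))) / sqrt \<rho>"
    proof -
      have "- ((\<rho> * m)\<^sup>2 / (4 * \<rho>)) = (\<tau> - t) * (m * m * (1 / 4))"
      proof -
        have "- ((\<rho> * m)\<^sup>2 / (4 * \<rho>)) = - \<rho> * (m * m * (1 / 4))" using \<rho> by (simp add: power2_eq_square)
        then show ?thesis by (simp add: \<rho>_def)
      qed
      then show ?thesis by (simp add: heat_kernel_def gauss_const_def real_sqrt_mult)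
    qed
    moreover have "(\<rho> * m) / (2 * \<rho>) = m / 2" using \<rho> by simp
    moreover note layers_of_heat_kernel[OF st \<rho>]
    ultimately show "boundary_flux (s t) t \<tau> = ?\<Phi> \<tau> / sqrt (t - \<tau>) + ?reg \<tau>"
      unfolding boundary_flux_def \<rho>_def[symmetric] z trace_kernel_def free_trace_def m_def[symmetric]
      by (simp add: algebra_simps diff_divide_distrib add_divide_distrib)
  qed
  from boundary_representation[OF c _ this]
  have "free_trace t / 2 = heat_average (s t) t c + (abel c ?\<Phi> t + integral {c..t} ?reg)"
    by (simp add: free_trace_def)
  moreover have "abel c ?\<Phi> t = 1 / 2 * abel c (\<lambda>\<tau>. trace_kernel t \<tau> * free_trace \<tau>) t"
    by (rule abel_cmult)
  ultimately show ?thesis by (simp add: trace_rest_def)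
qed

definition fixed_rest :: "real \<Rightarrow> real \<Rightarrow> real" where
  "fixed_rest c t = 2 * heat_average 0 t c
     + 2 * integral {c..t} (\<lambda>\<tau>. (s' \<tau> * single_layer (s \<tau>) (t - \<tau>) + double_layer (s \<tau>) (t - \<tau>)) * free_trace \<tau>)"

text \<open>
  The double layer of \<open>x = 0\<close> vanishes on \<open>x = 0\<close> itself, which leaves the Neumann trace under the Abel
  operator. The free boundary contributes a smooth function, because \<open>t\<close> enters there only through the
  flat layer kernels.
\<close>

lemma fixed_equation:
  assumes c: "0 < c" "c < t"
  shows "dirichlet_trace t = fixed_rest c t - 2 * gauss_const * abel c neumann_trace t"
proof -
  let ?reg = "\<lambda>\<tau>. (s' \<tau> * single_layer (s \<tau>) (t - \<tau>) + double_layer (s \<tau>) (t - \<tau>)) * free_trace \<tau>"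
  let ?\<Phi> = "\<lambda>\<tau>. - gauss_const * neumann_trace \<tau>"
  have sub: "{c..t} \<subseteq> {0..}" using c by auto
  note tr = continuous_on_subset[OF free_trace_continuous sub] continuous_on_subset[OF neumann_trace_continuous sub]
    continuous_on_subset[OF s_continuous sub] continuous_on_subset[OF s'_continuous sub]
  have creg: "continuous_on {c..t} ?reg"
    by (intro continuous_intros layer_continuous tr) (use s_pos c in auto)
  have c\<Phi>: "continuous_on {c..t} ?\<Phi>" by (intro continuous_intros tr)
  have "((\<lambda>\<tau>. ?\<Phi> \<tau> / sqrt (t - \<tau>) + ?reg \<tau>) has_integral (abel c ?\<Phi> t + integral {c..t} ?reg)) {c..t}"
    by (intro has_integral_add abel_has_integral c\<Phi> integrable_integral integrable_continuous_real creg) (use c in simp)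
  then have "(boundary_flux 0 t has_integral (abel c ?\<Phi> t + integral {c..t} ?reg)) {c..t}"
  proof (rule has_integral_spike[OF negligible_sing[of t], rotated])
    fix \<tau> assume "\<tau> \<in> {c..t} - {t}"
    then have \<tau>: "0 < \<tau>" "0 < t - \<tau>" using c by auto
    then have "0 < s \<tau>" using s_pos by simp
    moreover have "heat_kernel 0 (t - \<tau>) = gauss_const / sqrt (t - \<tau>)"
      by (simp add: heat_kernel_def gauss_const_def real_sqrt_mult)
    moreover have "0 - s \<tau> = - s \<tau>" by simp
    ultimately show "boundary_flux 0 t \<tau> = ?\<Phi> \<tau> / sqrt (t - \<tau>) + ?reg \<tau>"
      using layers_of_heat_kernel[of "s \<tau>" "t - \<tau>"] \<tau>(2)
      unfolding boundary_flux_def free_trace_def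
      by (simp only: heat_kernel_minus) (simp add: algebra_simps)
  qed
  from boundary_representation[OF c _ this]
  have "dirichlet_trace t / 2 = heat_average 0 t c + (abel c ?\<Phi> t + integral {c..t} ?reg)" by simp
  moreover have "abel c ?\<Phi> t = - gauss_const * abel c neumann_trace t" by (rule abel_cmult)
  ultimately show ?thesis by (simp add: fixed_rest_def)
qed

lemma heat_average_Ck:
  assumes "0 < c" "Ck k {c<..} \<xi>"
  shows "Ck k {c<..} (\<lambda>t. heat_average (\<xi> t) t c)"
  unfolding heat_average_def
proof (rule Ck_integral)
  show "Ck_param k {c<..} {0..s c} (\<lambda>t x. heat_kernel (\<xi> t - x) (t - c) * w x c)"
  proof (intro Ck_param_mult Ck_param_heat_kernel Ck_param_diff Ck_param_of_Ck[OF assms(2)] Ck_param_id Ck_param_real)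
    show "Ck_param k {c<..} {0..s c} (\<lambda>t x. x)" by (rule Ck_param_const) auto
    show "Ck_param k {c<..} {0..s c} (\<lambda>t x. w x c)"
      by (rule Ck_param_const, rule w_cont[OF partials_continuous(1)]) (use assms(1) in auto)
  qed auto
qed (auto intro: convex_real_interval)

lemma trace_rest_Ck:
  assumes c: "0 < c" and s: "Ck k {0<..} s"
  shows "Ck k {c<..} (trace_rest c)"
  unfolding trace_rest_def[abs_def]
proof (intro Ck_add Ck_mult Ck_real heat_average_Ck[OF c])
  show "Ck k {c<..} s" by (rule Ck_subset[OF s]) (use c in auto)
  show "Ck k {c<..} (\<lambda>t. integral {c..t} (\<lambda>\<tau>. double_layer (s t) (t - \<tau>) * dirichlet_trace \<tau> - single_layer (s t) (t - \<tau>) * neumann_trace \<tau>))"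
  proof (rule Ck_causal_integral)
    fix T
    let ?I = "{c<..<T}"
    have sI: "Ck_param k ?I {c..T} (\<lambda>t \<tau>. s t)" by (rule Ck_param_of_Ck, rule Ck_subset[OF s]) (use c in auto)
    have d: "Ck_param k ?I {c..T} (\<lambda>t \<tau>. t - \<tau>)" by (intro Ck_param_diff Ck_param_id Ck_param_const continuous_intros)
    have D: "Ck_param k ?I {c..T} (\<lambda>t \<tau>. dirichlet_trace \<tau>)"
      by (rule Ck_param_const, rule continuous_on_subset[OF dirichlet_trace_continuous]) (use c in auto)
    have N: "Ck_param k ?I {c..T} (\<lambda>t \<tau>. neumann_trace \<tau>)"
      by (rule Ck_param_const, rule continuous_on_subset[OF neumann_trace_continuous]) (use c in auto)
    show "Ck_param k ?I {c..T} (\<lambda>t \<tau>. double_layer (s t) (t - \<tau>) * dirichlet_trace \<tau> - single_layer (s t) (t - \<tau>) * neumann_trace \<tau>)"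
      by (intro Ck_param_diff[OF Ck_param_mult Ck_param_mult] Ck_param_layer sI d D N) (use s_pos c in auto)
  qed (simp add: layer_zero)
qed

lemma fixed_rest_Ck:
  assumes c: "0 < c"
  shows "Ck k {c<..} (fixed_rest c)"
  unfolding fixed_rest_def[abs_def]
proof (intro Ck_add[OF Ck_mult Ck_mult] Ck_real heat_average_Ck[OF c])
  show "Ck k {c<..} (\<lambda>t. integral {c..t} (\<lambda>\<tau>. (s' \<tau> * single_layer (s \<tau>) (t - \<tau>) + double_layer (s \<tau>) (t - \<tau>)) * free_trace \<tau>))"
  proof (rule Ck_causal_integral)
    fix T
    let ?I = "{c<..<T}"
    have sub: "{c..T} \<subseteq> {0..}" using c by auto
    note [intro!] = Ck_param_const continuous_on_subset[OF free_trace_continuous sub]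
      continuous_on_subset[OF s_continuous sub] continuous_on_subset[OF s'_continuous sub]
    have d: "Ck_param k ?I {c..T} (\<lambda>t \<tau>. t - \<tau>)" by (intro Ck_param_diff Ck_param_id Ck_param_const continuous_intros)
    have sI: "Ck_param k ?I {c..T} (\<lambda>t \<tau>. s \<tau>)" "Ck_param k ?I {c..T} (\<lambda>t \<tau>. s' \<tau>)" "Ck_param k ?I {c..T} (\<lambda>t \<tau>. free_trace \<tau>)"
      by blast+
    show "Ck_param k ?I {c..T} (\<lambda>t \<tau>. (s' \<tau> * single_layer (s \<tau>) (t - \<tau>) + double_layer (s \<tau>) (t - \<tau>)) * free_trace \<tau>)"
      by (intro Ck_param_mult Ck_param_add Ck_param_layer sI d) (use s_pos c in auto)
  qed (simp add: layer_zero)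
qed

lemma dirichlet_of_neumann:
  assumes "Ck k {0<..} neumann_trace" shows "Ck k {0<..} dirichlet_trace"
proof (rule Ck_positive_half_line)
  fix c :: real assume c: "0 < c"
  have "Ck k {c<..} (abel c neumann_trace)"
    by (rule abel_Ck[OF c])
       (use c in \<open>auto intro: continuous_on_subset[OF neumann_trace_continuous] Ck_subset[OF assms]\<close>)
  then have "Ck k {c<..} (\<lambda>t. fixed_rest c t - 2 * gauss_const * abel c neumann_trace t)"
    by (intro Ck_diff Ck_mult[OF Ck_real] fixed_rest_Ck[OF c])
  then show "Ck k {c<..} dirichlet_trace"
    by (rule Ck_cong) (use fixed_equation[OF c] in auto)
qed

text \<open>
  Applying the Abel operator once more to the equation on \<open>x = 0\<close> turns it into an equation for the
  primitive of the Neumann trace.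
\<close>

lemma neumann_of_dirichlet:
  assumes "Ck (Suc k) {0<..} dirichlet_trace" shows "Ck k {0<..} neumann_trace"
proof (rule Ck_positive_half_line)
  fix c :: real assume c: "0 < c"
  have cN: "continuous_on {c..} neumann_trace"
    by (rule continuous_on_subset[OF neumann_trace_continuous]) (use c in auto)
  have "Ck (Suc k) {c<..} dirichlet_trace" by (rule Ck_subset[OF assms]) (use c in auto)
  then have "Ck (Suc k) {c<..} (\<lambda>t. 1 / (2 * gauss_const) * (fixed_rest c t - dirichlet_trace t))"
    by (intro Ck_mult Ck_real Ck_diff fixed_rest_Ck[OF c])
  then have half: "Ck (Suc k) {c<..} (abel c neumann_trace)"
    by (rule Ck_cong) (use fixed_equation[OF c] in \<open>auto simp: gauss_const_def\<close>)
  have "Ck (Suc k) {c<..} (\<lambda>t. 1 / pi * abel c (abel c neumann_trace) t)"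
    by (intro Ck_mult Ck_real abel_Ck[OF c abel_continuous_on[OF c cN] half])
  then have "Ck (Suc k) {c<..} (\<lambda>t. integral {c..t} neumann_trace)"
  proof (rule Ck_cong)
    fix t assume "t \<in> {c<..}"
    then show "1 / pi * abel c (abel c neumann_trace) t = integral {c..t} neumann_trace"
      using abel_abel[of c t neumann_trace] continuous_on_subset[OF cN] by auto
  qed simp
  then show "Ck k {c<..} neumann_trace"
    by (rule Ck_derivative[OF _ _ indefinite_integral_derivative[OF cN]]) auto
qed

text \<open>
  With \<open>d = gauss_const * s'\<close>, \<open>X = J (d * v)\<close> and \<open>R = v - X\<close>, where \<open>J\<close> is the Abel operator and \<open>v\<close> the
  trace, one has \<open>X = d * J X + J ((d \<tau> - d t) * X) + J (d * R)\<close>. The first term contains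
  \<open>J X = J (J (d * v))\<close>, a primitive; the second has a kernel vanishing on the diagonal; the third
  inherits the better regularity of \<open>R\<close>, whose kernel \<open>trace_kernel t \<tau> - d \<tau>\<close> also vanishes on the
  diagonal.
\<close>

lemma free_trace_gain:
  assumes s: "Ck (Suc (Suc k)) {0<..} s" and v: "Ck k {0<..} free_trace"
  shows "Ck (Suc k) {0<..} free_trace"
proof (rule Ck_positive_half_line)
  fix c :: real assume c: "0 < c"
  have s1: "Ck (Suc k) {0<..} s'" by (rule Ck_derivative[OF s _ s_deriv]) auto
  then obtain s'' where s'': "\<And>t. 0 < t \<Longrightarrow> (s' has_real_derivative s'' t) (at t)" "Ck k {0<..} s''"
    unfolding Ck_Suc by auto
  have s1k: "Ck k {0<..} s'" by (rule Ck_le[OF s1]) simp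
  define d where "d = (\<lambda>\<tau>. gauss_const * s' \<tau>)"
  define h where "h = (\<lambda>\<tau>. d \<tau> * free_trace \<tau>)"
  define X where "X = abel c h"
  define R where "R = (\<lambda>t. free_trace t - X t)"
  have sub: "{c..} \<subseteq> {0..}" "{c<..} \<subseteq> {0<..}" using c by auto
  have cv: "continuous_on {c..} free_trace" by (rule continuous_on_subset[OF free_trace_continuous sub(1)])
  have vc: "Ck k {c<..} free_trace" by (rule Ck_subset[OF v sub(2)])
  have cd: "continuous_on {c..} d"
    unfolding d_def by (intro continuous_intros continuous_on_subset[OF s'_continuous sub(1)])
  have d: "Ck (Suc k) {0<..} d" unfolding d_def by (intro Ck_mult Ck_real s1)
  have dc: "Ck (Suc k) {c<..} d" by (rule Ck_subset[OF d sub(2)])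
  have ch: "continuous_on {c..} h" unfolding h_def by (intro continuous_intros cd cv)
  have hk: "Ck k {c<..} h" unfolding h_def by (intro Ck_mult vc Ck_le[OF dc]) simp
  have cX: "continuous_on {c..} X" unfolding X_def by (rule abel_continuous_on[OF c ch])
  have Xk: "Ck k {c<..} X" unfolding X_def by (rule abel_Ck[OF c ch hk])
  have cR: "continuous_on {c..} R" unfolding R_def by (intro continuous_intros cv cX)
  \<comment> \<open>By the trace equation, \<open>R\<close> is the regular rest plus an Abel integral whose kernel vanishes on the diagonal.\<close>
  have RSk: "Ck (Suc k) {c<..} R"
  proof -
    let ?a = "\<lambda>t \<tau>. trace_kernel t \<tau> - d \<tau>"
    let ?\<mu> = "weighted_mean (\<lambda>\<eta>. 1 * \<eta>) s''"
    \<comment> \<open>The \<open>t\<close>-derivative of the kernel; \<open>?\<mu>\<close> is the \<open>t\<close>-derivative of the slope.\<close>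
    let ?\<alpha> = "\<lambda>t \<tau>. gauss_const * exp ((\<tau> - t) * (slope t \<tau> * slope t \<tau> * (1 / 4))) *
      (((- 1) * (slope t \<tau> * slope t \<tau> * (1 / 4)) + (\<tau> - t) * (slope t \<tau> * ?\<mu> t \<tau> * (1 / 2))) * (2 * s' \<tau> - slope t \<tau>) - ?\<mu> t \<tau>)"
    have \<alpha>: "smooth_kernel TYPE(real \<times> real) k ?\<alpha>"
      by (intro smooth_kernel_mult smooth_kernel_exp smooth_kernel_add smooth_kernel_diff smooth_kernel_const
          smooth_kernel_slope smooth_kernel_right smooth_kernel_left Ck_id smooth_kernel_weighted_mean s1k s'' continuous_intros)
    have gain: "Ck (Suc k) {c<..} (\<lambda>t. abel c (\<lambda>\<tau>. ?a t \<tau> * free_trace \<tau>) t)"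
    proof (rule abel_gain_Ck[OF c cv vc _ _ \<alpha>])
      show "?a \<tau> \<tau> = 0" if "0 < \<tau>" for \<tau>
        by (simp add: trace_kernel_def d_def slope_def weighted_mean_def)
      show "continuous_on {0<..} (?a t)" if "0 < t" for t
        using Ck_continuous[OF d] by (intro continuous_on_diff trace_kernel_row_continuous[OF that])
      fix r \<tau> :: real assume *: "0 < r" "0 < \<tau>"
      have m: "((\<lambda>r. slope r \<tau>) has_real_derivative ?\<mu> r \<tau>) (at r)"
        unfolding slope_def by (rule weighted_mean_deriv[OF s''(1) Ck_continuous[OF s''(2)] _ *]) auto
      show "((\<lambda>r. ?a r \<tau>) has_real_derivative ?\<alpha> r \<tau>) (at r)"
        unfolding trace_kernel_def
        by (rule derivative_eq_intros m refl)+ (simp add: algebra_simps)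
    qed
    have "Ck (Suc k) {0<..} s" by (rule Ck_le[OF s]) simp
    then have "Ck (Suc k) {c<..} (\<lambda>t. trace_rest c t + abel c (\<lambda>\<tau>. ?a t \<tau> * free_trace \<tau>) t)"
      by (intro Ck_add gain trace_rest_Ck[OF c])
    then show ?thesis
    proof (rule Ck_cong)
      fix t assume "t \<in> {c<..}"
      then have t: "c < t" "0 < t" using c by auto
      have sub': "{c..t} \<subseteq> {0<..}" "{c..t} \<subseteq> {c..}" using c by auto
      note cc = continuous_on_subset[OF trace_kernel_row_continuous[OF t(2)] sub'(1)]
        continuous_on_subset[OF cd sub'(2)] continuous_on_subset[OF cv sub'(2)] continuous_on_subset[OF ch sub'(2)]
      have "abel c (\<lambda>\<tau>. ?a t \<tau> * free_trace \<tau> + h \<tau>) t = abel c (\<lambda>\<tau>. ?a t \<tau> * free_trace \<tau>) t + X t"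
        unfolding X_def by (rule abel_add) (use t in \<open>auto intro!: continuous_intros cc\<close>)
      moreover have "(\<lambda>\<tau>. ?a t \<tau> * free_trace \<tau> + h \<tau>) = (\<lambda>\<tau>. trace_kernel t \<tau> * free_trace \<tau>)"
        by (simp add: h_def fun_eq_iff algebra_simps)
      ultimately show "trace_rest c t + abel c (\<lambda>\<tau>. ?a t \<tau> * free_trace \<tau>) t = R t"
        using trace_equation[OF c t(1)] by (simp add: R_def)
    qed simp
  qed
  \<comment> \<open>The commutator of \<open>d\<close> with the Abel operator.\<close>
  have comm: "Ck (Suc k) {c<..} (\<lambda>t. abel c (\<lambda>\<tau>. (d \<tau> - d t) * X \<tau>) t)"
  proof (rule abel_gain_Ck[OF c cX Xk, where \<alpha> = "\<lambda>t \<tau>. 0 - gauss_const * s'' t"])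
    show "smooth_kernel TYPE(real \<times> real) k (\<lambda>t \<tau>. 0 - gauss_const * s'' t)"
      by (intro smooth_kernel_diff smooth_kernel_mult smooth_kernel_const smooth_kernel_left s'')
    show "((\<lambda>r. d \<tau> - d r) has_real_derivative 0 - gauss_const * s'' r) (at r)" if "0 < r" for r \<tau>
      unfolding d_def by (intro DERIV_diff DERIV_const DERIV_cmult s'' that)
    show "continuous_on {0<..} (\<lambda>\<tau>. d \<tau> - d t)" for t
      using Ck_continuous[OF d] by (intro continuous_intros)
  qed simp
  have JdR: "Ck (Suc k) {c<..} (abel c (\<lambda>\<tau>. d \<tau> * R \<tau>))"
    by (rule abel_Ck[OF c]) (intro continuous_intros cd cR, intro Ck_mult dc RSk)
  have JX: "Ck (Suc k) {c<..} (\<lambda>t. pi * integral {c..t} h)"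
    by (intro Ck_mult Ck_real Ck_SucI[OF indefinite_integral_derivative[OF ch] hk]) simp
  have "Ck (Suc k) {c<..} (\<lambda>t. (d t * (pi * integral {c..t} h) + abel c (\<lambda>\<tau>. (d \<tau> - d t) * X \<tau>) t)
      + abel c (\<lambda>\<tau>. d \<tau> * R \<tau>) t + R t)"
    by (intro Ck_add Ck_mult dc JX comm JdR RSk)
  then show "Ck (Suc k) {c<..} free_trace"
  proof (rule Ck_cong)
    fix t assume "t \<in> {c<..}"
    then have t: "c \<le> t" by simp
    have sub': "{c..t} \<subseteq> {c..}" by auto
    note cc = continuous_on_subset[OF cd sub'] continuous_on_subset[OF cX sub'] continuous_on_subset[OF cR sub']
      continuous_on_subset[OF ch sub']
    have "X t = abel c (\<lambda>\<tau>. d \<tau> * X \<tau> + d \<tau> * R \<tau>) t"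
      unfolding X_def R_def by (simp add: h_def X_def algebra_simps)
    also have "\<dots> = abel c (\<lambda>\<tau>. d \<tau> * X \<tau>) t + abel c (\<lambda>\<tau>. d \<tau> * R \<tau>) t"
      by (rule abel_add[OF t]) (intro continuous_intros cc)+
    also have "abel c (\<lambda>\<tau>. d \<tau> * X \<tau>) t = abel c (\<lambda>\<tau>. d t * X \<tau> + (d \<tau> - d t) * X \<tau>) t"
      by (simp add: algebra_simps)
    also have "\<dots> = abel c (\<lambda>\<tau>. d t * X \<tau>) t + abel c (\<lambda>\<tau>. (d \<tau> - d t) * X \<tau>) t"
      by (rule abel_add[OF t]) (intro continuous_intros cc)+
    also have "abel c (\<lambda>\<tau>. d t * X \<tau>) t = d t * (pi * integral {c..t} h)"
      unfolding abel_cmult X_def using abel_abel[OF t cc(4)] by simp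
    finally show "(d t * (pi * integral {c..t} h) + abel c (\<lambda>\<tau>. (d \<tau> - d t) * X \<tau>) t)
      + abel c (\<lambda>\<tau>. d \<tau> * R \<tau>) t + R t = free_trace t"
      by (simp add: R_def)
  qed simp
qed

text \<open>
  The balance of the total mass. Through the integral condition for \<open>s'\<close> it becomes the differential
  equation for \<open>s\<close>.
\<close>

lemma mass_deriv:
  assumes "0 < t"
  shows "((\<lambda>r. integral {0..s r} (\<lambda>x. w x r)) has_real_derivative s' t * free_trace t - neumann_trace t) (at t)"
proof -
  have "((\<lambda>r. integral {0..s r} (\<lambda>x. 1 * w x r)) has_real_derivative
     (s' t * 1 - 0) * w (s t) t - (1 * wx 0 t - 0 * w 0 t)) (at t)"
    by (rule green_identity[where T = "t + 1" and G = "\<lambda>_ _. 1" and Gx = "\<lambda>_ _. 0" and Gxx = "\<lambda>_ _. 0"])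
       (use assms in \<open>auto simp: case_prod_unfold\<close>)
  then show ?thesis by (simp add: free_trace_def)
qed

end

section \<open>The regularity of the free boundary\<close>

theorem corollary3p4:
  fixes lam \<sigma> b :: real
    and f \<phi> s :: "real \<Rightarrow> real"
    and u :: "real \<Rightarrow> real \<Rightarrow> real"
  assumes "lam > 0" and "\<sigma> > 0" and "b > 0"
    and "\<phi> 0 = f 0"
    and "classical_solution lam \<sigma> b f \<phi> u s"
  shows "C_infinity_on {0<..} s \<longleftrightarrow> C_infinity_on {0<..} f"
proof -
  obtain ux ut uxx s' where sol: "has_continuous_partials s u ux ut uxx"
    "\<forall>t\<ge>0. (s has_real_derivative s' t) (at t within {0..})" "continuous_on {0..} s'" "\<forall>t\<ge>0. s t > 0"
    "\<forall>t>0. \<forall>x. 0 < x \<and> x < s t \<longrightarrow> ut x t = uxx x t - lam * u x t" "\<forall>t\<ge>0. u 0 t = f t"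
    "\<forall>t>0. ux (s t) t = 0" "\<forall>t>0. s' t = integral {0..s t} (\<lambda>x. u x t - \<sigma>)"
    using assms(5) unfolding classical_solution_def by (elim exE conjE) (rule that)
  note partials = sol(1) and cs' = sol(3)
  have s': "(s has_real_derivative s' t) (at t within {0..})" if "t \<ge> 0" for t using sol(2) that by blast
  have spos: "s t > 0" if "t \<ge> 0" for t using sol(4) that by blast
  have pde: "ut x t = uxx x t - lam * u x t" if "t > 0" "0 < x" "x < s t" for x t using sol(5) that by blast
  have dirichlet: "u 0 t = f t" if "t \<ge> 0" for t using sol(6) that by blast
  have neumann: "ux (s t) t = 0" if "t > 0" for t using sol(7) that by blast
  have stefan: "s' t = integral {0..s t} (\<lambda>x. u x t - \<sigma>)" if "t > 0" for t using sol(8) that by blast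
  define E where "E = (\<lambda>t. exp (lam * t))"
  define w where "w = (\<lambda>x t. E t * u x t)"
  define wx where "wx x t = E t * ux x t" for x t
  define wt where "wt x t = E t * (ut x t + lam * u x t)" for x t
  define wxx where "wxx x t = E t * uxx x t" for x t
  interpret heat_on_moving_domain s s' w wx wt wxx
  proof
    have cE: "continuous_on (fb_domain s) (\<lambda>z. E (snd z))" unfolding E_def by (intro continuous_intros)
    note cu = partials[unfolded has_continuous_partials_def case_prod_unfold]
    have E': "(E has_real_derivative lam * E t) (at t within S)" for t S
      unfolding E_def by (auto intro!: derivative_eq_intros)
    show "has_continuous_partials s w wx wt wxx"
      unfolding has_continuous_partials_def
    proof (intro conjI ballI)
      show "continuous_on (fb_domain s) (\<lambda>(x, t). w x t)" "continuous_on (fb_domain s) (\<lambda>(x, t). wx x t)"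
        "continuous_on (fb_domain s) (\<lambda>(x, t). wt x t)" "continuous_on (fb_domain s) (\<lambda>(x, t). wxx x t)"
        unfolding w_def wx_def wt_def wxx_def case_prod_unfold
        using cu by (auto intro!: continuous_intros cE)
      fix z assume z: "z \<in> fb_domain s"
      obtain x t where [simp]: "z = (x, t)" by force
      from cu z have d: "((\<lambda>y. u y t) has_real_derivative ux x t) (at x within {y. (y, t) \<in> fb_domain s})"
        "((\<lambda>\<tau>. u x \<tau>) has_real_derivative ut x t) (at t within {\<tau>. (x, \<tau>) \<in> fb_domain s})"
        "((\<lambda>y. ux y t) has_real_derivative uxx x t) (at x within {y. (y, t) \<in> fb_domain s})"
        by fastforce+
      show "case z of (x, t) \<Rightarrow>
          ((\<lambda>y. w y t) has_real_derivative wx x t) (at x within {y. (y, t) \<in> fb_domain s}) \<and>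
          (w x has_real_derivative wt x t) (at t within {\<tau>. (x, \<tau>) \<in> fb_domain s}) \<and>
          ((\<lambda>y. wx y t) has_real_derivative wxx x t) (at x within {y. (y, t) \<in> fb_domain s})"
        using DERIV_cmult[OF d(1), of "E t"] DERIV_mult[OF E' d(2)] DERIV_cmult[OF d(3), of "E t"]
        by (simp add: w_def wx_def wt_def wxx_def algebra_simps)
    qed
  qed (use s' cs' spos pde neumann in \<open>auto simp: wt_def wxx_def wx_def\<close>)
  have Epos: "E t > 0" for t by (simp add: E_def)
  have E_Ck: "Ck k I E" "Ck k I (\<lambda>t. 1 / E t)" for k and I :: "real set"
  proof -
    have "(\<lambda>t. 1 / E t) = (\<lambda>t. exp ((- lam) * t))" by (simp add: E_def exp_minus inverse_eq_divide)
    then show "Ck k I E" "Ck k I (\<lambda>t. 1 / E t)"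
      unfolding E_def by (auto intro!: Ck_compose[OF Ck_exp[of _ UNIV]] Ck_mult Ck_real Ck_id Ck_minus)
  qed
  define s'' where "s'' t = (s' t * free_trace t - neumann_trace t) / E t - lam * (s' t + \<sigma> * s t) - \<sigma> * s' t" for t
  have s''_deriv: "(s' has_real_derivative s'' t) (at t)" if t: "0 < t" for t
  proof -
    let ?m = "\<lambda>r. integral {0..s r} (\<lambda>x. w x r)"
    \<comment> \<open>The integral condition, written with \<open>w\<close>: it determines \<open>s'\<close> through the total mass of \<open>w\<close>, which is differentiable by Green's identity.\<close>
    have bal: "s' r = 1 / E r * ?m r - \<sigma> * s r" if r: "0 < r" for r
    proof -
      have cw: "continuous_on {0..s r} (\<lambda>x. w x r)"
        by (rule w_cont[OF partials_continuous(1)]) (use r in \<open>auto intro!: continuous_intros\<close>)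
      have "integral {0..s r} (\<lambda>x. u x r - \<sigma>) = integral {0..s r} (\<lambda>x. 1 / E r * w x r - \<sigma>)"
        by (simp add: w_def Epos[THEN less_imp_neq, symmetric])
      also have "\<dots> = integral {0..s r} (\<lambda>x. 1 / E r * w x r) - integral {0..s r} (\<lambda>x. \<sigma>)"
        by (intro integral_diff integrable_continuous_real continuous_intros cw)
      also have "integral {0..s r} (\<lambda>x. 1 / E r * w x r) = 1 / E r * ?m r"
        by (rule integral_mult_right)
      finally show ?thesis using stefan[OF r] spos[of r] r by (simp add: mult.commute)
    qed
    have iE: "((\<lambda>t. 1 / E t) has_real_derivative - lam * (1 / E t)) (at t)"
    proof -
      have "(\<lambda>t. 1 / E t) = (\<lambda>t. exp (- (lam * t)))" by (simp add: E_def exp_minus inverse_eq_divide)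
      then show ?thesis by (auto intro!: derivative_eq_intros simp: fun_eq_iff)
    qed
    have "((\<lambda>r. 1 / E r * ?m r - \<sigma> * s r) has_real_derivative s'' t) (at t)"
    proof (rule DERIV_cong[OF DERIV_diff[OF DERIV_mult[OF iE mass_deriv[OF t]] DERIV_cmult[OF s_deriv[OF t]]]])
      show "- lam * (1 / E t) * ?m t + (s' t * free_trace t - neumann_trace t) * (1 / E t) - \<sigma> * s' t = s'' t"
      proof -
        have "?m t = E t * (s' t + \<sigma> * s t)" using bal[OF t] Epos[of t] by simp
        then have "1 / E t * ?m t = s' t + \<sigma> * s t" using Epos[of t] by simp
        moreover have "- lam * (1 / E t) * ?m t = - lam * (1 / E t * ?m t)" by (simp only: mult.assoc)
        ultimately show ?thesis by (simp add: s''_def)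
      qed
    qed
    then show ?thesis
      by (rule has_field_derivative_transform_within_open[of _ _ _ "{0<..}"]) (use t bal in auto)
  qed
  have s'_Ck: "Ck k {0<..} s' \<Longrightarrow> Ck (Suc k) {0<..} s" for k
    by (rule Ck_SucI[OF s_deriv]) auto
  have s''_Ck: "Ck k {0<..} s'' \<Longrightarrow> Ck (Suc k) {0<..} s'" for k
    by (rule Ck_SucI[OF s''_deriv]) auto
  have v0: "Ck 0 {0<..} free_trace"
    unfolding Ck_0 by (rule continuous_on_subset[OF free_trace_continuous]) auto
  have f_w: "dirichlet_trace t = E t * f t" if "0 < t" for t
    using dirichlet[of t] that by (simp add: w_def)
  show ?thesis
    unfolding C_infinity_on_iff[OF open_greaterThan]
  proof
    assume f: "\<forall>k. Ck k {0<..} f"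
    have "Ck k {0<..} dirichlet_trace" for k
      by (rule Ck_cong[OF Ck_mult[OF E_Ck(1) f[rule_format]]]) (use f_w in auto)
    then have g: "Ck k {0<..} neumann_trace" for k
      using neumann_of_dirichlet by blast
    \<comment> \<open>The differential equation for \<open>s\<close> bounds the regularity of \<open>s''\<close> from below by that of \<open>s'\<close>, of the trace and of the smooth function \<open>wx 0\<close>.\<close>
    have step: "Ck (Suc (Suc k)) {0<..} s" if "Ck (Suc k) {0<..} s" "Ck k {0<..} free_trace" for k
    proof -
      have s1: "Ck k {0<..} s'" by (rule Ck_derivative[OF that(1) _ s_deriv]) auto
      have "Ck k {0<..} (\<lambda>t. (s' t * free_trace t - neumann_trace t) * (1 / E t) - lam * (s' t + \<sigma> * s t) - \<sigma> * s' t)"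
        by (intro Ck_diff Ck_mult Ck_add Ck_real E_Ck s1 that(2) g Ck_le[OF that(1)]) simp
      then have "Ck k {0<..} s''" unfolding s''_def[abs_def] by simp
      then show ?thesis by (intro s'_Ck s''_Ck)
    qed
    have "Ck (Suc k) {0<..} s \<and> Ck k {0<..} free_trace" for k
    proof (induction k)
      case 0
      show ?case using v0 s'_Ck[OF s'_continuous_Ck] by simp
    next
      case (Suc k)
      then show ?case using step free_trace_gain by blast
    qed
    then show "\<forall>k. Ck k {0<..} s" using Ck_le le_SucI by blast
  next
    assume s: "\<forall>k. Ck k {0<..} s"
    have s1: "Ck k {0<..} s'" for k by (rule Ck_derivative[OF s[rule_format] _ s_deriv]) auto
    have s2: "Ck k {0<..} s''" for k by (rule Ck_derivative[OF s1 _ s''_deriv]) auto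
    have v: "Ck k {0<..} free_trace" for k
      by (induction k) (use v0 free_trace_gain s in auto)
    have g: "Ck k {0<..} neumann_trace" for k
    proof -
      have "Ck k {0<..} (\<lambda>t. s' t * free_trace t - E t * (s'' t + lam * (s' t + \<sigma> * s t) + \<sigma> * s' t))"
        by (intro Ck_diff Ck_mult Ck_add Ck_real E_Ck s1 s2 v s[rule_format])
      then show ?thesis
        by (rule Ck_cong) (use Epos[THEN less_imp_neq, symmetric] in \<open>auto simp: s''_def\<close>)
    qed
    have "Ck k {0<..} (\<lambda>t. 1 / E t * dirichlet_trace t)" for k
      by (intro Ck_mult E_Ck dirichlet_of_neumann g)
    then show "\<forall>k. Ck k {0<..} f"
      by (intro allI, rule Ck_cong) (use f_w Epos[THEN less_imp_neq, symmetric] in auto)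
  qed
qed

end
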